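(* For any starting point $(x^0,\lambda^0)\in\mathcal X\times\mathbb R^n_+$, denote by $\overline C_{\mathsf{stoc}}$ the (primal) oracle complexity of the randomized IPDS algorithm (with the parameters and sub-problem solver described in the context), applied to the Lagrangian problem, to obtain an $\varepsilon$-optimal and $\varepsilon$-feasible solution of the constrained problem in expectation. Then $$\overline C_{\mathsf{stoc}}=O\bigg(\frac{\sqrt nM}{\sqrt{\mu\varepsilon}}\Big(\sqrt n+\sqrt{(L+\alpha)/\mu}\Big)\log\bigg(\frac{nM(L+\alpha)}{\mu\varepsilon}\bigg)\bigg).$$
   Context: Constrained problem: $\min_{x\in\mathcal X}f(x)+r(x)$ subject to $g_i(x)\le0$, $i=1,\dots,n$, where $\mathcal X\subseteq\mathbb R^d$ is nonempty, convex, compact with diameter $D_{\mathcal X}$ ($\mathbb R^d$ carries some norm $\|\cdot\|$ with dual norm $\|\cdot\|_*$), $f$ is $\mu$-strongly convex and $L$-smooth on $\mathcal X$ ($L\ge\mu>0$), $r$ is convex, closed, proper with $\mathcal X\subseteq\mathrm{dom}\,r$ and admits a distance generating function (DGF) $\overline\omega$ on $\mathcal X$ (convex, closed, proper, essentially smooth, $1$-strongly convex and continuous on $\mathcal X$, with $\min_{x\in\mathcal X}r(x)+\langle\upsilon,x\rangle+a^{-1}\overline\omega(x)$ having an easily computable unique solution in $\mathcal X^o:=\mathcal X\cap\mathrm{int}\,\mathrm{dom}\,\overline\omega$ for all $a>0$ and $\upsilon$), and each $g_i$ is convex and $\alpha_i$-smooth on $\mathcal X$. There is a Slater point in $\mathcal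 X^o$ at which all $g_i<0$. Let $x^*$ be the unique optimal solution. A random $\bar x\in\mathcal X$ is $\varepsilon$-optimal and $\varepsilon$-feasible in expectation if $\mathbb E[(f+r)(\bar x)]-(f+r)(x^* )\le\varepsilon$ and $\mathbb E[[g_i(\bar x)]_+]\le\varepsilon$ for all $i$, where $[a]_+:=\max\{a,0\}$. Lagrangian: $S(x,\lambda):=f(x)+r(x)+\frac1n\sum_{i=1}^nn\lambda_ig_i(x)$ on $\mathcal X\times\mathbb R^n_+$, with saddle point $(x^*,\lambda^* )$; $\psi^{\mathrm D}(\lambda):=\inf_{x\in\mathcal X}S(x,\lambda)$; $\Delta_\rho(x,\lambda):=\sup_{\lambda'\in\mathbb R^n_+}\{S(x,\lambda')-\frac\rho2\|\lambda'\|_2^2\}-\psi^{\mathrm D}(\lambda)$. $M_i:=\alpha_iD_{\mathcal X}+\inf_{x\in\mathcal X}\|\nabla g_i(x)\|_*$, $M:=\sum_{i=1}^nM_i$, $L_{\mathrm D}:=M^2/\mu>0$, $\alpha:=\sum_{i=1}^n\alpha_i$, $L_{xx}(\lambda):=\sum_{i=1}^n\lambda_i\alpha_i$. Primal oracle: returns $\nabla f(x)$ on input $(x,0)$ and $\lambda_i\nabla g_i(x)$ (up to normalization) on input $(x,\lambda,i)$; the oracle complexity is the number of calls (in expectation, since the cost of the runs depends on the random $\hat\lambda^k$ below). Randomized IPDS algorithm (specialized). Parameters $\rho_0=8L_{\mathrm D}$, $\tau_k=\frac{k+1}{k+3}$, $\gamma_k=\frac{\varepsilon}{4(k+3)}$,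 $\eta_k=0$. With $\widetilde\lambda_{\rho,0}(x):=([g_i(x)]_+/\rho)_{i=1}^n$ (the exact solution of $\max_{\lambda\in\mathbb R^n_+}\sum_i\lambda_ig_i(x)-\frac\rho2\|\lambda\|_2^2$), for $k=0,1,\dots$: $\hat\lambda^k=\tau_k\lambda^k+(1-\tau_k)\widetilde\lambda_{\rho_k,0}(x^k)$; produce $\widetilde x_{\gamma_k}(\hat\lambda^k)\in\mathcal X$ with $\mathbb E[S(\widetilde x_{\gamma_k}(\hat\lambda^k),\hat\lambda^k)-\psi^{\mathrm D}(\hat\lambda^k)\mid\mathcal F_{k,1}]\le\gamma_k$ a.s.; $x^{k+1}=\tau_kx^k+(1-\tau_k)\widetilde x_{\gamma_k}(\hat\lambda^k)$; $\rho_{k+1}=\tau_k\rho_k$; $\lambda^{k+1}=\tau_k\lambda^k+(1-\tau_k)\widetilde\lambda_{\rho_{k+1},0}(x^{k+1})$. Here $\mathcal F_{k,1}$ is the $\sigma$-field generated by all random quantities produced before $\widetilde x_{\gamma_k}(\hat\lambda^k)$. Sub-problem solver. $\widetilde x_{\gamma_k}(\hat\lambda^k)$ is computed by the randomized primal-dual gradient method (RPD). For $\min_{u\in\mathcal U}\Psi(u)=\phi_1(u)+\phi_2(u)$, $\mathcal U$ convex compact, $\phi_1=\frac1m\sum_{i=1}^m\varphi_i$ convex and $L'$-smooth with each $\varphi_i$ convex and smooth, $\Psi$ $\mu'$-strongly convex, $\phi_2$ convex with DGF $\pi$, $\kappa'=L'/\mu'$, minimizer $u^*$, its known guarantee from $u^0\in\mathcal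 U\cap\mathrm{int}\,\mathrm{dom}\,\pi$ is that $\mathbb E[\Psi(\tilde u^N)-\Psi(u^* )]\le e$ after $N=2(m+\sqrt{8m\kappa'})\log\big(2(L'/\sqrt{\mu'}+\sqrt{\mu'})^2(m+\sqrt{8m\kappa'})D_{\mathcal U,\pi}(u^0)/e\big)$ (rounded up) iterations, with $O(N)$ component-gradient oracle calls, where $D_{\mathcal U,\pi}(u^0)=\max_{u\in\mathcal U}[\pi(u)-\pi(u^0)-\langle\nabla\pi(u^0),u-u^0\rangle]<\infty$. Here $m=n$, $\phi_1=f+\frac1n\sum_in\hat\lambda^k_ig_i$, $\phi_2=r$, $L'=L+L_{xx}(\hat\lambda^k)$, $\mu'=\mu$; a fixed starting point in $\mathcal X^o$ is used. $O(\cdot)$ convention: $\varepsilon\to0$, i.e. the bound holds for all sufficiently small $\varepsilon>0$ (threshold depending on the other data); the implied constant may depend on $\lambda^0$, $\lambda^*$ and $[\Delta_{\rho_0}(x^0,\lambda^0)]_+/L_{\mathrm D}$. *)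

theory Defs
  imports "HOL-Probability.Probability"
begin

section \<open>Convex analysis on a finite-dimensional space with an arbitrary norm\<close>

text \<open>
  The space R^d is rendered as a finite-dimensional subspace \<open>E\<close> of a separable real inner
  product space \<open>'a\<close>; the case \<open>E = UNIV\<close> of a Euclidean type is included. With d fixed by
  the type, a constant that is existentially quantified in a theorem could depend on d; with d
  fixed by \<open>E\<close> it cannot, provided \<open>E\<close> is quantified after the constant.
  The inner product pairs points with dual vectors, and \<open>N\<close> is the (arbitrary) norm of R^d.
\<close>

definition finite_dim_subspace :: "'a::real_vector set \<Rightarrow> bool" where
  "finite_dim_subspace E \<longleftrightarrow> subspace E \<and> (\<exists>B. finite B \<and> E = span B)"

definition norm_on :: "'a::real_vector set \<Rightarrow> ('a \<Rightarrow> real) \<Rightarrow> bool" where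
  "norm_on E N \<longleftrightarrow>
     (\<forall>x\<in>E. 0 \<le> N x \<and> (N x = 0 \<longleftrightarrow> x = 0)) \<and>
     (\<forall>x\<in>E. \<forall>a. N (a *\<^sub>R x) = \<bar>a\<bar> * N x) \<and>
     (\<forall>x\<in>E. \<forall>y\<in>E. N (x + y) \<le> N x + N y)"

definition dual_norm :: "'a::real_inner set \<Rightarrow> ('a \<Rightarrow> real) \<Rightarrow> 'a \<Rightarrow> real" where
  "dual_norm E N y = (SUP x\<in>{x\<in>E. N x \<le> 1}. y \<bullet> x)"

definition diam :: "('a::real_vector \<Rightarrow> real) \<Rightarrow> 'a set \<Rightarrow> real" where
  "diam N X = (SUP (x, y)\<in>X \<times> X. N (x - y))"

definition has_gradient :: "'a::real_inner set \<Rightarrow> ('a \<Rightarrow> real) \<Rightarrow> 'a \<Rightarrow> 'a \<Rightarrow> bool" where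
  "has_gradient E h x D \<longleftrightarrow> D \<in> E \<and> (h has_derivative (\<lambda>v. D \<bullet> v)) (at x within E)"

definition grad :: "'a::real_inner set \<Rightarrow> ('a \<Rightarrow> real) \<Rightarrow> 'a \<Rightarrow> 'a" where
  "grad E h x = (THE D. has_gradient E h x D)"

definition smooth_on :: "'a::real_inner set \<Rightarrow> ('a \<Rightarrow> real) \<Rightarrow> 'a set \<Rightarrow> ('a \<Rightarrow> real) \<Rightarrow> real \<Rightarrow> bool" where
  "smooth_on E N X h L \<longleftrightarrow>
     (\<forall>x\<in>X. \<exists>D. has_gradient E h x D) \<and>
     (\<forall>x\<in>X. \<forall>y\<in>X. dual_norm E N (grad E h x - grad E h y) \<le> L * N (x - y))"

definition strongly_convex_on :: "('a::real_vector \<Rightarrow> real) \<Rightarrow> 'a set \<Rightarrow> ('a \<Rightarrow> real) \<Rightarrow> real \<Rightarrow> bool" where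
  "strongly_convex_on N X h m \<longleftrightarrow>
     convex X \<and>
     (\<forall>x\<in>X. \<forall>y\<in>X. \<forall>t\<in>{0..1}.
        h ((1 - t) *\<^sub>R x + t *\<^sub>R y)
          \<le> (1 - t) * h x + t * h y - m / 2 * t * (1 - t) * (N (x - y))\<^sup>2)"

definition eff_dom :: "'a set \<Rightarrow> ('a \<Rightarrow> ereal) \<Rightarrow> 'a set" where
  "eff_dom E h = {x\<in>E. h x < \<infinity>}"

definition closed_proper_convex :: "'a::real_normed_vector set \<Rightarrow> ('a \<Rightarrow> ereal) \<Rightarrow> bool" where
  "closed_proper_convex E h \<longleftrightarrow>
     convex {(x, t::real). x \<in> E \<and> h x \<le> ereal t} \<and>
     closed {(x, t::real). x \<in> E \<and> h x \<le> ereal t} \<and>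
     (\<forall>x\<in>E. h x \<noteq> -\<infinity>) \<and> eff_dom E h \<noteq> {}"

text \<open>The real-valued part of an extended function, used only where that function is finite.\<close>

abbreviation fin :: "('a \<Rightarrow> ereal) \<Rightarrow> 'a \<Rightarrow> real" where
  "fin h \<equiv> \<lambda>x. real_of_ereal (h x)"

definition int_dom :: "'a::topological_space set \<Rightarrow> ('a \<Rightarrow> ereal) \<Rightarrow> 'a set" where
  "int_dom E h = top_of_set E interior_of eff_dom E h"

definition essentially_smooth :: "'a::real_inner set \<Rightarrow> ('a \<Rightarrow> real) \<Rightarrow> ('a \<Rightarrow> ereal) \<Rightarrow> bool" where
  "essentially_smooth E N h \<longleftrightarrow>
     int_dom E h \<noteq> {} \<and>
     (\<forall>x\<in>int_dom E h. \<exists>D. has_gradient E (fin h) x D) \<and>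
     (\<forall>z l. (\<forall>j. z j \<in> int_dom E h) \<and> z \<longlonglongrightarrow> l \<and> l \<notin> int_dom E h \<longrightarrow>
        filterlim (\<lambda>j. dual_norm E N (grad E (fin h) (z j))) at_top sequentially)"

text \<open>\<open>dgf_on E N U h \<omega>\<close>: \<open>\<omega>\<close> is a distance generating function for \<open>h\<close> on \<open>U\<close>.\<close>

definition dgf_on ::
  "'a::real_inner set \<Rightarrow> ('a \<Rightarrow> real) \<Rightarrow> 'a set \<Rightarrow> ('a \<Rightarrow> ereal) \<Rightarrow> ('a \<Rightarrow> ereal) \<Rightarrow> bool" where
  "dgf_on E N U h \<omega> \<longleftrightarrow>
     closed_proper_convex E \<omega> \<and> essentially_smooth E N \<omega> \<and>
     U \<subseteq> eff_dom E \<omega> \<and> strongly_convex_on N U (fin \<omega>) 1 \<and> continuous_on U (fin \<omega>) \<and>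
     (\<forall>a>0. \<forall>v\<in>E. \<exists>x\<in>U \<inter> int_dom E \<omega>. \<forall>y\<in>U. y \<noteq> x \<longrightarrow>
        fin h x + v \<bullet> x + fin \<omega> x / a < fin h y + v \<bullet> y + fin \<omega> y / a)"

definition bregman_radius :: "'a::real_inner set \<Rightarrow> 'a set \<Rightarrow> ('a \<Rightarrow> ereal) \<Rightarrow> 'a \<Rightarrow> real" where
  "bregman_radius E U \<omega> u0 =
     (SUP u\<in>U. fin \<omega> u - fin \<omega> u0 - grad E (fin \<omega>) u0 \<bullet> (u - u0))"


section \<open>Composite finite-sum problems and the guarantee of RPD\<close>

record 'a composite_problem =
  co_space :: "'a set"
  co_norm :: "'a \<Rightarrow> real"
  co_set :: "'a set"
  co_m :: nat
  co_comp :: "nat \<Rightarrow> 'a \<Rightarrow> real"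
  co_reg :: "'a \<Rightarrow> ereal"
  co_dgf :: "'a \<Rightarrow> ereal"
  co_L :: real
  co_mu :: real

definition co_avg :: "'a composite_problem \<Rightarrow> 'a \<Rightarrow> real" where
  "co_avg Q u = (\<Sum>i<co_m Q. co_comp Q i u) / real (co_m Q)"

definition co_obj :: "'a composite_problem \<Rightarrow> 'a \<Rightarrow> real" where
  "co_obj Q u = co_avg Q u + fin (co_reg Q) u"

definition valid_composite :: "'a::real_inner composite_problem \<Rightarrow> bool" where
  "valid_composite Q \<longleftrightarrow>
     finite_dim_subspace (co_space Q) \<and> norm_on (co_space Q) (co_norm Q) \<and>
     co_set Q \<subseteq> co_space Q \<and> co_set Q \<noteq> {} \<and> convex (co_set Q) \<and> compact (co_set Q) \<and>
     0 < co_m Q \<and> 0 < co_L Q \<and> 0 < co_mu Q \<and>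
     (\<forall>i<co_m Q. convex_on (co_set Q) (co_comp Q i) \<and>
        (\<exists>l. smooth_on (co_space Q) (co_norm Q) (co_set Q) (co_comp Q i) l)) \<and>
     convex_on (co_set Q) (co_avg Q) \<and>
     smooth_on (co_space Q) (co_norm Q) (co_set Q) (co_avg Q) (co_L Q) \<and>
     closed_proper_convex (co_space Q) (co_reg Q) \<and>
     co_set Q \<subseteq> eff_dom (co_space Q) (co_reg Q) \<and>
     dgf_on (co_space Q) (co_norm Q) (co_set Q) (co_reg Q) (co_dgf Q) \<and>
     strongly_convex_on (co_norm Q) (co_set Q) (co_obj Q) (co_mu Q)"

definition rpd_work :: "'a composite_problem \<Rightarrow> real" where
  "rpd_work Q = real (co_m Q) + sqrt (8 * real (co_m Q) * (co_L Q / co_mu Q))"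

definition rpd_log_arg :: "'a::real_inner composite_problem \<Rightarrow> 'a \<Rightarrow> real \<Rightarrow> real" where
  "rpd_log_arg Q u0 e =
     2 * (co_L Q / sqrt (co_mu Q) + sqrt (co_mu Q))\<^sup>2 * rpd_work Q
       * bregman_radius (co_space Q) (co_set Q) (co_dgf Q) u0 / e"

definition rpd_iters :: "'a::real_inner composite_problem \<Rightarrow> 'a \<Rightarrow> real \<Rightarrow> nat" where
  "rpd_iters Q u0 e = nat \<lceil>2 * rpd_work Q * ln (rpd_log_arg Q u0 e)\<rceil>"

text \<open>
  A randomized solver maps a problem, a starting point and an iteration count to the joint law of
  its output and of the number of component gradients it evaluates.
\<close>

type_synonym 'a solver = "'a composite_problem \<Rightarrow> 'a \<Rightarrow> nat \<Rightarrow> ('a \<times> nat) measure"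

definition run_space :: "'a::topological_space set \<Rightarrow> ('a \<times> nat) measure" where
  "run_space U = restrict_space borel U \<Otimes>\<^sub>M count_space UNIV"

text \<open>
  The known guarantee of RPD, with \<open>c\<close> the constant hidden in \<open>O(N)\<close>. It is assumed only for
  accuracies \<open>e\<close> at which the logarithm is at least 1: otherwise the formula for the number of
  iterations may be nonpositive, or less than the cost of one pass over the components.
  The optimality gap is nonnegative, so its expectation is a Lebesgue integral in
  \<open>[0, \<infinity>]\<close>, without an integrability side condition.
\<close>

definition rpd_guarantee ::
  "real \<Rightarrow> 'a::{real_inner, second_countable_topology} solver \<Rightarrow> bool" where
  "rpd_guarantee c rpd \<longleftrightarrow>
     (\<forall>Q u0. valid_composite Q \<and> u0 \<in> co_set Q \<inter> int_dom (co_space Q) (co_dgf Q) \<longrightarrow>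
        (\<forall>k. rpd Q u0 k \<in> space (prob_algebra (run_space (co_set Q)))) \<and>
        (\<forall>e>0. 1 \<le> ln (rpd_log_arg Q u0 e) \<longrightarrow>
           (\<integral>\<^sup>+ (u, j). ennreal (co_obj Q u - (INF v\<in>co_set Q. co_obj Q v))
              \<partial>rpd Q u0 (rpd_iters Q u0 e)) \<le> ennreal e \<and>
           (AE (u, j) in rpd Q u0 (rpd_iters Q u0 e).
              real j \<le> c * real (rpd_iters Q u0 e))))"


section \<open>The constrained problem and its Lagrangian\<close>

text \<open>The constraints are indexed by \<open>0, \<dots>, n - 1\<close>.\<close>

record 'a constrained_problem =
  cp_space :: "'a set"
  cp_norm :: "'a \<Rightarrow> real"
  cp_set :: "'a set"
  cp_f :: "'a \<Rightarrow> real"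
  cp_r :: "'a \<Rightarrow> ereal"
  cp_dgf :: "'a \<Rightarrow> ereal"
  cp_n :: nat
  cp_g :: "nat \<Rightarrow> 'a \<Rightarrow> real"
  cp_L :: real
  cp_mu :: real
  cp_alpha :: "nat \<Rightarrow> real"

definition cp_interior :: "'a::topological_space constrained_problem \<Rightarrow> 'a set" where
  "cp_interior P = cp_set P \<inter> int_dom (cp_space P) (cp_dgf P)"

definition cp_obj :: "'a constrained_problem \<Rightarrow> 'a \<Rightarrow> real" where
  "cp_obj P x = cp_f P x + fin (cp_r P) x"

definition M_of :: "'a::real_inner constrained_problem \<Rightarrow> real" where
  "M_of P = (\<Sum>i<cp_n P. cp_alpha P i * diam (cp_norm P) (cp_set P)
     + (INF x\<in>cp_set P. dual_norm (cp_space P) (cp_norm P) (grad (cp_space P) (cp_g P i) x)))"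

definition L_D :: "'a::real_inner constrained_problem \<Rightarrow> real" where
  "L_D P = (M_of P)\<^sup>2 / cp_mu P"

definition alpha_of :: "'a constrained_problem \<Rightarrow> real" where
  "alpha_of P = (\<Sum>i<cp_n P. cp_alpha P i)"

definition L_xx :: "'a constrained_problem \<Rightarrow> (nat \<Rightarrow> real) \<Rightarrow> real" where
  "L_xx P lam = (\<Sum>i<cp_n P. lam i * cp_alpha P i)"

definition valid_problem :: "'a::real_inner constrained_problem \<Rightarrow> bool" where
  "valid_problem P \<longleftrightarrow>
     finite_dim_subspace (cp_space P) \<and> norm_on (cp_space P) (cp_norm P) \<and>
     cp_set P \<subseteq> cp_space P \<and> cp_set P \<noteq> {} \<and> convex (cp_set P) \<and> compact (cp_set P) \<and>
     0 < cp_mu P \<and> cp_mu P \<le> cp_L P \<and>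
     strongly_convex_on (cp_norm P) (cp_set P) (cp_f P) (cp_mu P) \<and>
     smooth_on (cp_space P) (cp_norm P) (cp_set P) (cp_f P) (cp_L P) \<and>
     closed_proper_convex (cp_space P) (cp_r P) \<and>
     cp_set P \<subseteq> eff_dom (cp_space P) (cp_r P) \<and>
     dgf_on (cp_space P) (cp_norm P) (cp_set P) (cp_r P) (cp_dgf P) \<and>
     (\<forall>i<cp_n P. convex_on (cp_set P) (cp_g P i) \<and> 0 \<le> cp_alpha P i \<and>
        smooth_on (cp_space P) (cp_norm P) (cp_set P) (cp_g P i) (cp_alpha P i)) \<and>
     (\<exists>x\<in>cp_interior P. \<forall>i<cp_n P. cp_g P i x < 0) \<and>
     0 < cp_n P \<and> 0 < L_D P"

text \<open>A vector of \<open>R^n\<close> is a sequence that vanishes from index \<open>n\<close> on.\<close>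

definition orthant :: "nat \<Rightarrow> (nat \<Rightarrow> real) set" where
  "orthant n = {lam. (\<forall>i<n. 0 \<le> lam i) \<and> (\<forall>i\<ge>n. lam i = 0)}"

definition lagrangian :: "'a constrained_problem \<Rightarrow> 'a \<Rightarrow> (nat \<Rightarrow> real) \<Rightarrow> real" where
  "lagrangian P x lam =
     cp_f P x + fin (cp_r P) x
       + 1 / real (cp_n P) * (\<Sum>i<cp_n P. real (cp_n P) * lam i * cp_g P i x)"

definition dual_fun :: "'a constrained_problem \<Rightarrow> (nat \<Rightarrow> real) \<Rightarrow> real" where
  "dual_fun P lam = (INF x\<in>cp_set P. lagrangian P x lam)"

definition smoothed_gap :: "'a constrained_problem \<Rightarrow> real \<Rightarrow> 'a \<Rightarrow> (nat \<Rightarrow> real) \<Rightarrow> real" where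
  "smoothed_gap P \<rho> x lam =
     (SUP lam'\<in>orthant (cp_n P). lagrangian P x lam' - \<rho> / 2 * (\<Sum>i<cp_n P. (lam' i)\<^sup>2))
       - dual_fun P lam"

definition optimal_solution :: "'a constrained_problem \<Rightarrow> 'a \<Rightarrow> bool" where
  "optimal_solution P x \<longleftrightarrow>
     x \<in> cp_set P \<and> (\<forall>i<cp_n P. cp_g P i x \<le> 0) \<and>
     (\<forall>y\<in>cp_set P. (\<forall>i<cp_n P. cp_g P i y \<le> 0) \<longrightarrow> cp_obj P x \<le> cp_obj P y)"

definition saddle_point :: "'a constrained_problem \<Rightarrow> 'a \<Rightarrow> (nat \<Rightarrow> real) \<Rightarrow> bool" where
  "saddle_point P x lam \<longleftrightarrow>
     x \<in> cp_set P \<and> lam \<in> orthant (cp_n P) \<and>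
     (\<forall>lam'\<in>orthant (cp_n P). lagrangian P x lam' \<le> lagrangian P x lam) \<and>
     (\<forall>y\<in>cp_set P. lagrangian P x lam \<le> lagrangian P y lam)"


section \<open>The randomized IPDS algorithm\<close>

definition tau :: "nat \<Rightarrow> real" where
  "tau k = (real k + 1) / (real k + 3)"

definition gam :: "real \<Rightarrow> nat \<Rightarrow> real" where
  "gam \<epsilon> k = \<epsilon> / (4 * (real k + 3))"

primrec rho :: "'a::real_inner constrained_problem \<Rightarrow> nat \<Rightarrow> real" where
  "rho P 0 = 8 * L_D P"
| "rho P (Suc k) = tau k * rho P k"

definition lam_tilde :: "'a constrained_problem \<Rightarrow> real \<Rightarrow> 'a \<Rightarrow> nat \<Rightarrow> real" where
  "lam_tilde P \<rho> x = (\<lambda>i. if i < cp_n P then max (cp_g P i x) 0 / \<rho> else 0)"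

definition lam_mix :: "nat \<Rightarrow> (nat \<Rightarrow> real) \<Rightarrow> (nat \<Rightarrow> real) \<Rightarrow> nat \<Rightarrow> real" where
  "lam_mix k lam lam' = (\<lambda>i. tau k * lam i + (1 - tau k) * lam' i)"

text \<open>
  The sub-problem \<open>min S(\<cdot>, lam)\<close> over the constraint set, with
  \<open>\<phi>\<^sub>1 = (1/n) \<Sum>\<^sub>i (f + n lam\<^sub>i g\<^sub>i)\<close> and \<open>\<phi>\<^sub>2 = r\<close>.
\<close>

definition subproblem :: "'a constrained_problem \<Rightarrow> (nat \<Rightarrow> real) \<Rightarrow> 'a composite_problem" where
  "subproblem P lam =
     \<lparr> co_space = cp_space P, co_norm = cp_norm P, co_set = cp_set P, co_m = cp_n P,
       co_comp = (\<lambda>i x. cp_f P x + real (cp_n P) * lam i * cp_g P i x),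
       co_reg = cp_r P, co_dgf = cp_dgf P,
       co_L = cp_L P + L_xx P lam, co_mu = cp_mu P \<rparr>"

text \<open>
  Measurability of the solver in the multiplier, needed for its composition with the random
  multipliers to make sense.
\<close>

definition solver_measurable ::
  "'a::{real_inner, second_countable_topology} constrained_problem \<Rightarrow> 'a solver \<Rightarrow> 'a \<Rightarrow> bool" where
  "solver_measurable P rpd u0 \<longleftrightarrow>
     (\<forall>k. (\<lambda>lam. rpd (subproblem P lam) u0 k)
        \<in> restrict_space borel (orthant (cp_n P)) \<rightarrow>\<^sub>M prob_algebra (run_space (cp_set P)))"

text \<open>A state consists of the two iterates and of the number of primal oracle calls so far.\<close>

definition ipds_space :: "'a::topological_space constrained_problem \<Rightarrow> ('a \<times> (nat \<Rightarrow> real) \<times> nat) measure" where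
  "ipds_space P =
     restrict_space borel (cp_set P) \<Otimes>\<^sub>M
       (restrict_space borel (orthant (cp_n P)) \<Otimes>\<^sub>M count_space UNIV)"

text \<open>
  \<open>ipds_law P rpd u0 \<epsilon> x0 lam0 k\<close> is the joint law of \<open>x^k\<close>, \<open>lambda^k\<close> and the number of primal
  oracle calls made in iterations \<open>0, \<dots>, k - 1\<close>. Each run of the solver uses fresh randomness: given the past,
  i.e. given the sigma-field \<open>F_(k,1)\<close>, its output is distributed according to the solver's law
  for the sub-problem at the current multiplier. A gradient of the component \<open>f + n lam\<^sub>i g\<^sub>i\<close>
  takes two primal oracle calls, on the inputs \<open>(x, 0)\<close> and \<open>(x, lam, i)\<close>.
\<close>

primrec ipds_law ::
  "'a::{real_inner, second_countable_topology} constrained_problem \<Rightarrow> 'a solver \<Rightarrow> 'a \<Rightarrow> real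
     \<Rightarrow> 'a \<Rightarrow> (nat \<Rightarrow> real) \<Rightarrow> nat \<Rightarrow> ('a \<times> (nat \<Rightarrow> real) \<times> nat) measure" where
  "ipds_law P rpd u0 \<epsilon> x0 lam0 0 = return (ipds_space P) (x0, lam0, 0)"
| "ipds_law P rpd u0 \<epsilon> x0 lam0 (Suc k) =
     ipds_law P rpd u0 \<epsilon> x0 lam0 k \<bind> (\<lambda>(x, lam, q).
       let lam_hat = lam_mix k lam (lam_tilde P (rho P k) x);
           Q = subproblem P lam_hat
       in rpd Q u0 (rpd_iters Q u0 (gam \<epsilon> k)) \<bind> (\<lambda>(x_tilde, j).
         let x' = tau k *\<^sub>R x + (1 - tau k) *\<^sub>R x_tilde;
             lam' = lam_mix k lam (lam_tilde P (rho P (Suc k)) x')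
         in return (ipds_space P) (x', lam', q + 2 * j)))"

text \<open>The law \<open>\<nu>\<close> of a state has an \<open>\<epsilon>\<close>-optimal and \<open>\<epsilon>\<close>-feasible primal iterate in expectation.\<close>

definition eps_solution ::
  "'a constrained_problem \<Rightarrow> 'a \<Rightarrow> real \<Rightarrow> ('a \<times> (nat \<Rightarrow> real) \<times> nat) measure \<Rightarrow> bool" where
  "eps_solution P x_opt \<epsilon> \<nu> \<longleftrightarrow>
     integrable \<nu> (\<lambda>(x, lam, q). cp_obj P x) \<and>
     (\<integral>(x, lam, q). cp_obj P x \<partial>\<nu>) - cp_obj P x_opt \<le> \<epsilon> \<and>
     (\<forall>i<cp_n P. integrable \<nu> (\<lambda>(x, lam, q). max (cp_g P i x) 0) \<and>
        (\<integral>(x, lam, q). max (cp_g P i x) 0 \<partial>\<nu>) \<le> \<epsilon>)"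

text \<open>
  The expected number of primal oracle calls until the first iterate that is an \<open>\<epsilon>\<close>-solution: the
  call counter is nondecreasing, so the infimum is attained at the first such index; it is
  \<open>\<infinity>\<close> if there is none.
\<close>

definition stoc_complexity ::
  "'a::{real_inner, second_countable_topology} constrained_problem \<Rightarrow> 'a solver \<Rightarrow> 'a
     \<Rightarrow> 'a \<Rightarrow> (nat \<Rightarrow> real) \<Rightarrow> 'a \<Rightarrow> real \<Rightarrow> ennreal" where
  "stoc_complexity P rpd u0 x0 lam0 x_opt \<epsilon> =
     (INF k\<in>{k. eps_solution P x_opt \<epsilon> (ipds_law P rpd u0 \<epsilon> x0 lam0 k)}.
        \<integral>\<^sup>+ (x, lam, q). of_nat q \<partial>ipds_law P rpd u0 \<epsilon> x0 lam0 k)"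

end

theory Submission
  imports Defs
begin

text \<open>
  Why the bound holds. Write \<open>F = f + r\<close>, let \<open>\<psi>\<close> be the dual function, and let
  \<open>F(x) + \<Sum>\<^sub>i [g\<^sub>i(x)]\<^sub>+\<^sup>2/(2\<rho>)\<close> be the smoothed primal function, the maximum over the multipliers of the
  Lagrangian minus the penalty \<open>\<rho>/2 |lam|\<^sup>2\<close>. The potential of a pair of iterates is
  \<open>V\<^sub>k = F(x) + \<Sum>\<^sub>i [g\<^sub>i(x)]\<^sub>+\<^sup>2/(2\<rho>\<^sub>k) - \<psi>(lam) + \<rho>\<^sub>k/2 |lam_opt|\<^sup>2\<close>, the smoothed duality gap plus a
  term that makes it nonnegative.

  An excessive-gap argument gives \<open>V\<^sub>k\<^sub>+\<^sub>1 \<le> \<tau>\<^sub>k V\<^sub>k + 2 \<delta>\<^sub>k\<close> for every outcome, where \<open>\<delta>\<^sub>k\<close> is the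
  inaccuracy of the sub-problem solution (\<open>gap_step\<close>, \<open>potential_step\<close>). Its core is a smoothness estimate for
  \<open>\<psi>\<close> at an approximate minimiser of the Lagrangian (\<open>dual_fun_inexact_descent\<close>), whose constant
  \<open>L_D = M\<^sup>2/\<mu>\<close> comes from the Lipschitz constants of the constraints. Since \<open>\<rho>\<^sub>k\<close> and the
  product of the \<open>\<tau>\<close>'s decrease like \<open>1/k\<^sup>2\<close> and \<open>E \<delta>\<^sub>k \<le> \<gamma>\<^sub>k\<close>, the expected potential is at most
  \<open>O(V\<^sub>0/k\<^sup>2) + \<epsilon>/4\<close> (\<open>expected_potential\<close>).

  The saddle point inequalities show that the optimality gap, each infeasibility \<open>[g\<^sub>i(x)]\<^sub>+\<close> and each new
  multiplier \<open>[g\<^sub>i(x)]\<^sub>+/\<rho>\<^sub>k\<close> are bounded by affine functions of \<open>V\<^sub>k\<close>. The first two facts make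
  the iterate an \<open>\<epsilon>\<close>-solution after \<open>K = O(M/\<surd>(\<mu>\<epsilon>))\<close> iterations (\<open>eps_solution_law\<close>). The third
  bounds the expectation of the random constant \<open>L_xx\<close> by \<open>O(\<alpha>)\<close> up to that time (\<open>expected_L_xx\<close>), because
  the expected potential is then still \<open>O(\<rho>\<^sub>k)\<close>. The cost of one run of the solver grows like
  \<open>\<surd>L_xx\<close> times a logarithm, which is again at most affine in \<open>L_xx\<close> (\<open>iters_le\<close>), so \<open>E L_xx\<close> controls
  the expected cost, and \<open>K\<close> times that cost is the claim (\<open>complexity_le\<close>).

  Expectations are taken of nonnegative functions as far as possible: a closed convex function that is finite on
  a compact convex set may be unbounded above there, so the integrability of the objective is itself a consequence of
  \<open>E V\<^sub>k < \<infinity>\<close>.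
\<close>


section \<open>Norms on a finite-dimensional subspace\<close>

lemma compact_box_combinations:
  fixes C :: "'a::real_normed_vector set"
  assumes "finite C"
  shows "compact {(\<Sum>b\<in>C. a b *\<^sub>R b) | a. \<forall>b\<in>C. \<bar>a b\<bar> \<le> R}"
  using assms
proof (induction C rule: finite_induct)
  case empty
  have "{(\<Sum>b\<in>{}. a b *\<^sub>R b) | a::'a \<Rightarrow> real. \<forall>b\<in>{}. \<bar>a b\<bar> \<le> R} = {0::'a}" by auto
  then show ?case by simp
next
  case (insert c C)
  have eq: "{(\<Sum>b\<in>insert c C. a b *\<^sub>R b) | a. \<forall>b\<in>insert c C. \<bar>a b\<bar> \<le> R}
    = {x + y | x y. x \<in> (\<lambda>t. t *\<^sub>R c) ` {-R..R} \<and>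
         y \<in> {(\<Sum>b\<in>C. a b *\<^sub>R b) | a. \<forall>b\<in>C. \<bar>a b\<bar> \<le> R}}" (is "?A = ?B")
  proof
    show "?A \<subseteq> ?B"
      using insert.hyps by (auto simp: abs_le_iff) fastforce
    show "?B \<subseteq> ?A"
    proof
      fix z assume "z \<in> ?B"
      then obtain t a where ta: "\<bar>t\<bar> \<le> R" "\<forall>b\<in>C. \<bar>a b\<bar> \<le> R" "z = t *\<^sub>R c + (\<Sum>b\<in>C. a b *\<^sub>R b)"
      proof -
        from \<open>z \<in> ?B\<close> obtain x y where xy: "z = x + y" "x \<in> (\<lambda>t. t *\<^sub>R c) ` {-R..R}"
          "y \<in> {(\<Sum>b\<in>C. a b *\<^sub>R b) | a. \<forall>b\<in>C. \<bar>a b\<bar> \<le> R}" by blast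
        from xy(2) obtain t where "t \<in> {-R..R}" "x = t *\<^sub>R c" by blast
        then have "\<bar>t\<bar> \<le> R" "x = t *\<^sub>R c" by auto
        with xy(1,3) that show thesis by blast
      qed
      let ?a = "a(c := t)"
      have "(\<Sum>b\<in>C. ?a b *\<^sub>R b) = (\<Sum>b\<in>C. a b *\<^sub>R b)"
        using insert.hyps by (intro sum.cong) auto
      then have "z = (\<Sum>b\<in>insert c C. ?a b *\<^sub>R b)" "\<forall>b\<in>insert c C. \<bar>?a b\<bar> \<le> R"
        using ta insert.hyps by auto
      then show "z \<in> ?A" by blast
    qed
  qed
  have "compact ((\<lambda>t. t *\<^sub>R c) ` {-R..R})"
    by (intro compact_continuous_image continuous_intros) auto
  then show ?case unfolding eq using insert.IH by (rule compact_sums)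
qed

lemma norm_onD:
  assumes "norm_on E N"
  shows "x \<in> E \<Longrightarrow> 0 \<le> N x" "x \<in> E \<Longrightarrow> N x = 0 \<longleftrightarrow> x = 0"
    "x \<in> E \<Longrightarrow> N (a *\<^sub>R x) = \<bar>a\<bar> * N x"
    "x \<in> E \<Longrightarrow> y \<in> E \<Longrightarrow> N (x + y) \<le> N x + N y"
  using assms by (auto simp: norm_on_def)

lemma norm_on_sum_le:
  assumes "norm_on E N" "subspace E" "finite C" "C \<subseteq> E"
  shows "N (\<Sum>b\<in>C. a b *\<^sub>R b) \<le> (\<Sum>b\<in>C. \<bar>a b\<bar> * N b)"
  using assms(3,4)
proof (induction C rule: finite_induct)
  case empty
  then show ?case using norm_onD(2)[OF assms(1), of 0] assms(2) by (simp add: subspace_0)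
next
  case (insert c C)
  have "a c *\<^sub>R c \<in> E" "(\<Sum>b\<in>C. a b *\<^sub>R b) \<in> E"
    using insert assms(2) by (auto intro!: subspace_sum subspace_scale)
  then show ?case
    using insert norm_onD(4)[OF assms(1), of "a c *\<^sub>R c" "\<Sum>b\<in>C. a b *\<^sub>R b"]
      norm_onD(3)[OF assms(1), of c "a c"] by simp
qed

lemma norm_on_minus_commute:
  assumes "norm_on E N" "subspace E" "x \<in> E" "y \<in> E"
  shows "N (x - y) = N (y - x)"
  using norm_onD(3)[OF assms(1), of "x - y" "-1"] assms by (simp add: subspace_diff)

text \<open>
  All norms on a finite-dimensional space are equivalent. An orthogonal basis bounds \<open>N\<close> by a
  multiple of the Euclidean norm and shows that the Euclidean unit sphere is compact; on it the
  continuous function \<open>N\<close> attains a positive minimum. It is this that makes the supremum in the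
  definition of the dual norm a finite one.
\<close>

lemma norm_on_equivalent:
  fixes E :: "'a::real_inner set"
  assumes fd: "finite_dim_subspace E" and N: "norm_on E N"
  shows "\<exists>c>0. (\<forall>x\<in>E. N x \<le> c * norm x) \<and> (\<forall>x\<in>E. norm x \<le> c * N x)"
proof -
  from fd obtain B where sE: "subspace E" and B: "finite B" "E = span B"
    by (auto simp: finite_dim_subspace_def)
  from basis_orthogonal[OF B(1)] obtain C0 where
    C0: "finite C0" "span C0 = E" "pairwise orthogonal C0" using B by auto
  define C where "C = C0 - {0}"
  have C: "finite C" "span C = E" "pairwise orthogonal C" "0 \<notin> C"
    using C0 by (auto simp: C_def span_delete_0 intro: pairwise_mono)
  have CE: "C \<subseteq> E" using C(2) span_superset by blast
  have rep: "\<exists>a. x = (\<Sum>b\<in>C. a b *\<^sub>R b) \<and> (\<forall>b\<in>C. \<bar>a b\<bar> \<le> norm x * (\<Sum>b\<in>C. 1 / norm b))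
      \<and> (\<forall>b\<in>C. \<bar>a b\<bar> \<le> norm x / norm b)" if "x \<in> E" for x
  proof -
    from that C(2) obtain a where a: "x = (\<Sum>b\<in>C. a b *\<^sub>R b)"
      using span_finite[OF C(1)] by auto
    have ab: "\<bar>a b\<bar> \<le> norm x / norm b" if b: "b \<in> C" for b
    proof -
      have "x \<bullet> b = (\<Sum>b'\<in>C. if b' = b then a b * (b \<bullet> b) else 0)"
        unfolding a inner_sum_left
      proof (rule sum.cong[OF refl])
        fix b' assume "b' \<in> C"
        then have "b' \<noteq> b \<Longrightarrow> b' \<bullet> b = 0"
          using C(3) b by (auto simp: pairwise_def orthogonal_def)
        then show "a b' *\<^sub>R b' \<bullet> b = (if b' = b then a b * (b \<bullet> b) else 0)" by auto
      qed
      also have "\<dots> = a b * (b \<bullet> b)" using b C(1) by simp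
      finally have "\<bar>a b\<bar> * (norm b)\<^sup>2 \<le> norm x * norm b"
        using Cauchy_Schwarz_ineq2[of x b] by (simp add: abs_mult power2_norm_eq_inner)
      moreover have "norm b > 0" using b C(4) by auto
      ultimately show ?thesis by (simp add: field_simps power2_eq_square)
    qed
    have "\<bar>a b\<bar> \<le> norm x * (\<Sum>b\<in>C. 1 / norm b)" if b: "b \<in> C" for b
    proof -
      have "1 / norm b \<le> (\<Sum>b\<in>C. 1 / norm b)"
        by (rule member_le_sum[OF b]) (use C in auto)
      then have "norm x * (1 / norm b) \<le> norm x * (\<Sum>b\<in>C. 1 / norm b)"
        by (intro mult_left_mono) auto
      then show ?thesis using ab[OF b] by simp
    qed
    with a ab show ?thesis by blast
  qed
  define c1 where "c1 = (\<Sum>b\<in>C. N b / norm b)"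
  have c1: "N x \<le> c1 * norm x" if "x \<in> E" for x
  proof -
    from rep[OF that] obtain a where a: "x = (\<Sum>b\<in>C. a b *\<^sub>R b)" "\<forall>b\<in>C. \<bar>a b\<bar> \<le> norm x / norm b"
      by blast
    have "N x \<le> (\<Sum>b\<in>C. \<bar>a b\<bar> * N b)"
      using norm_on_sum_le[OF N sE C(1) CE] a(1) by simp
    also have "\<dots> \<le> (\<Sum>b\<in>C. norm x / norm b * N b)"
      using a(2) CE norm_onD(1)[OF N] by (intro sum_mono mult_right_mono) auto
    also have "\<dots> = c1 * norm x"
      by (simp add: c1_def sum_distrib_right)
        (intro sum.cong, auto simp: mult.commute)
    finally show ?thesis .
  qed
  have c1_nonneg: "c1 \<ge> 0"
    unfolding c1_def using CE norm_onD(1)[OF N] by (intro sum_nonneg) auto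
  define S where "S = {x\<in>E. norm x = 1}"
  define R where "R = (\<Sum>b\<in>C. 1 / norm b)"
  let ?K = "{(\<Sum>b\<in>C. a b *\<^sub>R b) | a. \<forall>b\<in>C. \<bar>a b\<bar> \<le> R}"
  have "S = ?K \<inter> {x. norm x = 1}"
  proof
    show "S \<subseteq> ?K \<inter> {x. norm x = 1}"
    proof
      fix x assume "x \<in> S"
      then have "x \<in> E" "norm x = 1" by (auto simp: S_def)
      with rep[of x] show "x \<in> ?K \<inter> {x. norm x = 1}" by (auto simp: R_def)
    qed
    show "?K \<inter> {x. norm x = 1} \<subseteq> S"
      using CE sE by (auto simp: S_def intro!: subspace_sum subspace_scale)
  qed
  moreover have "closed {x::'a. norm x = 1}"
    by (intro closed_Collect_eq continuous_intros)
  ultimately have cS: "compact S"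
    using compact_Int_closed[OF compact_box_combinations[OF C(1)]] by simp
  have Nlip: "\<bar>N x - N y\<bar> \<le> c1 * norm (x - y)" if "x \<in> E" "y \<in> E" for x y
  proof -
    have "N x \<le> N (x - y) + N y" "N y \<le> N (y - x) + N x"
      using norm_onD(4)[OF N, of "x - y" y] norm_onD(4)[OF N, of "y - x" x] that sE
      by (auto simp: subspace_diff)
    then show ?thesis
      using norm_on_minus_commute[OF N sE that] c1[of "x - y"] that sE
      by (simp add: subspace_diff abs_le_iff)
  qed
  have "continuous_on S N"
  proof (rule continuous_onI)
    fix x e assume x: "x \<in> S" and e: "0 < (e::real)"
    show "\<exists>d>0. \<forall>x'\<in>S. dist x' x < d \<longrightarrow> dist (N x') (N x) \<le> e"
    proof (intro exI conjI ballI impI)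
      show "0 < e / (c1 + 1)" using e c1_nonneg by simp
      fix x' assume x': "x' \<in> S" "dist x' x < e / (c1 + 1)"
      have "\<bar>N x' - N x\<bar> \<le> c1 * norm (x' - x)" using Nlip x x' by (auto simp: S_def)
      also have "\<dots> \<le> (c1 + 1) * norm (x' - x)" by (intro mult_right_mono) auto
      also have "\<dots> \<le> e"
        using x'(2) c1_nonneg by (simp add: dist_norm pos_less_divide_eq mult.commute)
      finally show "dist (N x') (N x) \<le> e" by (simp add: dist_real_def)
    qed
  qed
  have "\<exists>m>0. \<forall>x\<in>S. m \<le> N x"
  proof (cases "S = {}")
    case False
    from continuous_attains_inf[OF cS False \<open>continuous_on S N\<close>]
    obtain x where x: "x \<in> S" "\<forall>y\<in>S. N x \<le> N y" by blast
    then have "x \<in> E" "x \<noteq> 0" by (auto simp: S_def)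
    then have "N x > 0" using norm_onD(1,2)[OF N, of x] by force
    then show ?thesis using x by blast
  qed (auto intro: exI[of _ 1])
  then obtain m where m: "m > 0" "\<forall>x\<in>S. m \<le> N x" by blast
  have low: "norm x \<le> (1 / m) * N x" if x: "x \<in> E" for x
  proof (cases "x = 0")
    case True
    then show ?thesis using norm_onD(2)[OF N x] by simp
  next
    case False
    then have "(1 / norm x) *\<^sub>R x \<in> S" using x sE by (auto simp: S_def subspace_scale)
    then have "m \<le> (1 / norm x) * N x"
      using m(2) norm_onD(3)[OF N x, of "1 / norm x"] by fastforce
    then show ?thesis using False m(1) by (simp add: field_simps)
  qed
  show ?thesis
  proof (intro exI conjI ballI)
    show "0 < c1 + 1 / m" using c1_nonneg m by (simp add: add_nonneg_pos)
    fix x assume x: "x \<in> E"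
    have "0 \<le> N x" "0 \<le> N x / m" "0 \<le> norm x / m" "0 \<le> c1 * N x"
      using norm_onD(1)[OF N x] m(1) c1_nonneg by auto
    then show "N x \<le> (c1 + 1 / m) * norm x" "norm x \<le> (c1 + 1 / m) * N x"
      using c1[OF x] low[OF x] by (simp_all add: distrib_right)
  qed
qed

locale normed_subspace =
  fixes E :: "'a::real_inner set" and N :: "'a \<Rightarrow> real"
  assumes finite_dim: "finite_dim_subspace E" and norm_on: "norm_on E N"
begin

lemma subspace: "subspace E"
  using finite_dim by (simp add: finite_dim_subspace_def)

lemmas N_nonneg = norm_onD(1)[OF norm_on]
lemmas N_eq_0_iff = norm_onD(2)[OF norm_on]
lemmas N_scale = norm_onD(3)[OF norm_on]
lemmas N_minus_commute = norm_on_minus_commute[OF norm_on subspace]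

lemma N_pos: "x \<in> E \<Longrightarrow> x \<noteq> 0 \<Longrightarrow> 0 < N x"
  using N_nonneg N_eq_0_iff by force

lemma bdd_above_dual_norm: "bdd_above ((\<lambda>x. y \<bullet> x) ` {x \<in> E. N x \<le> 1})"
proof -
  obtain c where c: "c > 0" "\<And>x. x \<in> E \<Longrightarrow> norm x \<le> c * N x"
    using norm_on_equivalent[OF finite_dim norm_on] by blast
  have "y \<bullet> x \<le> norm y * c" if "x \<in> E" "N x \<le> 1" for x
  proof -
    have "y \<bullet> x \<le> norm y * norm x" using Cauchy_Schwarz_ineq2[of y x] by simp
    also have "\<dots> \<le> norm y * (c * 1)"
      using order_trans[OF c(2)[OF that(1)] mult_left_mono[OF that(2), of c]] c(1)
      by (intro mult_left_mono) auto
    finally show ?thesis by simp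
  qed
  then show ?thesis by (auto intro!: bdd_aboveI)
qed

lemma inner_le_dual_norm:
  assumes x: "x \<in> E"
  shows "y \<bullet> x \<le> dual_norm E N y * N x"
proof (cases "x = 0")
  case False
  let ?z = "(1 / N x) *\<^sub>R x"
  have "?z \<in> {x \<in> E. N x \<le> 1}"
    using x False N_pos[of x] N_scale[of x "1 / N x"] subspace by (auto simp: subspace_scale)
  then have "y \<bullet> ?z \<le> dual_norm E N y"
    unfolding dual_norm_def by (intro cSUP_upper bdd_above_dual_norm)
  then show ?thesis using N_pos[OF x False] by (simp add: field_simps)
qed (use N_eq_0_iff[of 0] subspace_0[OF subspace] in auto)

lemma zero_in_unit_ball: "0 \<in> {x \<in> E. N x \<le> 1}"
  using subspace_0[OF subspace] N_eq_0_iff[of 0] by auto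

lemma dual_norm_nonneg: "0 \<le> dual_norm E N y"
  using cSUP_upper[OF zero_in_unit_ball bdd_above_dual_norm, of y] by (simp add: dual_norm_def)

lemma dual_norm_triangle: "dual_norm E N (y + z) \<le> dual_norm E N y + dual_norm E N z"
proof -
  have "(y + z) \<bullet> x \<le> dual_norm E N y + dual_norm E N z" if "x \<in> {x \<in> E. N x \<le> 1}" for x
    using cSUP_upper[OF that bdd_above_dual_norm, of y] cSUP_upper[OF that bdd_above_dual_norm, of z]
    by (simp add: dual_norm_def inner_add_left)
  moreover have "{x \<in> E. N x \<le> 1} \<noteq> {}" using zero_in_unit_ball by blast
  ultimately show ?thesis
    unfolding dual_norm_def[of _ _ "y + z"] by (intro cSUP_least)
qed

lemma dual_norm_scale_le:
  assumes "0 \<le> a"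
  shows "dual_norm E N (a *\<^sub>R y) \<le> a * dual_norm E N y"
proof -
  have "(a *\<^sub>R y) \<bullet> x \<le> a * dual_norm E N y" if "x \<in> {x \<in> E. N x \<le> 1}" for x
    using mult_left_mono[OF cSUP_upper[OF that bdd_above_dual_norm, of y] assms]
    by (simp add: dual_norm_def)
  moreover have "{x \<in> E. N x \<le> 1} \<noteq> {}" using zero_in_unit_ball by blast
  ultimately show ?thesis
    unfolding dual_norm_def[of _ _ "a *\<^sub>R y"] by (intro cSUP_least)
qed

lemma norm_diff_le_diam:
  assumes "bounded X" "X \<subseteq> E" "x \<in> X" "y \<in> X"
  shows "N (x - y) \<le> diam N X"
proof -
  obtain c where c: "c > 0" "\<And>x. x \<in> E \<Longrightarrow> N x \<le> c * norm x"
    using norm_on_equivalent[OF finite_dim norm_on] by blast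
  obtain r where r: "\<And>x. x \<in> X \<Longrightarrow> norm x \<le> r" using assms(1) by (auto simp: bounded_iff)
  have "N (u - v) \<le> c * (r + r)" if "u \<in> X" "v \<in> X" for u v
  proof -
    have "N (u - v) \<le> c * norm (u - v)" using that assms(2) by (intro c subspace_diff[OF subspace]) auto
    also have "\<dots> \<le> c * (r + r)"
      using norm_triangle_ineq4[of u v] r[OF that(1)] r[OF that(2)] c(1) by (intro mult_left_mono) auto
    finally show ?thesis .
  qed
  then have "bdd_above ((\<lambda>(x, y). N (x - y)) ` (X \<times> X))" by (auto intro!: bdd_aboveI)
  from cSUP_upper[OF _ this, of "(x, y)"] assms show ?thesis by (simp add: diam_def)
qed


section \<open>Gradients relative to a subspace\<close>

text \<open>A line with direction in \<open>E\<close> stays in \<open>E\<close>, so the relative gradient gives an ordinary derivative along it. From this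
  follow the uniqueness of the gradient, the mean value estimate and the first-order inequality below.\<close>

lemma has_gradient_line:
  assumes h: "has_gradient E h (x + t *\<^sub>R v) D" and E: "x \<in> E" "v \<in> E"
  shows "((\<lambda>s. h (x + s *\<^sub>R v)) has_derivative (\<lambda>s. s * (D \<bullet> v))) (at t within S)"
proof -
  have sub: "(\<lambda>s. x + s *\<^sub>R v) ` S \<subseteq> E"
    using E subspace by (auto intro!: subspace_add subspace_scale)
  have "((\<lambda>s. x + s *\<^sub>R v) has_derivative (\<lambda>s. s *\<^sub>R v)) (at t within S)"
    by (auto intro!: derivative_eq_intros)
  moreover have "(h has_derivative (\<lambda>v. D \<bullet> v)) (at (x + t *\<^sub>R v) within (\<lambda>s. x + s *\<^sub>R v) ` S)"
    using h sub by (auto simp: has_gradient_def intro: has_derivative_subset)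
  ultimately show ?thesis
    using has_derivative_in_compose[of "\<lambda>s. x + s *\<^sub>R v" "\<lambda>s. s *\<^sub>R v" t S h "\<lambda>v. D \<bullet> v"]
    by simp
qed

lemma has_gradient_unique:
  assumes D: "has_gradient E h x D" "has_gradient E h x D'" and x: "x \<in> E"
  shows "D = D'"
proof -
  have "D \<in> E" "D' \<in> E" using D by (auto simp: has_gradient_def)
  then have v: "D - D' \<in> E" using subspace by (simp add: subspace_diff)
  have "(\<lambda>s::real. s * (D \<bullet> (D - D'))) = (\<lambda>s. s * (D' \<bullet> (D - D')))"
    using has_gradient_line[of h x 0 "D - D'" D UNIV] has_gradient_line[of h x 0 "D - D'" D' UNIV]
      D x v by (intro has_derivative_unique) auto
  from fun_cong[OF this, of 1] have "(D - D') \<bullet> (D - D') = 0" by (simp add: inner_diff_left)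
  then show ?thesis by simp
qed

lemma grad_eq: "has_gradient E h x D \<Longrightarrow> x \<in> E \<Longrightarrow> grad E h x = D"
  unfolding grad_def by (rule the_equality) (auto intro: has_gradient_unique)

lemma has_gradient_const: "has_gradient E (\<lambda>_. a) x 0"
  using subspace by (auto simp: has_gradient_def subspace_0)

lemma has_gradient_add:
  "has_gradient E h x D \<Longrightarrow> has_gradient E h' x D' \<Longrightarrow> has_gradient E (\<lambda>x. h x + h' x) x (D + D')"
  using subspace by (auto simp: has_gradient_def subspace_add inner_add_left intro!: derivative_eq_intros)

lemma has_gradient_scale:
  assumes "has_gradient E h x D"
  shows "has_gradient E (\<lambda>x. a * h x) x (a *\<^sub>R D)"
  using assms subspace has_derivative_mult_right[of h "\<lambda>v. D \<bullet> v" "at x within E" a]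
  by (auto simp: has_gradient_def subspace_scale)

lemma smooth_onD:
  assumes "smooth_on E N X h l" "x \<in> X" "x \<in> E"
  shows "has_gradient E h x (grad E h x)"
  using assms grad_eq by (auto simp: smooth_on_def)

lemma smooth_on_continuous:
  assumes "smooth_on E N X h l" "X \<subseteq> E"
  shows "continuous_on X h"
  unfolding continuous_on_eq_continuous_within
proof
  fix x assume "x \<in> X"
  with smooth_onD[OF assms(1), of x] assms(2)
  have "(h has_derivative (\<lambda>v. grad E h x \<bullet> v)) (at x within E)" by (auto simp: has_gradient_def)
  then have "continuous (at x within E) h" by (rule has_derivative_continuous)
  then show "continuous (at x within X) h" using assms(2) by (rule continuous_within_subset)
qed

lemma smooth_on_const:
  assumes "X \<subseteq> E"
  shows "smooth_on E N X (\<lambda>_. a) 0"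
proof -
  have "grad E (\<lambda>_. a) x = 0" if "x \<in> X" for x
    using that assms by (intro grad_eq has_gradient_const) auto
  moreover have "dual_norm E N 0 = 0"
    unfolding dual_norm_def inner_zero_left using zero_in_unit_ball by (intro cSUP_const) blast
  ultimately show ?thesis using has_gradient_const by (auto simp: smooth_on_def)
qed

lemma smooth_on_add:
  assumes X: "X \<subseteq> E" and h: "smooth_on E N X h l" and h': "smooth_on E N X h' l'"
  shows "smooth_on E N X (\<lambda>x. h x + h' x) (l + l')"
proof -
  have g: "has_gradient E (\<lambda>x. h x + h' x) x (grad E h x + grad E h' x)" if "x \<in> X" for x
    using that X smooth_onD[OF h] smooth_onD[OF h'] by (auto intro: has_gradient_add)
  then have g': "grad E (\<lambda>x. h x + h' x) x = grad E h x + grad E h' x" if "x \<in> X" for x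
    using that X by (intro grad_eq) auto
  have "dual_norm E N (grad E (\<lambda>x. h x + h' x) x - grad E (\<lambda>x. h x + h' x) y) \<le> (l + l') * N (x - y)"
    if "x \<in> X" "y \<in> X" for x y
  proof -
    have "dual_norm E N (grad E (\<lambda>x. h x + h' x) x - grad E (\<lambda>x. h x + h' x) y)
      \<le> dual_norm E N (grad E h x - grad E h y) + dual_norm E N (grad E h' x - grad E h' y)"
      using dual_norm_triangle[of "grad E h x - grad E h y" "grad E h' x - grad E h' y"] that
      by (simp add: g' algebra_simps)
    then show ?thesis
      using h h' that unfolding smooth_on_def by (fastforce simp: distrib_right)
  qed
  with g show ?thesis unfolding smooth_on_def by blast
qed

lemma smooth_on_scale:
  assumes X: "X \<subseteq> E" and h: "smooth_on E N X h l" and a: "0 \<le> a"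
  shows "smooth_on E N X (\<lambda>x. a * h x) (a * l)"
proof -
  have g: "has_gradient E (\<lambda>x. a * h x) x (a *\<^sub>R grad E h x)" if "x \<in> X" for x
    using that X smooth_onD[OF h] by (auto intro: has_gradient_scale)
  then have g': "grad E (\<lambda>x. a * h x) x = a *\<^sub>R grad E h x" if "x \<in> X" for x
    using that X by (intro grad_eq) auto
  have "dual_norm E N (grad E (\<lambda>x. a * h x) x - grad E (\<lambda>x. a * h x) y) \<le> (a * l) * N (x - y)"
    if "x \<in> X" "y \<in> X" for x y
  proof -
    have "dual_norm E N (grad E h x - grad E h y) \<le> l * N (x - y)"
      using h that by (auto simp: smooth_on_def)
    from mult_left_mono[OF this a] show ?thesis
      using dual_norm_scale_le[OF a, of "grad E h x - grad E h y"] that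
      by (simp add: g' scaleR_diff_right mult.assoc)
  qed
  with g show ?thesis unfolding smooth_on_def by blast
qed

lemma smooth_on_sum:
  assumes X: "X \<subseteq> E" and "finite I" "\<And>i. i \<in> I \<Longrightarrow> smooth_on E N X (h i) (l i)"
  shows "smooth_on E N X (\<lambda>x. \<Sum>i\<in>I. h i x) (\<Sum>i\<in>I. l i)"
  using assms(2,3)
proof (induction I rule: finite_induct)
  case empty
  show ?case using smooth_on_const[OF X, of 0] by simp
next
  case (insert i I)
  then show ?case using smooth_on_add[OF X, of "h i" "l i" "\<lambda>x. \<Sum>i\<in>I. h i x" "\<Sum>i\<in>I. l i"] by simp
qed

text \<open>
  The slope between two points is a derivative at a point between them, and every gradient on
  \<open>X\<close> is within \<open>l\<close> times the diameter of any chosen one. This is where the constants \<open>M\<^sub>i\<close> of the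
  problem come from.
\<close>

lemma smooth_on_lipschitz:
  assumes X: "X \<subseteq> E" "convex X" "bounded X" "X \<noteq> {}" and h: "smooth_on E N X h l" and l: "0 \<le> l"
    and xy: "x \<in> X" "y \<in> X"
  shows "\<bar>h x - h y\<bar> \<le> (l * diam N X + (INF w\<in>X. dual_norm E N (grad E h w))) * N (x - y)"
proof -
  let ?M = "l * diam N X + (INF w\<in>X. dual_norm E N (grad E h w))"
  have gM: "dual_norm E N (grad E h z) \<le> ?M" if z: "z \<in> X" for z
  proof -
    have "dual_norm E N (grad E h z) - l * diam N X \<le> dual_norm E N (grad E h w)" if w: "w \<in> X" for w
    proof -
      have "dual_norm E N (grad E h z) \<le> dual_norm E N (grad E h z - grad E h w) + dual_norm E N (grad E h w)"
        using dual_norm_triangle[of "grad E h z - grad E h w" "grad E h w"] by simp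
      moreover have "dual_norm E N (grad E h z - grad E h w) \<le> l * N (z - w)"
        using h z w by (auto simp: smooth_on_def)
      moreover have "l * N (z - w) \<le> l * diam N X"
        using norm_diff_le_diam[OF X(3,1) z w] l by (intro mult_left_mono)
      ultimately show ?thesis by linarith
    qed
    then have "dual_norm E N (grad E h z) - l * diam N X \<le> (INF w\<in>X. dual_norm E N (grad E h w))"
      using X(4) by (intro cINF_greatest)
    then show ?thesis by linarith
  qed
  have le: "h x - h y \<le> ?M * N (x - y)" if xy: "x \<in> X" "y \<in> X" for x y
  proof -
    have E: "y \<in> E" "x - y \<in> E" using xy X(1) by (auto intro!: subspace_diff[OF subspace])
    have seg: "y + t *\<^sub>R (x - y) \<in> X" if "0 \<le> t" "t \<le> 1" for t
      using convexD_alt[OF X(2) xy(2,1) that] by (simp add: algebra_simps)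
    have "\<exists>t\<in>{0<..<1::real}. h (y + 1 *\<^sub>R (x - y)) - h (y + 0 *\<^sub>R (x - y))
        = (1 - 0) * (grad E h (y + t *\<^sub>R (x - y)) \<bullet> (x - y))"
    proof (rule mvt_simple)
      fix t :: real assume "0 \<le> t" "t \<le> 1"
      then show "((\<lambda>t. h (y + t *\<^sub>R (x - y))) has_derivative
          (\<lambda>s. s * (grad E h (y + t *\<^sub>R (x - y)) \<bullet> (x - y)))) (at t within {0..1})"
        using seg X(1) E by (intro has_gradient_line smooth_onD[OF h]) auto
    qed simp
    then obtain t where t: "0 < t" "t < 1"
      "h x - h y = grad E h (y + t *\<^sub>R (x - y)) \<bullet> (x - y)" by auto
    have "h x - h y \<le> dual_norm E N (grad E h (y + t *\<^sub>R (x - y))) * N (x - y)"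
      unfolding t(3) using E by (intro inner_le_dual_norm)
    also have "\<dots> \<le> ?M * N (x - y)"
      using t seg E by (intro mult_right_mono gM N_nonneg) auto
    finally show ?thesis .
  qed
  from le[OF xy] le[OF xy(2,1)] show ?thesis
    using N_minus_commute[OF subsetD[OF X(1) xy(1)] subsetD[OF X(1) xy(2)]] by (simp add: abs_le_iff)
qed

lemma strongly_convex_first_order:
  assumes h: "strongly_convex_on N X h m" and D: "has_gradient E h x D"
    and X: "x \<in> X" "y \<in> X" "X \<subseteq> E"
  shows "h y \<ge> h x + D \<bullet> (y - x) + m / 2 * (N (x - y))\<^sup>2"
proof -
  let ?c = "m / 2 * (N (x - y))\<^sup>2"
  let ?q = "\<lambda>t. h (x + t *\<^sub>R (y - x))"
  have E: "x \<in> E" "y - x \<in> E" using X by (auto intro!: subspace_diff[OF subspace])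
  have "(?q has_derivative (\<lambda>s. s * (D \<bullet> (y - x)))) (at 0 within {0<..})"
    using D E by (intro has_gradient_line) auto
  then have "(?q has_field_derivative (D \<bullet> (y - x))) (at 0 within {0<..})"
    unfolding has_field_derivative_def by (simp add: mult.commute[of _ "D \<bullet> (y - x)"])
  then have lim: "((\<lambda>t. (?q t - ?q 0) / (t - 0)) \<longlongrightarrow> D \<bullet> (y - x)) (at 0 within {0<..})"
    unfolding has_field_derivative_iff .
  have lim2: "((\<lambda>t. h y - h x - (1 - t) * ?c) \<longlongrightarrow> h y - h x - (1 - 0) * ?c) (at_right 0)"
    by (intro tendsto_intros)
  have "\<forall>\<^sub>F t in at_right 0. (?q t - ?q 0) / (t - 0) \<le> h y - h x - (1 - t) * ?c"
    using eventually_at_right_less[of 0] eventually_at_right_real[of 0 1, simplified]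
  proof eventually_elim
    case (elim t)
    then have t: "0 < t" "t < 1" by auto
    have "h ((1 - t) *\<^sub>R x + t *\<^sub>R y) \<le> (1 - t) * h x + t * h y - m / 2 * t * (1 - t) * (N (x - y))\<^sup>2"
      using h X t by (auto simp: strongly_convex_on_def)
    then have "?q t - h x \<le> t * (h y - h x - (1 - t) * ?c)" by (simp add: algebra_simps)
    then show ?case using t by (simp add: divide_le_eq mult.commute)
  qed
  with lim lim2 have "D \<bullet> (y - x) \<le> h y - h x - (1 - 0) * ?c"
    by (intro tendsto_le[of "at_right 0"]) auto
  then show ?thesis by simp
qed

end

lemma strongly_convex_onD:
  assumes "strongly_convex_on N X h m" "x \<in> X" "y \<in> X" "0 \<le> t" "t \<le> 1"
  shows "h ((1 - t) *\<^sub>R x + t *\<^sub>R y) \<le> (1 - t) * h x + t * h y - m / 2 * t * (1 - t) * (N (x - y))\<^sup>2"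
  using assms by (auto simp: strongly_convex_on_def)

lemma strongly_convex_on_imp_convex_on:
  assumes "strongly_convex_on N X h m" "0 \<le> m"
  shows "convex_on X h"
proof (rule convex_onI)
  show "convex X" using assms by (simp add: strongly_convex_on_def)
  fix t :: real and x y assume t: "0 < t" "t < 1" and xy: "x \<in> X" "y \<in> X"
  have "0 \<le> m / 2 * t * (1 - t) * (N (x - y))\<^sup>2" using t assms(2) by simp
  then show "h ((1 - t) *\<^sub>R x + t *\<^sub>R y) \<le> (1 - t) * h x + t * h y"
    using strongly_convex_onD[OF assms(1) xy, of t] t by simp
qed

lemma strongly_convex_on_add:
  assumes "strongly_convex_on N X h m" "convex_on X h'"
  shows "strongly_convex_on N X (\<lambda>x. h x + h' x) m"
  unfolding strongly_convex_on_def
proof (intro conjI ballI)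
  show "convex X" using assms by (simp add: strongly_convex_on_def)
  fix x y and t :: real assume xy: "x \<in> X" "y \<in> X" and t: "t \<in> {0..1}"
  show "h ((1 - t) *\<^sub>R x + t *\<^sub>R y) + h' ((1 - t) *\<^sub>R x + t *\<^sub>R y)
    \<le> (1 - t) * (h x + h' x) + t * (h y + h' y) - m / 2 * t * (1 - t) * (N (x - y))\<^sup>2"
    using strongly_convex_onD[OF assms(1) xy, of t] convex_onD[OF assms(2), of t x y] xy t
    by (simp add: algebra_simps)
qed

lemma convex_on_sum_functions:
  assumes "finite I" "convex X" "\<And>i. i \<in> I \<Longrightarrow> convex_on X (h i)"
  shows "convex_on X (\<lambda>x. \<Sum>i\<in>I. h i x)"
  using assms by (induction I rule: finite_induct) (auto simp: convex_on_const intro: convex_on_add)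

lemma finite_ereal_on_eff_dom:
  assumes "closed_proper_convex E h" "x \<in> eff_dom E h"
  shows "ereal (fin h x) = h x"
  using assms by (cases "h x") (auto simp: closed_proper_convex_def eff_dom_def)

lemma closed_proper_convex_imp_convex_on:
  fixes E :: "'a::real_normed_vector set"
  assumes h: "closed_proper_convex E h" and X: "X \<subseteq> eff_dom E h" "convex X"
  shows "convex_on X (fin h)"
proof (rule convex_onI)
  fix t :: real and x y assume t: "0 < t" "t < 1" and xy: "x \<in> X" "y \<in> X"
  let ?epi = "{(x, t::real). x \<in> E \<and> h x \<le> ereal t}" and ?z = "(1 - t) *\<^sub>R x + t *\<^sub>R y"
  have fx: "ereal (fin h x) = h x" "ereal (fin h y) = h y"
    using finite_ereal_on_eff_dom[OF h] X xy by auto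
  then have "(x, fin h x) \<in> ?epi" "(y, fin h y) \<in> ?epi"
    using X xy by (auto simp: eff_dom_def)
  moreover have "convex ?epi" using h by (simp add: closed_proper_convex_def)
  ultimately have "(1 - t) *\<^sub>R (x, fin h x) + t *\<^sub>R (y, fin h y) \<in> ?epi"
    using t by (intro convexD_alt) auto
  then have "h ?z \<le> ereal ((1 - t) * fin h x + t * fin h y)" by simp
  moreover have "ereal (fin h ?z) = h ?z"
    using convexD_alt[OF X(2) xy, of t] t X by (intro finite_ereal_on_eff_dom[OF h]) auto
  ultimately show "fin h ?z \<le> (1 - t) * fin h x + t * fin h y"
    using ereal_less_eq(3) by metis
qed (rule X(2))

text \<open>A closed convex function is lower semicontinuous: its sublevel sets are sections of its
  epigraph.\<close>

lemma closed_proper_convex_measurable: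
  fixes E :: "'a::real_normed_vector set"
  assumes h: "closed_proper_convex E h" and X: "X \<subseteq> eff_dom E h"
  shows "fin h \<in> borel_measurable (restrict_space borel X)"
proof (rule borel_measurableI_le)
  fix t :: real
  let ?epi = "{(x, t::real). x \<in> E \<and> h x \<le> ereal t}"
  have "closed ((\<lambda>x. (x, t)) -` ?epi)"
    using h by (intro closed_vimage continuous_intros) (simp add: closed_proper_convex_def)
  then have "(\<lambda>x. (x, t)) -` ?epi \<in> sets borel" by (rule borel_closed)
  moreover have "{x \<in> X. fin h x \<le> t} = X \<inter> (\<lambda>x. (x, t)) -` ?epi"
  proof -
    have "(fin h x \<le> t) = (h x \<le> ereal t)" "x \<in> E" if "x \<in> X" for x
      using finite_ereal_on_eff_dom[OF h, of x] that X by (auto simp: eff_dom_def simp flip: ereal_less_eq(3))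
    then show ?thesis by auto
  qed
  ultimately show "{x \<in> space (restrict_space borel X). fin h x \<le> t} \<in> sets (restrict_space borel X)"
    by (auto simp: space_restrict_space sets_restrict_space)
qed


section \<open>The Lagrangian and the dual function\<close>

locale slater_problem =
  fixes P :: "'a::{real_inner, second_countable_topology} constrained_problem"
  assumes valid: "valid_problem P"
begin

abbreviation "E \<equiv> cp_space P"
abbreviation "N \<equiv> cp_norm P"
abbreviation "X \<equiv> cp_set P"
abbreviation "n \<equiv> cp_n P"
abbreviation "g \<equiv> cp_g P"
abbreviation "\<mu> \<equiv> cp_mu P"
abbreviation "L \<equiv> cp_L P"
abbreviation "S \<equiv> lagrangian P"
abbreviation "\<psi> \<equiv> dual_fun P"

lemma problem_facts:
  shows X_sub: "X \<subseteq> E" and X_ne: "X \<noteq> {}" and X_convex: "convex X" and X_compact: "compact X"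
    and mu_pos: "0 < \<mu>" and mu_le_L: "\<mu> \<le> L"
    and f_strongly_convex: "strongly_convex_on N X (cp_f P) \<mu>"
    and f_smooth: "smooth_on E N X (cp_f P) L"
    and r_closed: "closed_proper_convex E (cp_r P)" and r_dom: "X \<subseteq> eff_dom E (cp_r P)"
    and dgf: "dgf_on E N X (cp_r P) (cp_dgf P)"
    and n_pos: "0 < n" and L_D_pos: "0 < L_D P"
  using valid by (auto simp: valid_problem_def)

lemma constraint_facts:
  assumes "i < n"
  shows g_convex: "convex_on X (g i)" and alpha_nonneg: "0 \<le> cp_alpha P i"
    and g_smooth: "smooth_on E N X (g i) (cp_alpha P i)"
  using valid assms by (auto simp: valid_problem_def)

sublocale normed_subspace "cp_space P" "cp_norm P"
  using valid by unfold_locales (auto simp: valid_problem_def)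

lemma L_pos: "0 < L"
  using mu_pos mu_le_L by linarith

lemma f_continuous: "continuous_on X (cp_f P)"
  using f_smooth X_sub by (rule smooth_on_continuous)

lemma g_continuous: "i < n \<Longrightarrow> continuous_on X (g i)"
  using g_smooth X_sub by (rule smooth_on_continuous)

lemma r_convex: "convex_on X (fin (cp_r P))"
  using r_closed r_dom X_convex by (rule closed_proper_convex_imp_convex_on)

definition lipschitz_const :: "nat \<Rightarrow> real" where
  "lipschitz_const i = cp_alpha P i * diam N X + (INF x\<in>X. dual_norm E N (grad E (g i) x))"

lemma M_eq: "M_of P = (\<Sum>i<n. lipschitz_const i)"
  by (simp add: M_of_def lipschitz_const_def)

lemma lipschitz_const_nonneg:
  assumes "i < n"
  shows "0 \<le> lipschitz_const i"
proof -
  obtain x where "x \<in> X" using X_ne by blast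
  then have "0 \<le> diam N X"
    using norm_diff_le_diam[OF compact_imp_bounded[OF X_compact] X_sub, of x x] N_nonneg[of "x - x"]
      subspace_0[OF subspace] by force
  moreover have "0 \<le> (INF x\<in>X. dual_norm E N (grad E (g i) x))"
    using X_ne dual_norm_nonneg by (intro cINF_greatest)
  ultimately show ?thesis
    using alpha_nonneg[OF assms] by (simp add: lipschitz_const_def)
qed

lemma M_pos: "0 < M_of P"
proof -
  have "0 \<le> M_of P" unfolding M_eq using lipschitz_const_nonneg by (intro sum_nonneg) auto
  moreover have "M_of P \<noteq> 0" using L_D_pos by (auto simp: L_D_def)
  ultimately show ?thesis by simp
qed

lemma g_lipschitz:
  "i < n \<Longrightarrow> x \<in> X \<Longrightarrow> y \<in> X \<Longrightarrow> \<bar>g i x - g i y\<bar> \<le> lipschitz_const i * N (x - y)"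
  unfolding lipschitz_const_def
  using X_sub X_convex compact_imp_bounded[OF X_compact] X_ne g_smooth alpha_nonneg
  by (intro smooth_on_lipschitz)

lemma lagrangian_eq: "S x lam = cp_obj P x + (\<Sum>i<n. lam i * g i x)"
  using n_pos by (simp add: lagrangian_def cp_obj_def sum_divide_distrib mult.assoc)

lemma constraints_convex:
  assumes "lam \<in> orthant n"
  shows "convex_on X (\<lambda>x. \<Sum>i<n. lam i * g i x)"
  using assms g_convex X_convex
  by (intro convex_on_sum_functions convex_on_cmul) (auto simp: orthant_def)

lemma lagrangian_strongly_convex:
  assumes "lam \<in> orthant n"
  shows "strongly_convex_on N X (\<lambda>x. S x lam) \<mu>"
  using strongly_convex_on_add[OF strongly_convex_on_add[OF f_strongly_convex r_convex]
      constraints_convex[OF assms]]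
  by (simp add: lagrangian_eq cp_obj_def)

text \<open>
  The defining property of a distance generating function gives a minimiser of \<open>r + \<omega>\<close>, where \<open>\<omega>\<close> is
  continuous on the compact set \<open>X\<close>. There is no upper counterpart, since a closed convex function that is finite
  on \<open>X\<close> need not be continuous there.
\<close>

lemma r_bdd_below: "\<exists>b. \<forall>x\<in>X. b \<le> fin (cp_r P) x"
proof -
  let ?r = "fin (cp_r P)" and ?w = "fin (cp_dgf P)"
  have "0 \<in> E" by (rule subspace_0[OF subspace])
  with dgf obtain z where z: "z \<in> X" "\<And>y. y \<in> X \<Longrightarrow> y \<noteq> z \<Longrightarrow> ?r z + ?w z < ?r y + ?w y"
    unfolding dgf_on_def by (force dest: spec[of _ "1::real"] bspec[of _ _ 0])
  have "continuous_on X ?w" using dgf by (simp add: dgf_on_def)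
  from continuous_attains_sup[OF X_compact X_ne this]
  obtain m where "\<forall>y\<in>X. ?w y \<le> ?w m" by blast
  then have "\<forall>x\<in>X. ?r z + ?w z - ?w m \<le> ?r x" using z by force
  then show ?thesis by blast
qed

lemma continuous_bdd_below:
  assumes "continuous_on X (h :: 'a \<Rightarrow> real)"
  shows "\<exists>b. \<forall>x\<in>X. b \<le> h x"
  using continuous_attains_inf[OF X_compact X_ne assms] by blast

lemma lagrangian_bdd_below: "bdd_below ((\<lambda>x. S x lam) ` X)"
proof -
  have "continuous_on X (\<lambda>x. cp_f P x + (\<Sum>i<n. lam i * g i x))"
    by (intro continuous_intros f_continuous g_continuous) auto
  from continuous_bdd_below[OF this] r_bdd_below
  obtain b b' where "\<forall>x\<in>X. b \<le> cp_f P x + (\<Sum>i<n. lam i * g i x)" "\<forall>x\<in>X. b' \<le> fin (cp_r P) x"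
    by blast
  then have "\<forall>x\<in>X. b + b' \<le> S x lam" by (force simp: lagrangian_eq cp_obj_def)
  then show ?thesis by (auto intro!: bdd_belowI)
qed

lemma dual_fun_le: "x \<in> X \<Longrightarrow> \<psi> lam \<le> S x lam"
  unfolding dual_fun_def by (intro cINF_lower lagrangian_bdd_below)

lemma dual_fun_greatest: "(\<And>x. x \<in> X \<Longrightarrow> b \<le> S x lam) \<Longrightarrow> b \<le> \<psi> lam"
  unfolding dual_fun_def by (intro cINF_greatest X_ne)

text \<open>
  A smoothness estimate for the dual function that allows for an approximate minimiser \<open>z\<close>. For any
  competitor \<open>y\<close>, strong convexity at the midpoint of \<open>y\<close> and \<open>z\<close> gives
  \<open>S(y, lam) \<ge> \<psi> lam + \<mu>/4 N(y - z)\<^sup>2 - \<delta>\<close> with \<open>\<delta> = S(z, lam) - \<psi> lam\<close>, and this quadratic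
  absorbs the change \<open>M |d| N(y - z)\<close> of the constraint terms.
\<close>

lemma dual_fun_inexact_descent:
  assumes lam: "lam \<in> orthant n" and z: "z \<in> X" and lam': "\<And>i. i < n \<Longrightarrow> lam' i = lam i + d i"
  shows "S z lam' - 2 * (S z lam - \<psi> lam) - L_D P * (\<Sum>i<n. (d i)\<^sup>2) \<le> \<psi> lam'"
proof (rule dual_fun_greatest)
  fix y assume y: "y \<in> X"
  let ?\<delta> = "S z lam - \<psi> lam" and ?N = "N (z - y)" and ?d = "L2_set d {..<n}"
  have S': "S x lam' = S x lam + (\<Sum>i<n. d i * g i x)" for x
  proof -
    have "(\<Sum>i<n. lam' i * g i x) = (\<Sum>i<n. lam i * g i x + d i * g i x)"
      using lam' by (intro sum.cong) (auto simp: distrib_right)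
    then show ?thesis by (simp add: lagrangian_eq sum.distrib)
  qed
  have N0: "0 \<le> ?N" using y z X_sub by (auto intro!: N_nonneg subspace_diff[OF subspace])
  have "\<psi> lam \<le> S ((1 - 1/2) *\<^sub>R z + (1/2) *\<^sub>R y) lam"
    using convexD_alt[OF X_convex z y, of "1/2"] by (intro dual_fun_le) simp
  also have "\<dots> \<le> (1 - 1/2) * S z lam + 1/2 * S y lam - \<mu> / 2 * (1/2) * (1 - 1/2) * ?N\<^sup>2"
    by (rule strongly_convex_onD[OF lagrangian_strongly_convex[OF lam] z y]) auto
  finally have quad: "\<psi> lam + \<mu> / 4 * ?N\<^sup>2 - ?\<delta> \<le> S y lam" by (simp add: field_simps)
  have "(\<Sum>i<n. d i * g i z) - (\<Sum>i<n. d i * g i y) = (\<Sum>i<n. d i * (g i z - g i y))"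
    by (simp add: sum_subtractf right_diff_distrib)
  also have "\<dots> \<le> (\<Sum>i<n. ?d * (lipschitz_const i * ?N))"
  proof (rule sum_mono)
    fix i assume i: "i \<in> {..<n}"
    have "\<bar>d i\<bar> = sqrt ((d i)\<^sup>2)" by simp
    also have "\<dots> \<le> ?d" unfolding L2_set_def using i by (intro real_sqrt_le_mono member_le_sum) auto
    finally have "\<bar>d i\<bar> \<le> ?d" .
    then have "\<bar>d i\<bar> * \<bar>g i z - g i y\<bar> \<le> ?d * (lipschitz_const i * ?N)"
      using i z y by (intro mult_mono g_lipschitz) auto
    then show "d i * (g i z - g i y) \<le> ?d * (lipschitz_const i * ?N)"
      by (metis abs_ge_self abs_mult order_trans)
  qed
  also have "\<dots> = ?d * (M_of P * ?N)" by (simp add: M_eq sum_distrib_left sum_distrib_right)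
  also have "\<dots> \<le> \<mu> / 4 * ?N\<^sup>2 + L_D P * ?d\<^sup>2"
  proof -
    have "0 \<le> (\<mu> / 2 * ?N - M_of P * ?d)\<^sup>2 / \<mu>" using mu_pos by simp
    also have "\<dots> = \<mu> / 4 * ?N\<^sup>2 + L_D P * ?d\<^sup>2 - ?d * (M_of P * ?N)"
      using mu_pos by (simp add: L_D_def power2_eq_square field_simps)
    finally show ?thesis by simp
  qed
  also have "?d\<^sup>2 = (\<Sum>i<n. (d i)\<^sup>2)" by (simp add: L2_set_def sum_nonneg)
  finally have "(\<Sum>i<n. d i * g i z) - (\<Sum>i<n. d i * g i y) - L_D P * (\<Sum>i<n. (d i)\<^sup>2) \<le> \<mu> / 4 * ?N\<^sup>2"
    by simp
  then show "S z lam' - 2 * ?\<delta> - L_D P * (\<Sum>i<n. (d i)\<^sup>2) \<le> S y lam'"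
    using quad unfolding S' by argo
qed


section \<open>The sub-problems\<close>

lemma L_xx_nonneg: "lam \<in> orthant n \<Longrightarrow> 0 \<le> L_xx P lam"
  unfolding L_xx_def using alpha_nonneg by (intro sum_nonneg) (auto simp: orthant_def)

lemma alpha_of_nonneg: "0 \<le> alpha_of P"
  unfolding alpha_of_def using alpha_nonneg by (intro sum_nonneg) auto

lemma co_avg_subproblem:
  "co_avg (subproblem P lam) = (\<lambda>x. cp_f P x + (\<Sum>i<n. lam i * g i x))"
  using n_pos by (simp add: co_avg_def subproblem_def fun_eq_iff sum.distrib sum_divide_distrib
      add_divide_distrib mult.assoc)

lemma co_obj_subproblem: "co_obj (subproblem P lam) x = S x lam"
  by (simp add: co_obj_def co_avg_subproblem lagrangian_eq cp_obj_def) (simp add: subproblem_def)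

lemma valid_composite_subproblem:
  assumes lam: "lam \<in> orthant n"
  shows "valid_composite (subproblem P lam)"
proof -
  have comp: "convex_on X (\<lambda>x. cp_f P x + real n * lam i * g i x)"
    "smooth_on E N X (\<lambda>x. cp_f P x + real n * lam i * g i x) (L + real n * lam i * cp_alpha P i)"
    if "i < n" for i
    using that lam strongly_convex_on_imp_convex_on[OF f_strongly_convex] mu_pos
    by (auto intro!: convex_on_add convex_on_cmul smooth_on_add smooth_on_scale X_sub f_smooth
        g_smooth g_convex simp: orthant_def)
  have "smooth_on E N X (\<lambda>x. cp_f P x + (\<Sum>i<n. lam i * g i x)) (L + L_xx P lam)"
    unfolding L_xx_def using lam
    by (intro smooth_on_add smooth_on_sum smooth_on_scale X_sub f_smooth g_smooth)
      (auto simp: orthant_def)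
  moreover have "convex_on X (\<lambda>x. cp_f P x + (\<Sum>i<n. lam i * g i x))"
    using strongly_convex_on_imp_convex_on[OF f_strongly_convex] mu_pos constraints_convex[OF lam]
    by (intro convex_on_add) auto
  moreover have "co_obj (subproblem P lam) = (\<lambda>x. S x lam)"
    by (simp add: fun_eq_iff co_obj_subproblem)
  ultimately show ?thesis
    unfolding valid_composite_def co_avg_subproblem
    using comp problem_facts finite_dim norm_on L_pos L_xx_nonneg[OF lam] lagrangian_strongly_convex[OF lam]
    by (simp add: subproblem_def) blast
qed


section \<open>One step of the method\<close>

definition smoothed_primal :: "real \<Rightarrow> 'a \<Rightarrow> real" where
  "smoothed_primal \<rho> x = cp_obj P x + (\<Sum>i<n. (max (g i x) 0)\<^sup>2 / (2 * \<rho>))"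

lemma lam_tilde_orthant: "0 < \<rho> \<Longrightarrow> lam_tilde P \<rho> x \<in> orthant n"
  by (auto simp: orthant_def lam_tilde_def)

text \<open>
  \<open>smoothed_primal\<close> is the maximum over the multipliers of the Lagrangian minus the quadratic
  penalty, attained at \<open>lam_tilde\<close>; the penalty makes this maximum grow quadratically.
\<close>

lemma smoothed_primal_max:
  assumes rho: "0 < \<rho>" and lam: "lam \<in> orthant n"
  shows "S x lam - \<rho> / 2 * (\<Sum>i<n. (lam i)\<^sup>2)
    \<le> smoothed_primal \<rho> x - \<rho> / 2 * (\<Sum>i<n. (lam i - lam_tilde P \<rho> x i)\<^sup>2)"
proof -
  have "(\<Sum>i<n. lam i * g i x - \<rho> / 2 * (lam i)\<^sup>2)
    \<le> (\<Sum>i<n. (max (g i x) 0)\<^sup>2 / (2 * \<rho>) - \<rho> / 2 * (lam i - lam_tilde P \<rho> x i)\<^sup>2)"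
  proof (rule sum_mono)
    fix i assume i: "i \<in> {..<n}"
    have "lam i * g i x \<le> lam i * max (g i x) 0"
      using i lam by (intro mult_left_mono) (auto simp: orthant_def)
    moreover have "(max (g i x) 0)\<^sup>2 / (2 * \<rho>) - \<rho> / 2 * (lam i - lam_tilde P \<rho> x i)\<^sup>2
        = lam i * max (g i x) 0 - \<rho> / 2 * (lam i)\<^sup>2"
      using i rho by (simp add: lam_tilde_def power2_eq_square field_simps)
    ultimately show "lam i * g i x - \<rho> / 2 * (lam i)\<^sup>2
      \<le> (max (g i x) 0)\<^sup>2 / (2 * \<rho>) - \<rho> / 2 * (lam i - lam_tilde P \<rho> x i)\<^sup>2" by simp
  qed
  then show ?thesis
    by (simp add: lagrangian_eq smoothed_primal_def sum_subtractf sum_distrib_left)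
qed

lemma smoothed_primal_attained:
  assumes rho: "0 < \<rho>"
  shows "smoothed_primal \<rho> x = S x (lam_tilde P \<rho> x) - \<rho> / 2 * (\<Sum>i<n. (lam_tilde P \<rho> x i)\<^sup>2)"
proof -
  have "(\<Sum>i<n. (max (g i x) 0)\<^sup>2 / (2 * \<rho>))
    = (\<Sum>i<n. lam_tilde P \<rho> x i * g i x - \<rho> / 2 * (lam_tilde P \<rho> x i)\<^sup>2)"
    using rho by (intro sum.cong) (auto simp: lam_tilde_def max_def power2_eq_square field_simps)
  then show ?thesis
    by (simp add: lagrangian_eq smoothed_primal_def sum_subtractf sum_distrib_left)
qed

lemma smoothed_primal_le_gap:
  assumes "0 < \<rho>"
  shows "smoothed_primal \<rho> x - \<psi> lam \<le> smoothed_gap P \<rho> x lam"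
proof -
  have "S x lam' - \<rho> / 2 * (\<Sum>i<n. (lam' i)\<^sup>2) \<le> smoothed_primal \<rho> x" if "lam' \<in> orthant n" for lam'
  proof -
    have "0 \<le> \<rho> / 2 * (\<Sum>i<n. (lam' i - lam_tilde P \<rho> x i)\<^sup>2)" using assms by (simp add: sum_nonneg)
    then show ?thesis using smoothed_primal_max[OF assms that, of x] by linarith
  qed
  then have "bdd_above ((\<lambda>lam'. S x lam' - \<rho> / 2 * (\<Sum>i<n. (lam' i)\<^sup>2)) ` orthant n)"
    by (auto intro!: bdd_aboveI)
  from cSUP_upper[OF lam_tilde_orthant[OF assms] this] show ?thesis
    by (simp add: smoothed_gap_def smoothed_primal_attained[OF assms])
qed

lemma tau_bounds: "0 < tau k" "tau k < 1"
  by (auto simp: tau_def)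

lemma lam_mix_orthant:
  "lam \<in> orthant n \<Longrightarrow> lam' \<in> orthant n \<Longrightarrow> lam_mix k lam lam' \<in> orthant n"
  using tau_bounds[of k] by (auto simp: orthant_def lam_mix_def intro!: add_nonneg_nonneg)

lemma lagrangian_lam_mix: "S x (lam_mix k lam lam') = tau k * S x lam + (1 - tau k) * S x lam'"
proof -
  have "(\<Sum>i<n. lam_mix k lam lam' i * g i x)
      = tau k * (\<Sum>i<n. lam i * g i x) + (1 - tau k) * (\<Sum>i<n. lam' i * g i x)"
    by (simp add: lam_mix_def sum_distrib_left sum.distrib distrib_right mult.assoc)
  then show ?thesis unfolding lagrangian_eq by (simp add: algebra_simps)
qed

text \<open>
  The excessive-gap argument: the smoothed duality gap contracts by \<open>\<tau>\<^sub>k\<close>, up to twice the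
  inaccuracy of the sub-problem. The loss \<open>L_D |d|\<^sup>2\<close> from the inexact dual step is paid for by the
  quadratic growth of the smoothed primal function, provided that \<open>L_D (1 - \<tau>)\<^sup>2 \<le> \<tau> \<rho> / 2\<close>.
\<close>

lemma gap_step:
  assumes rho: "0 < \<rho>" "L_D P * (1 - tau k)\<^sup>2 \<le> tau k * \<rho> / 2"
    and x: "x \<in> X" and z: "z \<in> X" and lam: "lam \<in> orthant n"
    and lh: "lh = lam_mix k lam (lam_tilde P \<rho> x)"
    and x': "x' = tau k *\<^sub>R x + (1 - tau k) *\<^sub>R z"
    and lam': "lam' = lam_mix k lam (lam_tilde P (tau k * \<rho>) x')"
  shows "smoothed_primal (tau k * \<rho>) x' - \<psi> lam'
    \<le> tau k * (smoothed_primal \<rho> x - \<psi> lam) + 2 * (S z lh - \<psi> lh)"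
proof -
  let ?t = "tau k" and ?l = "lam_tilde P \<rho> x" and ?m = "lam_tilde P (tau k * \<rho>) x'"
  let ?D = "\<Sum>i<n. (?m i - ?l i)\<^sup>2"
  have t: "0 < ?t" "?t < 1" by (rule tau_bounds)+
  have rho': "0 < ?t * \<rho>" using t rho by simp
  note m = lam_tilde_orthant[OF rho', of x'] and l = lam_tilde_orthant[OF rho(1), of x]
  have "S x' ?m \<le> ?t * S x ?m + (1 - ?t) * S z ?m"
  proof -
    have "convex_on X (\<lambda>x. S x ?m)"
      using strongly_convex_on_imp_convex_on[OF lagrangian_strongly_convex[OF m]] mu_pos by simp
    from convex_onD[OF this, of "1 - ?t" x z] show ?thesis using t x z by (simp add: x')
  qed
  then have "S x' ?m - ?t * \<rho> / 2 * (\<Sum>i<n. (?m i)\<^sup>2)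
      \<le> ?t * (S x ?m - \<rho> / 2 * (\<Sum>i<n. (?m i)\<^sup>2)) + (1 - ?t) * S z ?m"
    by (simp add: right_diff_distrib)
  then have "smoothed_primal (?t * \<rho>) x'
      \<le> ?t * (S x ?m - \<rho> / 2 * (\<Sum>i<n. (?m i)\<^sup>2)) + (1 - ?t) * S z ?m"
    by (simp only: smoothed_primal_attained[OF rho'])
  also have "\<dots> \<le> ?t * (smoothed_primal \<rho> x - \<rho> / 2 * ?D) + (1 - ?t) * S z ?m"
    using mult_left_mono[OF smoothed_primal_max[OF rho(1) m, of x], of ?t] t by simp
  finally have primal: "smoothed_primal (?t * \<rho>) x'
      \<le> ?t * smoothed_primal \<rho> x - ?t * \<rho> / 2 * ?D + (1 - ?t) * S z ?m"
    by (simp add: algebra_simps)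
  have "S z lam' - 2 * (S z lh - \<psi> lh) - L_D P * (\<Sum>i<n. ((1 - ?t) * (?m i - ?l i))\<^sup>2) \<le> \<psi> lam'"
  proof (rule dual_fun_inexact_descent[OF _ z])
    show "lh \<in> orthant n" unfolding lh by (rule lam_mix_orthant[OF lam l])
    show "lam' i = lh i + (1 - ?t) * (?m i - ?l i)" for i
      by (simp add: lh lam' lam_mix_def right_diff_distrib)
  qed
  moreover have "L_D P * (\<Sum>i<n. ((1 - ?t) * (?m i - ?l i))\<^sup>2) = (L_D P * (1 - ?t)\<^sup>2) * ?D"
    by (simp add: power_mult_distrib sum_distrib_left[symmetric] mult.assoc)
  moreover have "(L_D P * (1 - ?t)\<^sup>2) * ?D \<le> (?t * \<rho> / 2) * ?D"
    using rho(2) by (intro mult_right_mono) (auto intro: sum_nonneg)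
  moreover have "?t * \<psi> lam \<le> ?t * S z lam"
    using t dual_fun_le[OF z] by (intro mult_left_mono) auto
  moreover have "S z lam' = ?t * S z lam + (1 - ?t) * S z ?m"
    unfolding lam' by (rule lagrangian_lam_mix)
  ultimately show ?thesis
    using primal unfolding right_diff_distrib[of ?t "smoothed_primal \<rho> x"] by linarith
qed

lemma rho_eq: "rho P k = 16 * L_D P / ((real k + 1) * (real k + 2))"
proof (induction k)
  case (Suc k)
  then have "rho P (Suc k) = (real k + 1) / (real k + 3) * (16 * L_D P / ((real k + 1) * (real k + 2)))"
    by (simp add: tau_def)
  also have "\<dots> = 16 * L_D P / ((real k + 2) * (real k + 3))"
    by (simp add: divide_simps)
  finally show ?case by (simp add: algebra_simps)
qed simp

lemma rho_pos: "0 < rho P k"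
  using L_D_pos by (simp add: rho_eq)

lemma rho_condition: "L_D P * (1 - tau k)\<^sup>2 \<le> tau k * rho P k / 2"
proof -
  have "(1 - tau k)\<^sup>2 = 4 / ((real k + 3) * (real k + 3))"
    by (simp add: tau_def power2_eq_square field_simps)
  also have "\<dots> = 4 * (real k + 2) / ((real k + 2) * (real k + 3) * (real k + 3))"
    by (simp add: divide_simps)
  also have "\<dots> \<le> 8 * (real k + 3) / ((real k + 2) * (real k + 3) * (real k + 3))"
    by (intro divide_right_mono) auto
  also have "\<dots> = 8 / ((real k + 2) * (real k + 3))" by (simp add: divide_simps)
  finally have "L_D P * (1 - tau k)\<^sup>2 \<le> L_D P * (8 / ((real k + 2) * (real k + 3)))"
    using L_D_pos by (intro mult_left_mono) auto
  also have "\<dots> = 16 * L_D P / ((real (Suc k) + 1) * (real (Suc k) + 2)) / 2" by (simp add: add.commute)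
  also have "\<dots> = rho P (Suc k) / 2" by (simp only: rho_eq)
  finally show ?thesis by simp
qed

end


section \<open>The potential function\<close>

text \<open>
  Adding \<open>\<rho>/2 |lam_opt|\<^sup>2\<close> to the smoothed duality gap makes it nonnegative. Since \<open>\<rho>\<^sub>k\<^sub>+\<^sub>1 = \<tau>\<^sub>k \<rho>\<^sub>k\<close>,
  the sum obeys the same one-step recursion. The optimality gap, the infeasibility and the new multipliers are bounded by
  affine functions of it, so that one expectation controls all of them.
\<close>

locale saddle_problem = slater_problem P
  for P :: "'a::{real_inner, second_countable_topology} constrained_problem" +
  fixes x_opt :: 'a and lam_opt :: "nat \<Rightarrow> real"
  assumes optimal: "optimal_solution P x_opt" and saddle: "saddle_point P x_opt lam_opt"
begin

definition potential :: "real \<Rightarrow> 'a \<Rightarrow> (nat \<Rightarrow> real) \<Rightarrow> real" where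
  "potential \<rho> x lam = smoothed_primal \<rho> x - \<psi> lam + \<rho> / 2 * (\<Sum>i<n. (lam_opt i)\<^sup>2)"

lemma lam_opt_orthant: "lam_opt \<in> orthant n" and x_opt_in: "x_opt \<in> X"
  using saddle by (auto simp: saddle_point_def)

text \<open>Weak duality, and the bound on how far an infeasible point can undercut the optimal value.\<close>

lemma dual_fun_le_opt:
  assumes "lam \<in> orthant n"
  shows "\<psi> lam \<le> cp_obj P x_opt"
proof -
  have "\<psi> lam \<le> S x_opt lam" by (rule dual_fun_le[OF x_opt_in])
  also have "\<dots> \<le> cp_obj P x_opt"
    using optimal assms unfolding lagrangian_eq
    by (auto simp: optimal_solution_def orthant_def intro!: sum_nonpos mult_nonneg_nonpos)
  finally show ?thesis .
qed

lemma obj_opt_le: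
  assumes x: "x \<in> X"
  shows "cp_obj P x_opt \<le> cp_obj P x + (\<Sum>i<n. lam_opt i * max (g i x) 0)"
proof -
  have "(\<lambda>_. 0) \<in> orthant n" by (simp add: orthant_def)
  then have "S x_opt (\<lambda>_. 0) \<le> S x_opt lam_opt" using saddle by (simp add: saddle_point_def)
  also have "\<dots> \<le> S x lam_opt" using saddle x by (simp add: saddle_point_def)
  also have "\<dots> \<le> cp_obj P x + (\<Sum>i<n. lam_opt i * max (g i x) 0)"
    unfolding lagrangian_eq using lam_opt_orthant
    by (intro add_left_mono sum_mono mult_left_mono) (auto simp: orthant_def)
  finally show ?thesis by (simp add: lagrangian_eq)
qed

text \<open>Weak duality and the saddle point inequality leave a sum of complete squares.\<close>

lemma potential_lower:
  assumes rho: "0 < \<rho>" and x: "x \<in> X" and lam: "lam \<in> orthant n"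
  shows "(\<Sum>i<n. (max (g i x) 0 - \<rho> * lam_opt i)\<^sup>2 / (2 * \<rho>)) \<le> potential \<rho> x lam"
proof -
  have "(\<Sum>i<n. (max (g i x) 0 - \<rho> * lam_opt i)\<^sup>2 / (2 * \<rho>))
    = (\<Sum>i<n. (max (g i x) 0)\<^sup>2 / (2 * \<rho>) - lam_opt i * max (g i x) 0 + \<rho> / 2 * (lam_opt i)\<^sup>2)"
    using rho by (intro sum.cong) (auto simp: power2_eq_square field_simps)
  also have "\<dots> = (\<Sum>i<n. (max (g i x) 0)\<^sup>2 / (2 * \<rho>)) - (\<Sum>i<n. lam_opt i * max (g i x) 0)
      + \<rho> / 2 * (\<Sum>i<n. (lam_opt i)\<^sup>2)"
    by (simp add: sum.distrib sum_subtractf sum_distrib_left)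
  finally show ?thesis
    using obj_opt_le[OF x] dual_fun_le_opt[OF lam] by (simp add: potential_def smoothed_primal_def)
qed

lemma potential_nonneg:
  assumes "0 < \<rho>" "x \<in> X" "lam \<in> orthant n"
  shows "0 \<le> potential \<rho> x lam"
  using assms by (intro order_trans[OF sum_nonneg potential_lower]) auto

lemma obj_le_potential:
  assumes "0 < \<rho>" "lam \<in> orthant n"
  shows "cp_obj P x - cp_obj P x_opt \<le> potential \<rho> x lam"
proof -
  have "0 \<le> (\<Sum>i<n. (max (g i x) 0)\<^sup>2 / (2 * \<rho>))" "0 \<le> \<rho> / 2 * (\<Sum>i<n. (lam_opt i)\<^sup>2)"
    using assms by (auto intro!: sum_nonneg mult_nonneg_nonneg)
  then show ?thesis
    using dual_fun_le_opt[OF assms(2)] by (simp add: potential_def smoothed_primal_def)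
qed

text \<open>By the preceding bound \<open>y = [g\<^sub>i(x)]\<^sub>+/\<rho> - lam_opt\<^sub>i\<close> satisfies \<open>\<rho> y\<^sup>2/2 \<le> V\<close>; then \<open>y \<le> 1/2 + y\<^sup>2/2\<close>
  linearises the estimate.\<close>

lemma multiplier_le_potential:
  assumes rho: "0 < \<rho>" and x: "x \<in> X" and lam: "lam \<in> orthant n" and i: "i < n"
  shows "max (g i x) 0 / \<rho> \<le> lam_opt i + 1 / 2 + potential \<rho> x lam / \<rho>"
proof -
  let ?y = "max (g i x) 0 / \<rho> - lam_opt i"
  have "\<rho> * ?y\<^sup>2 / 2 = (max (g i x) 0 - \<rho> * lam_opt i)\<^sup>2 / (2 * \<rho>)"
    using rho by (simp add: power2_eq_square field_simps)
  also have "\<dots> \<le> (\<Sum>i<n. (max (g i x) 0 - \<rho> * lam_opt i)\<^sup>2 / (2 * \<rho>))"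
    using i rho by (intro member_le_sum[of i "{..<n}"]) auto
  also have "\<dots> \<le> potential \<rho> x lam" by (rule potential_lower[OF rho x lam])
  finally have "?y\<^sup>2 / 2 \<le> potential \<rho> x lam / \<rho>"
    using rho by (simp add: pos_le_divide_eq mult.commute)
  moreover have "y \<le> 1 / 2 + v" if "y\<^sup>2 / 2 \<le> v" for y v :: real
    using that zero_le_power2[of "y - 1"] by (simp add: power2_diff)
  ultimately have "?y \<le> 1 / 2 + potential \<rho> x lam / \<rho>" by blast
  then show ?thesis by linarith
qed

lemma infeasibility_le_potential:
  assumes rho: "0 < \<rho>" and x: "x \<in> X" and lam: "lam \<in> orthant n" and i: "i < n"
  shows "max (g i x) 0 \<le> \<rho> * (lam_opt i + 1 / 2) + potential \<rho> x lam"
  using multiplier_le_potential[OF assms] rho by (simp add: field_simps)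

lemma potential_step:
  assumes x: "x \<in> X" and z: "z \<in> X" and lam: "lam \<in> orthant n"
    and lh: "lh = lam_mix k lam (lam_tilde P (rho P k) x)"
    and x': "x' = tau k *\<^sub>R x + (1 - tau k) *\<^sub>R z"
    and lam': "lam' = lam_mix k lam (lam_tilde P (rho P (Suc k)) x')"
  shows "potential (rho P (Suc k)) x' lam' \<le> tau k * potential (rho P k) x lam + 2 * (S z lh - \<psi> lh)"
  using gap_step[OF rho_pos rho_condition x z lam lh x'] lam'
  by (simp add: potential_def algebra_simps)

end


section \<open>Measurability\<close>

lemma nn_integral_affine_le:
  assumes "prob_space \<nu>"
    and [measurable]: "f \<in> borel_measurable \<nu>" "h \<in> borel_measurable \<nu>"
    and pos: "\<And>x. x \<in> space \<nu> \<Longrightarrow> 0 \<le> f x" "\<And>x. x \<in> space \<nu> \<Longrightarrow> 0 \<le> h x"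
    and int: "(\<integral>\<^sup>+x. ennreal (f x) \<partial>\<nu>) \<le> ennreal A" "(\<integral>\<^sup>+x. ennreal (h x) \<partial>\<nu>) \<le> ennreal B"
    and coeff: "0 \<le> a" "0 \<le> b" "0 \<le> d" "0 \<le> A" "0 \<le> B"
    and F: "\<And>x. x \<in> space \<nu> \<Longrightarrow> F x \<le> a * f x + b * h x + d"
  shows "(\<integral>\<^sup>+x. ennreal (F x) \<partial>\<nu>) \<le> ennreal (a * A + b * B + d)"
proof -
  interpret prob_space \<nu> by fact
  have "(\<integral>\<^sup>+x. ennreal (F x) \<partial>\<nu>) \<le> (\<integral>\<^sup>+x. ennreal a * ennreal (f x) + ennreal b * ennreal (h x) + ennreal d \<partial>\<nu>)"
  proof (rule nn_integral_mono)
    fix x assume x: "x \<in> space \<nu>"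
    have "ennreal (F x) \<le> ennreal (a * f x + b * h x + d)" using F[OF x] by (rule ennreal_leI)
    also have "\<dots> = ennreal a * ennreal (f x) + ennreal b * ennreal (h x) + ennreal d"
      using pos[OF x] coeff by (simp add: ennreal_plus ennreal_mult)
    finally show "ennreal (F x) \<le> ennreal a * ennreal (f x) + ennreal b * ennreal (h x) + ennreal d" .
  qed
  also have "\<dots> = ennreal a * (\<integral>\<^sup>+x. ennreal (f x) \<partial>\<nu>) + ennreal b * (\<integral>\<^sup>+x. ennreal (h x) \<partial>\<nu>) + ennreal d"
    by (simp add: nn_integral_add nn_integral_cmult emeasure_space_1)
  also have "\<dots> \<le> ennreal a * ennreal A + ennreal b * ennreal B + ennreal d"
    by (intro add_mono mult_left_mono int) auto
  also have "\<dots> = ennreal (a * A + b * B + d)"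
    using coeff by (simp add: ennreal_plus ennreal_mult)
  finally show ?thesis .
qed

context slater_problem
begin

abbreviation "primal_space \<equiv> restrict_space borel X"
abbreviation "dual_space \<equiv> restrict_space borel (orthant n)"
abbreviation "states \<equiv> ipds_space P"

lemma space_primal: "space primal_space = X" and space_dual: "space dual_space = orthant n"
  by (simp_all add: space_restrict_space)

lemma space_states: "space states = X \<times> orthant n \<times> UNIV"
  by (simp add: ipds_space_def space_pair_measure space_primal space_dual)

lemma g_measurable: "i < n \<Longrightarrow> g i \<in> borel_measurable primal_space"
  by (intro borel_measurable_continuous_on_restrict g_continuous)

lemma obj_measurable: "cp_obj P \<in> borel_measurable primal_space"
proof -
  have [measurable]: "cp_f P \<in> borel_measurable primal_space" "fin (cp_r P) \<in> borel_measurable primal_space"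
    using closed_proper_convex_measurable[OF r_closed r_dom]
    by (auto intro: borel_measurable_continuous_on_restrict f_continuous)
  have "(\<lambda>x. cp_f P x + fin (cp_r P) x) \<in> borel_measurable primal_space" by measurable
  then show ?thesis by (simp add: cp_obj_def[abs_def])
qed

lemma smoothed_primal_measurable: "smoothed_primal \<rho> \<in> borel_measurable primal_space"
proof -
  note [measurable] = obj_measurable g_measurable
  have "(\<lambda>x. cp_obj P x + (\<Sum>i\<in>{..<n}. (max (g i x) 0)\<^sup>2 / (2 * \<rho>))) \<in> borel_measurable primal_space"
    by (intro borel_measurable_add borel_measurable_sum obj_measurable) auto
  then show ?thesis by (simp add: smoothed_primal_def[abs_def])
qed

lemma coordinate_measurable: "(\<lambda>lam. lam i) \<in> borel_measurable dual_space"
  by (intro measurable_restrict_space1 borel_measurable_continuous_onI continuous_on_product_coordinates)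

lemma L_xx_measurable: "L_xx P \<in> borel_measurable dual_space"
  unfolding L_xx_def[abs_def]
  by (intro borel_measurable_sum borel_measurable_times coordinate_measurable borel_measurable_const)

text \<open>The dual function is an infimum of functions that are affine in the multiplier, so it is upper
  semicontinuous.\<close>

lemma dual_fun_measurable: "\<psi> \<in> borel_measurable dual_space"
proof (rule borel_measurableI_less)
  fix t :: real
  have "open {lam. S x lam < t}" for x
    unfolding lagrangian_eq by (intro open_Collect_less continuous_intros) auto
  then have "open (\<Union>x\<in>X. {lam. S x lam < t})" by blast
  moreover have "{lam \<in> space dual_space. \<psi> lam < t} = orthant n \<inter> (\<Union>x\<in>X. {lam. S x lam < t})"
    using cINF_less_iff[OF X_ne lagrangian_bdd_below] by (auto simp: space_dual dual_fun_def)
  ultimately show "{lam \<in> space dual_space. \<psi> lam < t} \<in> sets dual_space"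
    by (auto simp: sets_restrict_space)
qed

lemma measurable_into_dual:
  assumes "\<And>i. (\<lambda>s. h s i) \<in> borel_measurable \<nu>" "\<And>s. s \<in> space \<nu> \<Longrightarrow> h s \<in> orthant n"
  shows "h \<in> measurable \<nu> dual_space"
  using assms by (intro measurable_restrict_space2 measurable_coordinatewise_then_product) auto

lemma measurable_multiplier_update:
  assumes x: "x \<in> measurable \<nu> primal_space" and lam: "lam \<in> measurable \<nu> dual_space"
    and rho: "0 < \<rho>"
  shows "(\<lambda>s. lam_mix k (lam s) (lam_tilde P \<rho> (x s))) \<in> measurable \<nu> dual_space"
proof (rule measurable_into_dual)
  fix s assume "s \<in> space \<nu>"
  then show "lam_mix k (lam s) (lam_tilde P \<rho> (x s)) \<in> orthant n"
    using measurable_space[OF lam] by (auto simp: space_dual intro!: lam_mix_orthant lam_tilde_orthant rho)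
next
  fix i
  have [measurable]: "(\<lambda>s. lam s i) \<in> borel_measurable \<nu>"
    by (rule measurable_compose[OF lam coordinate_measurable])
  have "(\<lambda>s. lam_tilde P \<rho> (x s) i) \<in> borel_measurable \<nu>"
  proof (cases "i < n")
    case True
    have [measurable]: "(\<lambda>s. g i (x s)) \<in> borel_measurable \<nu>"
      by (rule measurable_compose[OF x g_measurable[OF True]])
    show ?thesis using True by (simp add: lam_tilde_def)
  qed (simp add: lam_tilde_def)
  note [measurable] = this
  show "(\<lambda>s. lam_mix k (lam s) (lam_tilde P \<rho> (x s)) i) \<in> borel_measurable \<nu>"
    by (simp add: lam_mix_def)
qed

lemma state_projections:
  shows "(\<lambda>(x, lam, q). x) \<in> measurable states primal_space"
    and "(\<lambda>(x, lam, q). lam) \<in> measurable states dual_space"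
    and "(\<lambda>(x, lam, q). q) \<in> measurable states (count_space UNIV)"
  by (simp_all add: ipds_space_def)

lemma rpd_iters_measurable:
  "(\<lambda>lam. rpd_iters (subproblem P lam) u0 e) \<in> measurable dual_space (count_space UNIV)"
proof -
  note [measurable] = L_xx_measurable
  have *: "rpd_iters (subproblem P lam) u0 e =
      nat \<lceil>2 * (real n + sqrt (8 * real n * ((L + L_xx P lam) / \<mu>))) *
        ln (2 * ((L + L_xx P lam) / sqrt \<mu> + sqrt \<mu>)\<^sup>2 * (real n + sqrt (8 * real n * ((L + L_xx P lam) / \<mu>)))
          * bregman_radius E X (cp_dgf P) u0 / e)\<rceil>" for lam
    by (simp add: rpd_iters_def rpd_work_def rpd_log_arg_def subproblem_def)
  show ?thesis unfolding * by measurable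
qed

end


section \<open>The law of the iterates\<close>

locale ipds_run = saddle_problem P x_opt lam_opt
  for P :: "'a::{real_inner, second_countable_topology} constrained_problem" and x_opt lam_opt +
  fixes c :: real and rpd :: "'a solver" and u0 x0 :: 'a and lam0 :: "nat \<Rightarrow> real" and \<epsilon> :: real
  assumes guarantee: "rpd_guarantee c rpd" and u0: "u0 \<in> cp_interior P"
    and solver_measurable: "solver_measurable P rpd u0"
    and x0: "x0 \<in> X" and lam0: "lam0 \<in> orthant n" and eps: "0 < \<epsilon>"
begin

definition lam_hat :: "nat \<Rightarrow> 'a \<Rightarrow> (nat \<Rightarrow> real) \<Rightarrow> nat \<Rightarrow> real" where
  "lam_hat k x lam = lam_mix k lam (lam_tilde P (rho P k) x)"

definition iters :: "nat \<Rightarrow> (nat \<Rightarrow> real) \<Rightarrow> nat" where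
  "iters k lam = rpd_iters (subproblem P lam) u0 (gam \<epsilon> k)"

definition solver_run :: "nat \<Rightarrow> (nat \<Rightarrow> real) \<Rightarrow> ('a \<times> nat) measure" where
  "solver_run k lam = rpd (subproblem P lam) u0 (iters k lam)"

definition next_primal :: "nat \<Rightarrow> 'a \<Rightarrow> 'a \<Rightarrow> 'a" where
  "next_primal k x z = tau k *\<^sub>R x + (1 - tau k) *\<^sub>R z"

definition next_dual :: "nat \<Rightarrow> 'a \<Rightarrow> (nat \<Rightarrow> real) \<Rightarrow> 'a \<Rightarrow> nat \<Rightarrow> real" where
  "next_dual k x lam z = lam_mix k lam (lam_tilde P (rho P (Suc k)) (next_primal k x z))"

definition kernel :: "nat \<Rightarrow> 'a \<times> (nat \<Rightarrow> real) \<times> nat \<Rightarrow> ('a \<times> (nat \<Rightarrow> real) \<times> nat) measure" where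
  "kernel k = (\<lambda>(x, lam, q). solver_run k (lam_hat k x lam) \<bind>
     (\<lambda>(z, j). return states (next_primal k x z, next_dual k x lam z, q + 2 * j)))"

abbreviation law :: "nat \<Rightarrow> ('a \<times> (nat \<Rightarrow> real) \<times> nat) measure" where
  "law \<equiv> ipds_law P rpd u0 \<epsilon> x0 lam0"

lemma law_Suc: "law (Suc k) = law k \<bind> kernel k"
  by (simp add: kernel_def[abs_def] solver_run_def iters_def lam_hat_def next_primal_def next_dual_def Let_def)

lemma next_primal_in: "x \<in> X \<Longrightarrow> z \<in> X \<Longrightarrow> next_primal k x z \<in> X"
  using convexD_alt[OF X_convex, of z x "tau k"] tau_bounds[of k]
  by (simp add: next_primal_def add.commute)

lemma lam_hat_orthant: "lam \<in> orthant n \<Longrightarrow> lam_hat k x lam \<in> orthant n"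
  unfolding lam_hat_def by (intro lam_mix_orthant lam_tilde_orthant rho_pos)

lemma next_dual_orthant: "lam \<in> orthant n \<Longrightarrow> next_dual k x lam z \<in> orthant n"
  unfolding next_dual_def by (intro lam_mix_orthant lam_tilde_orthant rho_pos)

text \<open>The number of iterations also depends on the multiplier, but it takes only countably many values.\<close>

lemma solver_run_kernel: "solver_run k \<in> measurable dual_space (prob_algebra (run_space X))"
  unfolding solver_run_def[abs_def] iters_def
  by (rule measurable_compose_countable[OF _ rpd_iters_measurable])
    (use solver_measurable in \<open>auto simp: solver_measurable_def\<close>)

lemma transition_measurable:
  "(\<lambda>((x, lam, q), (z, j)). (next_primal k x z, next_dual k x lam z, q + 2 * j))
    \<in> measurable (states \<Otimes>\<^sub>M run_space X) states"
proof -
  let ?M = "states \<Otimes>\<^sub>M run_space X"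
  have x: "(\<lambda>((x, lam, q), (z, j)). x) \<in> measurable ?M primal_space"
    and lam: "(\<lambda>((x, lam, q), (z, j)). lam) \<in> measurable ?M dual_space"
    and q: "(\<lambda>((x, lam, q), (z, j)). q) \<in> measurable ?M (count_space UNIV)"
    and z: "(\<lambda>((x, lam, q), (z, j)). z) \<in> measurable ?M primal_space"
    and j: "(\<lambda>((x, lam, q), (z, j)). j) \<in> measurable ?M (count_space UNIV)"
    unfolding ipds_space_def run_space_def case_prod_beta' by measurable
  have xz: "(\<lambda>((x, lam, q), (z, j)). x) \<in> borel_measurable ?M"
    "(\<lambda>((x, lam, q), (z, j)). z) \<in> borel_measurable ?M"
    using x z by (auto simp: measurable_restrict_space2_iff)
  have np: "(\<lambda>((x, lam, q), (z, j)). next_primal k x z) \<in> measurable ?M primal_space"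
  proof (rule measurable_restrict_space2)
    show "(\<lambda>((x, lam, q), (z, j)). next_primal k x z) \<in> space ?M \<rightarrow> X"
      by (auto simp: space_pair_measure space_states run_space_def space_primal next_primal_in)
    have "(\<lambda>p. tau k *\<^sub>R fst (fst p) + (1 - tau k) *\<^sub>R fst (snd p)) \<in> borel_measurable ?M"
      using xz unfolding case_prod_beta'
      by (intro borel_measurable_add borel_measurable_scaleR borel_measurable_const)
    then show "(\<lambda>((x, lam, q), (z, j)). next_primal k x z) \<in> borel_measurable ?M"
      by (simp add: next_primal_def case_prod_beta')
  qed
  have nd: "(\<lambda>((x, lam, q), (z, j)). next_dual k x lam z) \<in> measurable ?M dual_space"
    using measurable_multiplier_update[OF np lam rho_pos, of k "Suc k"]
    by (simp add: next_dual_def case_prod_beta')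
  have nq: "(\<lambda>((x, lam, q), (z, j)). q + 2 * j) \<in> measurable ?M (count_space UNIV)"
  proof -
    have [measurable]: "(\<lambda>p. snd (snd (fst p))) \<in> measurable ?M (count_space UNIV)"
      "(\<lambda>p. snd (snd p)) \<in> measurable ?M (count_space UNIV)"
      using q j by (simp_all add: case_prod_beta')
    have "(\<lambda>p. snd (snd (fst p)) + 2 * snd (snd p)) \<in> measurable ?M (count_space UNIV)"
      by measurable
    then show ?thesis by (simp add: case_prod_beta')
  qed
  show ?thesis
    using measurable_Pair[OF np measurable_Pair[OF nd nq]]
    by (simp add: ipds_space_def case_prod_beta')
qed

lemma lam_hat_measurable: "(\<lambda>(x, lam, q). lam_hat k x lam) \<in> measurable states dual_space"
  using measurable_multiplier_update[OF state_projections(1,2) rho_pos, of k k]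
  by (simp add: lam_hat_def case_prod_beta')

lemma kernel_measurable: "kernel k \<in> measurable states (prob_algebra states)"
proof -
  have "(\<lambda>s. solver_run k (case s of (x, lam, q) \<Rightarrow> lam_hat k x lam))
      \<in> measurable states (prob_algebra (run_space X))"
    by (rule measurable_compose[OF lam_hat_measurable solver_run_kernel])
  moreover have "(\<lambda>(s, w). return states
      (case (s, w) of ((x, lam, q), (z, j)) \<Rightarrow> (next_primal k x z, next_dual k x lam z, q + 2 * j)))
      \<in> measurable (states \<Otimes>\<^sub>M run_space X) (prob_algebra states)"
    using measurable_compose[OF transition_measurable measurable_return_prob_space]
    by (simp add: case_prod_beta')
  ultimately show ?thesis
    using measurable_bind_prob_space2[of "\<lambda>s. solver_run k (case s of (x, lam, q) \<Rightarrow> lam_hat k x lam)"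
        states "run_space X"]
    by (fastforce simp: kernel_def case_prod_beta')
qed

lemma law_prob_algebra: "law k \<in> space (prob_algebra states)"
proof (induction k)
  case 0
  have "(x0, lam0, 0) \<in> space states" using x0 lam0 by (simp add: space_states)
  then show ?case by (auto simp: space_prob_algebra prob_space_return)
next
  case (Suc k)
  then show ?case
    unfolding law_Suc space_prob_algebra
    by (simp add: prob_space_bind'[OF Suc kernel_measurable] sets_bind'[OF Suc kernel_measurable])
qed

lemma prob_space_law: "prob_space (law k)" and sets_law: "sets (law k) = sets states"
  using law_prob_algebra[of k] by (auto simp: space_prob_algebra)

lemma space_law: "space (law k) = X \<times> orthant n \<times> UNIV"
  using sets_eq_imp_space_eq[OF sets_law] by (simp add: space_states)

lemma measurable_law: "f \<in> measurable states \<nu> \<Longrightarrow> f \<in> measurable (law k) \<nu>"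
  using measurable_cong_sets[OF sets_law refl] by blast

lemma solver_run_prob_algebra:
  "lam \<in> orthant n \<Longrightarrow> solver_run k lam \<in> space (prob_algebra (run_space X))"
  using measurable_space[OF solver_run_kernel] by (simp add: space_dual)

lemma solver_run_facts:
  assumes "lam \<in> orthant n"
  shows prob_space_run: "prob_space (solver_run k lam)"
    and sets_run: "sets (solver_run k lam) = sets (run_space X)"
    and space_run: "space (solver_run k lam) = X \<times> UNIV"
  using solver_run_prob_algebra[OF assms, of k] sets_eq_imp_space_eq[of "solver_run k lam" "run_space X"]
  by (auto simp: space_prob_algebra run_space_def space_pair_measure space_primal)

lemma nn_integral_law_Suc:
  assumes f: "f \<in> borel_measurable states"
  shows "(\<integral>\<^sup>+s. f s \<partial>law (Suc k)) =
    (\<integral>\<^sup>+(x, lam, q). (\<integral>\<^sup>+(z, j). f (next_primal k x z, next_dual k x lam z, q + 2 * j)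
        \<partial>solver_run k (lam_hat k x lam)) \<partial>law k)"
proof -
  have "(\<integral>\<^sup>+s. f s \<partial>law (Suc k)) = (\<integral>\<^sup>+s. \<integral>\<^sup>+s'. f s' \<partial>kernel k s \<partial>law k)"
    unfolding law_Suc
    by (rule nn_integral_bind[OF f measurable_law[OF measurable_prob_algebraD[OF kernel_measurable]]])
  also have "\<dots> = (\<integral>\<^sup>+(x, lam, q). (\<integral>\<^sup>+(z, j). f (next_primal k x z, next_dual k x lam z, q + 2 * j)
        \<partial>solver_run k (lam_hat k x lam)) \<partial>law k)"
  proof (rule nn_integral_cong, clarify)
    fix x lam q assume "(x, lam, q) \<in> space (law k)"
    then have s: "x \<in> X" "lam \<in> orthant n" by (auto simp: space_law)
    then have st: "(x, lam, q) \<in> space states" by (simp add: space_states)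
    let ?R = "solver_run k (lam_hat k x lam)"
    let ?T = "\<lambda>(z, j). (next_primal k x z, next_dual k x lam z, q + 2 * j)"
    have sets: "sets ?R = sets (run_space X)" by (rule sets_run[OF lam_hat_orthant[OF s(2)]])
    have "?T \<in> measurable (run_space X) states"
      using measurable_Pair2[OF transition_measurable st] by (simp add: case_prod_beta')
    then have T: "?T \<in> measurable ?R states" using measurable_cong_sets[OF sets refl] by blast
    have "(\<integral>\<^sup>+s'. f s' \<partial>kernel k (x, lam, q)) = (\<integral>\<^sup>+s'. f s' \<partial>(?R \<bind> (\<lambda>w. return states (?T w))))"
      by (simp add: kernel_def case_prod_beta')
    also have "\<dots> = (\<integral>\<^sup>+w. \<integral>\<^sup>+s'. f s' \<partial>return states (?T w) \<partial>?R)"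
      by (rule nn_integral_bind[OF f measurable_compose[OF T return_measurable]])
    also have "\<dots> = (\<integral>\<^sup>+w. f (?T w) \<partial>?R)"
      by (intro nn_integral_cong nn_integral_return f measurable_space[OF T])
    finally show "(\<integral>\<^sup>+s'. f s' \<partial>kernel k (x, lam, q)) =
        (\<integral>\<^sup>+(z, j). f (next_primal k x z, next_dual k x lam z, q + 2 * j) \<partial>?R)"
      by (simp add: case_prod_beta')
  qed
  finally show ?thesis .
qed

text \<open>Both the potential and \<open>L_xx\<close> of the new state are bounded by a function of the old state plus a multiple of the
  inaccuracy of the sub-problem solution, which is all that the guarantee of the solver controls.\<close>

lemma nn_integral_law_Suc_le:
  assumes accuracy: "\<And>lam. lam \<in> orthant n \<Longrightarrow> 1 \<le> ln (rpd_log_arg (subproblem P lam) u0 (gam \<epsilon> k))"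
    and f: "(\<lambda>(x, lam, q). f x lam) \<in> borel_measurable states"
    and b: "0 \<le> b" and h: "\<And>x lam. x \<in> X \<Longrightarrow> lam \<in> orthant n \<Longrightarrow> 0 \<le> h x lam"
    and le: "\<And>x lam z. x \<in> X \<Longrightarrow> lam \<in> orthant n \<Longrightarrow> z \<in> X \<Longrightarrow>
      f (next_primal k x z) (next_dual k x lam z)
        \<le> h x lam + b * (S z (lam_hat k x lam) - \<psi> (lam_hat k x lam))"
  shows "(\<integral>\<^sup>+(x, lam, q). ennreal (f x lam) \<partial>law (Suc k))
    \<le> (\<integral>\<^sup>+(x, lam, q). ennreal (h x lam + b * gam \<epsilon> k) \<partial>law k)"
proof -
  have "(\<integral>\<^sup>+(x, lam, q). ennreal (f x lam) \<partial>law (Suc k)) =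
    (\<integral>\<^sup>+(x, lam, q). (\<integral>\<^sup>+(z, j). ennreal (f (next_primal k x z) (next_dual k x lam z))
        \<partial>solver_run k (lam_hat k x lam)) \<partial>law k)"
    using nn_integral_law_Suc[OF measurable_compose[OF f measurable_ennreal]]
    by (simp add: case_prod_beta')
  also have "\<dots> \<le> (\<integral>\<^sup>+(x, lam, q). ennreal (h x lam + b * gam \<epsilon> k) \<partial>law k)"
  proof (rule nn_integral_mono, clarify)
    fix x lam q assume "(x, lam, q) \<in> space (law k)"
    then have s: "x \<in> X" "lam \<in> orthant n" by (auto simp: space_law)
    let ?lh = "lam_hat k x lam"
    note lh = lam_hat_orthant[OF s(2), of k x]
    let ?R = "solver_run k ?lh"
    let ?\<delta> = "\<lambda>z. S z ?lh - \<psi> ?lh"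
    interpret R: prob_space ?R by (rule prob_space_run[OF lh])
    have "(\<lambda>z. S z ?lh) \<in> borel_measurable primal_space"
      unfolding lagrangian_eq
      by (intro borel_measurable_add borel_measurable_sum borel_measurable_times obj_measurable g_measurable) auto
    then have "(\<lambda>(z, j). ?\<delta> z) \<in> borel_measurable (run_space X)" unfolding run_space_def by measurable
    then have meas: "(\<lambda>(z, j). ?\<delta> z) \<in> borel_measurable ?R"
      using measurable_cong_sets[OF sets_run[OF lh] refl] by blast
    have g0: "0 < gam \<epsilon> k" using eps by (simp add: gam_def)
    have u0': "u0 \<in> co_set (subproblem P ?lh) \<inter> int_dom (co_space (subproblem P ?lh)) (co_dgf (subproblem P ?lh))"
      using u0 by (simp add: subproblem_def cp_interior_def)
    have "(\<integral>\<^sup>+(z, j). ennreal (co_obj (subproblem P ?lh) z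
        - (INF v\<in>co_set (subproblem P ?lh). co_obj (subproblem P ?lh) v)) \<partial>?R) \<le> ennreal (gam \<epsilon> k)"
      using guarantee valid_composite_subproblem[OF lh] u0' g0 accuracy[OF lh]
      unfolding rpd_guarantee_def solver_run_def iters_def by blast
    moreover have "(INF v\<in>co_set (subproblem P ?lh). co_obj (subproblem P ?lh) v) = \<psi> ?lh"
      unfolding dual_fun_def co_obj_subproblem by (simp add: subproblem_def)
    ultimately have acc: "(\<integral>\<^sup>+w. ennreal (case w of (z, j) \<Rightarrow> ?\<delta> z) \<partial>?R) \<le> ennreal (gam \<epsilon> k)"
      by (simp add: co_obj_subproblem case_prod_beta')
    have "(\<integral>\<^sup>+w. ennreal (case w of (z, j) \<Rightarrow> f (next_primal k x z) (next_dual k x lam z)) \<partial>?R)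
      \<le> ennreal (b * gam \<epsilon> k + 0 * 0 + h x lam)"
      using acc meas s lh b h[OF s] g0 le[OF s] dual_fun_le
      by (intro nn_integral_affine_le[where f = "\<lambda>(z, j). ?\<delta> z" and h = "\<lambda>_. 0"] R.prob_space_axioms)
        (auto simp: space_run[OF lh] add.commute)
    then show "(\<integral>\<^sup>+(z, j). ennreal (f (next_primal k x z) (next_dual k x lam z)) \<partial>?R)
        \<le> ennreal (h x lam + b * gam \<epsilon> k)"
      by (simp add: case_prod_beta' add.commute)
  qed
  finally show ?thesis .
qed

lemma calls_le:
  assumes accuracy: "\<And>lam. lam \<in> orthant n \<Longrightarrow> 1 \<le> ln (rpd_log_arg (subproblem P lam) u0 (gam \<epsilon> k))"
  shows "(\<integral>\<^sup>+(x, lam, q). of_nat q \<partial>law (Suc k))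
    \<le> (\<integral>\<^sup>+(x, lam, q). of_nat q \<partial>law k)
      + (\<integral>\<^sup>+(x, lam, q). ennreal (2 * max c 0 * real (iters k (lam_hat k x lam))) \<partial>law k)"
proof -
  have q [measurable]: "(\<lambda>(x, lam, q). of_nat q :: ennreal) \<in> borel_measurable states"
    using measurable_compose[OF state_projections(3), of "of_nat :: nat \<Rightarrow> ennreal" borel]
    by (simp add: case_prod_beta')
  have [measurable]: "(\<lambda>(x, lam, q). ennreal (2 * max c 0 * real (iters k (lam_hat k x lam)))) \<in> borel_measurable states"
  proof -
    have "(\<lambda>s. iters k (case s of (x, lam, q) \<Rightarrow> lam_hat k x lam)) \<in> measurable states (count_space UNIV)"
      unfolding iters_def by (rule measurable_compose[OF lam_hat_measurable rpd_iters_measurable])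
    from measurable_compose[OF this, of "\<lambda>m. ennreal (2 * max c 0 * real m)" borel]
    show ?thesis by (simp add: case_prod_beta')
  qed
  have "(\<integral>\<^sup>+(x, lam, q). of_nat q \<partial>law (Suc k)) =
    (\<integral>\<^sup>+(x, lam, q). (\<integral>\<^sup>+(z, j). of_nat (q + 2 * j) \<partial>solver_run k (lam_hat k x lam)) \<partial>law k)"
    using nn_integral_law_Suc[OF q] by (simp add: case_prod_beta')
  also have "\<dots> \<le> (\<integral>\<^sup>+s. (case s of (x, lam, q) \<Rightarrow> of_nat q)
      + (case s of (x, lam, q) \<Rightarrow> ennreal (2 * max c 0 * real (iters k (lam_hat k x lam)))) \<partial>law k)"
  proof (rule nn_integral_mono, clarify)
    fix x lam q assume "(x, lam, q) \<in> space (law k)"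
    then have s: "x \<in> X" "lam \<in> orthant n" by (auto simp: space_law)
    let ?lh = "lam_hat k x lam"
    note lh = lam_hat_orthant[OF s(2), of k x]
    let ?R = "solver_run k ?lh"
    interpret R: prob_space ?R by (rule prob_space_run[OF lh])
    have g0: "0 < gam \<epsilon> k" using eps by (simp add: gam_def)
    have u0': "u0 \<in> co_set (subproblem P ?lh) \<inter> int_dom (co_space (subproblem P ?lh)) (co_dgf (subproblem P ?lh))"
      using u0 by (simp add: subproblem_def cp_interior_def)
    have AE: "AE (z, j) in ?R. real j \<le> c * real (iters k ?lh)"
      using guarantee valid_composite_subproblem[OF lh] u0' g0 accuracy[OF lh]
      unfolding rpd_guarantee_def solver_run_def iters_def by blast
    have "(\<integral>\<^sup>+(z, j). of_nat (q + 2 * j) \<partial>?R)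
      \<le> (\<integral>\<^sup>+w. of_nat q + ennreal (2 * max c 0 * real (iters k ?lh)) \<partial>?R)"
    proof (rule nn_integral_mono_AE, use AE in eventually_elim, clarify)
      fix z :: 'a and j assume j: "real j \<le> c * real (iters k ?lh)"
      have "c * real (iters k ?lh) \<le> max c 0 * real (iters k ?lh)" by (intro mult_right_mono) auto
      with j have "real q + 2 * real j \<le> real q + 2 * max c 0 * real (iters k ?lh)" by simp
      then have "ennreal (real (q + 2 * j)) \<le> ennreal (real q + 2 * max c 0 * real (iters k ?lh))"
        by (intro ennreal_leI) simp
      also have "\<dots> = ennreal (real q) + ennreal (2 * max c 0 * real (iters k ?lh))"
        by (intro ennreal_plus) auto
      finally show "of_nat (q + 2 * j) \<le> of_nat q + ennreal (2 * max c 0 * real (iters k ?lh))"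
        by (simp only: ennreal_of_nat_eq_real_of_nat)
    qed
    also have "\<dots> = of_nat q + ennreal (2 * max c 0 * real (iters k ?lh))"
      by (simp add: R.emeasure_space_1)
    finally show "(\<integral>\<^sup>+(z, j). of_nat (q + 2 * j) \<partial>?R)
      \<le> of_nat q + ennreal (2 * max c 0 * real (iters k ?lh))" .
  qed
  also have "\<dots> = (\<integral>\<^sup>+(x, lam, q). of_nat q \<partial>law k)
      + (\<integral>\<^sup>+(x, lam, q). ennreal (2 * max c 0 * real (iters k (lam_hat k x lam))) \<partial>law k)"
    by (intro nn_integral_add measurable_law) measurable
  finally show ?thesis .
qed

end


section \<open>Expected potential, multipliers and oracle calls\<close>

context slater_problem
begin

lemma L_xx_lam_mix: "L_xx P (lam_mix k lam lam') = tau k * L_xx P lam + (1 - tau k) * L_xx P lam'"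
  by (simp add: L_xx_def lam_mix_def distrib_right sum.distrib sum_distrib_left mult.assoc)

end

context saddle_problem
begin

lemma potential_measurable: "(\<lambda>(x, lam, q). potential \<rho> x lam) \<in> borel_measurable states"
proof -
  have [measurable]: "(\<lambda>s. smoothed_primal \<rho> (fst s)) \<in> borel_measurable states"
    "(\<lambda>s. \<psi> (fst (snd s))) \<in> borel_measurable states"
    using measurable_compose[OF state_projections(1) smoothed_primal_measurable]
      measurable_compose[OF state_projections(2) dual_fun_measurable]
    by (simp_all add: case_prod_beta')
  show ?thesis unfolding potential_def case_prod_beta' by measurable
qed

lemma L_xx_lam_tilde_le:
  assumes rho: "0 < \<rho>" and x: "x \<in> X" and lam: "lam \<in> orthant n"
    and B: "\<And>i. i < n \<Longrightarrow> lam_opt i \<le> B"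
  shows "L_xx P (lam_tilde P \<rho> x) \<le> alpha_of P * (B + 1 / 2 + potential \<rho> x lam / \<rho>)"
proof -
  have "L_xx P (lam_tilde P \<rho> x) \<le> (\<Sum>i<n. (B + 1 / 2 + potential \<rho> x lam / \<rho>) * cp_alpha P i)"
    unfolding L_xx_def
  proof (intro sum_mono mult_right_mono)
    fix i assume "i \<in> {..<n}"
    then show "lam_tilde P \<rho> x i \<le> B + 1 / 2 + potential \<rho> x lam / \<rho>"
      using multiplier_le_potential[OF rho x lam, of i] B[of i] by (simp add: lam_tilde_def)
  qed (use alpha_nonneg in auto)
  then show ?thesis by (simp add: alpha_of_def sum_distrib_left[symmetric] mult.commute[of _ "sum _ _"])
qed

end

context ipds_run
begin

text \<open>The solution of \<open>e\<^sub>0 = V\<^sub>0\<close>, \<open>e\<^sub>k\<^sub>+\<^sub>1 = \<tau>\<^sub>k e\<^sub>k + 2 \<gamma>\<^sub>k\<close>. Its second summand, the accumulated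
  inaccuracy, never exceeds \<open>\<epsilon>/4\<close>.\<close>

definition potential_bound :: "nat \<Rightarrow> real" where
  "potential_bound k = 2 * potential (rho P 0) x0 lam0 / ((real k + 1) * (real k + 2))
     + \<epsilon> * (real k * (real k + 3)) / (4 * ((real k + 1) * (real k + 2)))"

lemma potential_bound_Suc: "potential_bound (Suc k) = tau k * potential_bound k + 2 * gam \<epsilon> k"
proof -
  have nz: "real k + 1 \<noteq> 0" "real k + 2 \<noteq> 0" "real k + 3 \<noteq> 0" by auto
  have "tau k * (2 * V / ((real k + 1) * (real k + 2))) = 2 * V / ((real k + 2) * (real k + 3))" for V
    using nz by (simp add: tau_def divide_simps)
  moreover have "tau k * (\<epsilon> * (real k * (real k + 3)) / (4 * ((real k + 1) * (real k + 2)))) + 2 * gam \<epsilon> k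
      = \<epsilon> * ((real k + 1) * (real k + 4)) / (4 * ((real k + 2) * (real k + 3)))"
    using nz by (simp add: tau_def gam_def divide_simps) (simp add: algebra_simps)
  moreover have "real (Suc k) = real k + 1" "real (Suc k) + 1 = real k + 2" "real (Suc k) + 2 = real k + 3"
    "real (Suc k) + 3 = real k + 4" by auto
  ultimately show ?thesis
    unfolding potential_bound_def distrib_left[of "tau k"] by (simp only: add.assoc)
qed

lemma potential0_nonneg: "0 \<le> potential (rho P 0) x0 lam0"
  by (intro potential_nonneg rho_pos x0 lam0)

lemma potential_bound_nonneg: "0 \<le> potential_bound k"
  using potential0_nonneg eps by (simp add: potential_bound_def)

lemma gam_nonneg: "0 \<le> gam \<epsilon> k"
  using eps by (simp add: gam_def)

text \<open>The guarantee of the solver applies to every sub-problem of iteration \<open>k\<close>.\<close>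

definition accurate :: "nat \<Rightarrow> bool" where
  "accurate k \<longleftrightarrow> (\<forall>lam\<in>orthant n. 1 \<le> ln (rpd_log_arg (subproblem P lam) u0 (gam \<epsilon> k)))"

lemma initial_state: "(x0, lam0, 0) \<in> space states"
  using x0 lam0 by (simp add: space_states)

lemma nn_integral_law_0:
  assumes "(\<lambda>(x, lam, q). f x lam) \<in> borel_measurable states"
  shows "(\<integral>\<^sup>+(x, lam, q). ennreal (f x lam) \<partial>law 0) = ennreal (f x0 lam0)"
proof -
  have "(\<lambda>(x, lam, q). ennreal (f x lam)) \<in> borel_measurable states"
    using measurable_compose[OF assms measurable_ennreal] by (simp add: case_prod_beta')
  from nn_integral_return[OF initial_state this] show ?thesis by simp
qed

lemma expected_potential:
  assumes "\<And>j. j < k \<Longrightarrow> accurate j"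
  shows "(\<integral>\<^sup>+(x, lam, q). ennreal (potential (rho P k) x lam) \<partial>law k) \<le> ennreal (potential_bound k)"
  using assms
proof (induction k)
  case 0
  then show ?case
    by (subst nn_integral_law_0[OF potential_measurable]) (simp add: potential_bound_def)
next
  case (Suc k)
  have "(\<integral>\<^sup>+(x, lam, q). ennreal (potential (rho P (Suc k)) x lam) \<partial>law (Suc k))
    \<le> (\<integral>\<^sup>+(x, lam, q). ennreal (tau k * potential (rho P k) x lam + 2 * gam \<epsilon> k) \<partial>law k)"
  proof (rule nn_integral_law_Suc_le[OF _ potential_measurable])
    show "potential (rho P (Suc k)) (next_primal k x z) (next_dual k x lam z)
      \<le> tau k * potential (rho P k) x lam + 2 * (S z (lam_hat k x lam) - \<psi> (lam_hat k x lam))"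
      if "x \<in> X" "lam \<in> orthant n" "z \<in> X" for x lam z
      by (rule potential_step[OF that(1,3,2)]) (simp_all add: lam_hat_def next_primal_def next_dual_def)
  qed (use Suc.prems tau_bounds[of k] potential_nonneg[OF rho_pos] in \<open>auto simp: accurate_def\<close>)
  also have "\<dots> \<le> ennreal (tau k * potential_bound k + 0 * 0 + 2 * gam \<epsilon> k)"
    unfolding case_prod_beta'
    using Suc tau_bounds[of k] gam_nonneg potential_bound_nonneg measurable_law[OF potential_measurable]
    by (intro nn_integral_affine_le[OF prob_space_law, where h = "\<lambda>_. 0"])
      (auto simp: case_prod_beta' space_law intro!: potential_nonneg rho_pos)
  finally show ?case by (simp add: potential_bound_Suc)
qed

lemma L_xx_state_measurable: "(\<lambda>(x, lam, q). L_xx P lam) \<in> borel_measurable states"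
  using measurable_compose[OF state_projections(2) L_xx_measurable] by (simp add: case_prod_beta')

lemma L_xx_le_alpha:
  assumes "\<And>i. i < n \<Longrightarrow> lam i \<le> \<Gamma>"
  shows "L_xx P lam \<le> alpha_of P * \<Gamma>"
proof -
  have "L_xx P lam \<le> (\<Sum>i<n. \<Gamma> * cp_alpha P i)"
    unfolding L_xx_def using assms alpha_nonneg by (intro sum_mono mult_right_mono) auto
  then show ?thesis by (simp add: alpha_of_def sum_distrib_left mult.commute)
qed

text \<open>
  The multipliers are convex combinations of \<open>lam0\<close> and of the points \<open>lam_tilde\<close>, whose size is
  affine in the potential divided by \<open>\<rho>\<^sub>k\<close>. Hence the expected smoothness constant of the sub-problems stays
  bounded as long as the expected potential is at most a multiple of \<open>\<rho>\<^sub>k\<close>.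
\<close>

lemma expected_L_xx:
  assumes "\<And>j. j < k \<Longrightarrow> accurate j"
    and v: "\<And>j. j \<le> k \<Longrightarrow> potential_bound j \<le> v * rho P j"
    and B: "\<And>i. i < n \<Longrightarrow> lam_opt i \<le> B" "0 \<le> B"
    and \<Gamma>: "\<And>i. i < n \<Longrightarrow> lam0 i \<le> \<Gamma>" "B + 1 / 2 + v \<le> \<Gamma>" "0 \<le> \<Gamma>"
  shows "(\<integral>\<^sup>+(x, lam, q). ennreal (L_xx P lam) \<partial>law k) \<le> ennreal (alpha_of P * \<Gamma>)"
  using assms(1,2)
proof (induction k)
  case 0
  then show ?case
    by (subst nn_integral_law_0[OF L_xx_state_measurable]) (intro ennreal_leI L_xx_le_alpha \<Gamma>(1))
next
  case (Suc k)
  let ?a = "alpha_of P" and ?t = "tau k" and ?r = "rho P (Suc k)"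
  let ?b = "(1 - ?t) * ?a / ?r"
  let ?d = "(1 - ?t) * ?a * (B + 1 / 2)"
  have t: "0 < ?t" "?t < 1" by (rule tau_bounds)+
  have a: "0 \<le> ?a" by (rule alpha_of_nonneg)
  have r: "0 < ?r" by (rule rho_pos)
  have b: "0 \<le> ?b" and d: "0 \<le> ?d" using t a r B(2) by (auto intro!: mult_nonneg_nonneg divide_nonneg_nonneg)
  have "(\<integral>\<^sup>+(x, lam, q). ennreal (L_xx P lam) \<partial>law (Suc k))
    \<le> (\<integral>\<^sup>+(x, lam, q). ennreal (?t * L_xx P lam + ?d + ?b * (?t * potential (rho P k) x lam)
        + (?b * 2) * gam \<epsilon> k) \<partial>law k)"
  proof (rule nn_integral_law_Suc_le[OF _ L_xx_state_measurable])
    fix x lam z assume s: "x \<in> X" "lam \<in> orthant n" "z \<in> X"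
    let ?\<delta> = "S z (lam_hat k x lam) - \<psi> (lam_hat k x lam)"
    let ?V = "potential ?r (next_primal k x z) (next_dual k x lam z)"
    have V: "?V \<le> ?t * potential (rho P k) x lam + 2 * ?\<delta>"
      by (rule potential_step[OF s(1,3,2)]) (simp_all add: lam_hat_def next_primal_def next_dual_def)
    have "L_xx P (next_dual k x lam z)
      = ?t * L_xx P lam + (1 - ?t) * L_xx P (lam_tilde P ?r (next_primal k x z))"
      unfolding next_dual_def by (rule L_xx_lam_mix)
    also have "\<dots> \<le> ?t * L_xx P lam + (1 - ?t) * (?a * (B + 1 / 2 + ?V / ?r))"
      using t s by (intro add_left_mono mult_left_mono
          L_xx_lam_tilde_le[OF r next_primal_in next_dual_orthant B(1)]) auto
    also have "\<dots> = ?t * L_xx P lam + ?d + ?b * ?V"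
      by (simp only: distrib_left mult.assoc times_divide_eq_right times_divide_eq_left add.assoc)
    also have "\<dots> \<le> ?t * L_xx P lam + ?d + ?b * (?t * potential (rho P k) x lam + 2 * ?\<delta>)"
      by (intro add_left_mono mult_left_mono V b)
    finally show "L_xx P (next_dual k x lam z)
      \<le> ?t * L_xx P lam + ?d + ?b * (?t * potential (rho P k) x lam) + (?b * 2) * ?\<delta>"
      by (simp only: distrib_left[of ?b] mult.assoc add.assoc)
  next
    fix x lam assume "x \<in> X" "lam \<in> orthant n"
    then show "0 \<le> ?t * L_xx P lam + ?d + ?b * (?t * potential (rho P k) x lam)"
      using t a b B(2) L_xx_nonneg potential_nonneg[OF rho_pos]
      by (intro add_nonneg_nonneg mult_nonneg_nonneg) auto
  next
    show "0 \<le> ?b * 2" by (rule mult_nonneg_nonneg[OF b]) simp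
  qed (use Suc.prems in \<open>auto simp: accurate_def\<close>)
  also have "\<dots> \<le> ennreal (?t * (?a * \<Gamma>) + (?b * ?t) * potential_bound k + (?d + (?b * 2) * gam \<epsilon> k))"
    unfolding case_prod_beta'
  proof (rule nn_integral_affine_le[OF prob_space_law,
        where f = "\<lambda>s. L_xx P (fst (snd s))" and h = "\<lambda>s. potential (rho P k) (fst s) (fst (snd s))"])
    show "(\<integral>\<^sup>+s. ennreal (L_xx P (fst (snd s))) \<partial>law k) \<le> ennreal (?a * \<Gamma>)"
      using Suc by (simp add: case_prod_beta')
    show "(\<integral>\<^sup>+s. ennreal (potential (rho P k) (fst s) (fst (snd s))) \<partial>law k) \<le> ennreal (potential_bound k)"
      using expected_potential[of k] Suc.prems(1) by (simp add: case_prod_beta')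
    show "0 \<le> ?b * ?t" using b t by (intro mult_nonneg_nonneg) auto
    show "0 \<le> ?d + (?b * 2) * gam \<epsilon> k"
      by (intro add_nonneg_nonneg d mult_nonneg_nonneg[OF mult_nonneg_nonneg[OF b]] gam_nonneg) simp
    fix s
    show "?t * L_xx P (fst (snd s)) + ?d + ?b * (?t * potential (rho P k) (fst s) (fst (snd s)))
        + (?b * 2) * gam \<epsilon> k
      \<le> ?t * L_xx P (fst (snd s)) + (?b * ?t) * potential (rho P k) (fst s) (fst (snd s))
        + (?d + (?b * 2) * gam \<epsilon> k)"
      by (simp only: ac_simps order_refl)
  qed (use t a \<Gamma> potential_bound_nonneg measurable_law[OF L_xx_state_measurable]
      measurable_law[OF potential_measurable] in
      \<open>auto simp: case_prod_beta' space_law intro!: L_xx_nonneg potential_nonneg rho_pos\<close>)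
  also have "\<dots> \<le> ennreal (?a * \<Gamma>)"
  proof (rule ennreal_leI)
    have "?b * potential_bound (Suc k) \<le> ?b * (v * ?r)"
      by (intro mult_left_mono Suc.prems(2) order_refl b)
    also have "\<dots> = (1 - ?t) * ?a * v" using less_imp_neq[OF r] by (simp del: rho.simps)
    finally have *: "?b * potential_bound (Suc k) \<le> (1 - ?t) * ?a * v" .
    have "?t * (?a * \<Gamma>) + (?b * ?t) * potential_bound k + (?d + (?b * 2) * gam \<epsilon> k)
      = ?t * (?a * \<Gamma>) + ?d + ?b * potential_bound (Suc k)"
      unfolding potential_bound_Suc by (simp add: distrib_left mult.assoc)
    also have "\<dots> \<le> ?t * (?a * \<Gamma>) + (1 - ?t) * (?a * (B + 1 / 2 + v))"
      using * by (simp add: distrib_left mult.assoc)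
    also have "\<dots> \<le> ?t * (?a * \<Gamma>) + (1 - ?t) * (?a * \<Gamma>)"
      using t a \<Gamma>(2) by (intro add_left_mono mult_left_mono) auto
    finally show "?t * (?a * \<Gamma>) + (?b * ?t) * potential_bound k + (?d + (?b * 2) * gam \<epsilon> k) \<le> ?a * \<Gamma>"
      unfolding left_diff_distrib[of 1 ?t "?a * \<Gamma>"] by linarith
  qed
  finally show ?case .
qed

text \<open>The work of one run of the solver, with the random \<open>L_xx\<close> replaced by \<open>\<alpha>\<close>.\<close>

definition work_bound :: real where
  "work_bound = real n + sqrt (8 * real n * ((L + alpha_of P) / \<mu>))"

definition radius :: real where
  "radius = bregman_radius E X (cp_dgf P) u0"

text \<open>
  With \<open>b = (L + \<alpha>)/\<mu>\<close>, \<open>a = (L + L_xx)/\<mu>\<close> and \<open>y = a/b\<close>, the work is at most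
  \<open>(1 + \<surd>y)\<close> times \<open>work_bound\<close>, and the logarithm is at most \<open>\<Lambda> + 3 ln y\<close>, because its argument grows at most like \<open>a\<^sup>3\<close>.
  Here \<open>ln y \<le> 2 \<surd>y\<close>, and the product \<open>(1 + \<surd>y) (\<Lambda> + 6 \<surd>y)\<close> is at most affine in \<open>y\<close>.
\<close>

lemma iters_le:
  assumes lam: "lam \<in> orthant n" and acc: "accurate k" and radius: "0 < radius"
    and \<Lambda>: "ln (32 * \<mu> * real n * radius * ((L + alpha_of P) / \<mu>) ^ 3 / gam \<epsilon> k) \<le> \<Lambda>" "1 \<le> \<Lambda>"
  shows "real (iters k lam)
    \<le> 3 * work_bound * \<Lambda> * (5 + 10 * ((L + L_xx P lam) / (L + alpha_of P)))"
proof -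
  define a b y where "a = (L + L_xx P lam) / \<mu>" and "b = (L + alpha_of P) / \<mu>" and "y = a / b"
  define w where "w = real n + sqrt (8 * real n * a)"
  define G where "G = 32 * \<mu> * real n * radius * b ^ 3 / gam \<epsilon> k"
  define l where "l = ln (rpd_log_arg (subproblem P lam) u0 (gam \<epsilon> k))"
  have n1: "1 \<le> real n" using n_pos by simp
  have g0: "0 < gam \<epsilon> k" using eps by (simp add: gam_def)
  have a1: "1 \<le> a" using mu_pos mu_le_L L_xx_nonneg[OF lam] by (simp add: a_def)
  have b1: "1 \<le> b" using mu_pos mu_le_L alpha_of_nonneg by (simp add: b_def)
  have y0: "0 < y" using a1 b1 by (simp add: y_def)
  have ay: "a = b * y" using b1 by (simp add: y_def)
  have y_eq: "y = (L + L_xx P lam) / (L + alpha_of P)"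
    using mu_pos by (simp add: y_def a_def b_def)
  have w1: "1 \<le> w" using n1 a1 by (simp add: w_def add_increasing2)
  have w_rpd: "rpd_work (subproblem P lam) = w"
    by (simp add: rpd_work_def subproblem_def w_def a_def)
  have arg: "rpd_log_arg (subproblem P lam) u0 (gam \<epsilon> k)
      = 2 * (\<mu> * (a + 1)\<^sup>2) * w * radius / gam \<epsilon> k"
  proof -
    have "(L + L_xx P lam) / sqrt \<mu> = sqrt \<mu> * a"
      using mu_pos real_sqrt_mult_self[of \<mu>] by (simp add: a_def field_simps)
    then have "((L + L_xx P lam) / sqrt \<mu> + sqrt \<mu>)\<^sup>2 = \<mu> * (a + 1)\<^sup>2"
      using mu_pos by (simp add: power_mult_distrib flip: distrib_left[of "sqrt \<mu>" a 1, simplified])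
    then show ?thesis
      using w_rpd by (simp add: rpd_log_arg_def radius_def) (simp add: subproblem_def)
  qed
  have w4: "w \<le> 4 * (real n * a)"
  proof -
    have na: "1 \<le> real n * a" using mult_mono[OF n1 a1] by simp
    have "sqrt (8 * real n * a) \<le> 3 * (real n * a)"
    proof (rule real_le_lsqrt)
      have "8 * (real n * a) * 1 \<le> 8 * (real n * a) * (real n * a)" using na by (intro mult_left_mono) auto
      also have "\<dots> \<le> 9 * (real n * a) * (real n * a)" using na by (intro mult_right_mono) auto
      also have "\<dots> = (3 * (real n * a))\<^sup>2" by (simp add: power2_eq_square)
      finally show "8 * real n * a \<le> (3 * (real n * a))\<^sup>2" by simp
    qed (use na in auto)
    moreover have "real n \<le> real n * a" using n1 a1 by simp
    ultimately show ?thesis by (simp add: w_def)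
  qed
  have G0: "0 < G" using mu_pos n1 radius b1 g0 by (simp add: G_def)
  have "rpd_log_arg (subproblem P lam) u0 (gam \<epsilon> k)
      \<le> 2 * (\<mu> * (2 * a)\<^sup>2) * (4 * (real n * a)) * radius / gam \<epsilon> k"
    unfolding arg using mu_pos a1 w1 w4 radius g0
    by (intro divide_right_mono mult_right_mono mult_mono mult_left_mono power_mono) auto
  also have "\<dots> = G * y ^ 3"
    unfolding ay G_def by (simp add: power2_eq_square power3_eq_cube)
  finally have "l \<le> ln (G * y ^ 3)"
    unfolding l_def arg using mu_pos a1 w1 radius g0
    by (intro ln_mono) (auto intro!: divide_pos_pos mult_pos_pos zero_less_power)
  also have "\<dots> = ln G + 3 * ln y" using G0 y0 by (simp add: ln_mult ln_realpow)
  also have "ln y \<le> 2 * sqrt y"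
    using ln_le_minus_one[of "sqrt y"] y0 by (simp add: ln_sqrt)
  finally have l: "l \<le> \<Lambda> + 6 * sqrt y" using \<Lambda>(1) by (simp add: G_def b_def)
  have l1: "1 \<le> l" using acc lam by (simp add: accurate_def l_def)
  have w: "w \<le> work_bound * (1 + sqrt y)"
  proof -
    have "sqrt (8 * real n * a) = sqrt (8 * real n * b) * sqrt y"
      by (simp add: ay real_sqrt_mult)
    moreover have "0 \<le> sqrt y * real n" "0 \<le> sqrt (8 * real n * b)" using y0 b1 by auto
    moreover have "work_bound = real n + sqrt (8 * real n * b)" by (simp add: work_bound_def b_def)
    ultimately show ?thesis by (simp add: w_def distrib_left distrib_right mult.commute)
  qed
  have W0: "0 \<le> work_bound" using L_pos alpha_of_nonneg mu_pos by (simp add: work_bound_def)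
  have sy: "0 \<le> sqrt y" "sqrt y \<le> (1 + y) / 2"
    using y0 zero_le_power2[of "sqrt y - 1"] by (auto simp: power2_diff)
  have "real (iters k lam) = real (nat \<lceil>2 * w * l\<rceil>)"
    by (simp add: iters_def rpd_iters_def w_rpd l_def)
  also have "\<dots> \<le> 2 * (w * l) + 1"
    using w1 l1 by (simp add: of_nat_nat) linarith
  also have "\<dots> \<le> 3 * (w * l)" using mult_mono[OF w1 l1] w1 by (simp add: mult.commute)
  also have "\<dots> \<le> 3 * (work_bound * (1 + sqrt y) * (\<Lambda> + 6 * sqrt y))"
    using w l w1 l1 W0 sy(1) by (intro mult_left_mono mult_mono) auto
  also have "\<dots> \<le> 3 * (work_bound * (1 + sqrt y) * (\<Lambda> * (1 + 6 * sqrt y)))"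
    using W0 sy(1) \<Lambda>(2) mult_right_mono[OF \<Lambda>(2), of "6 * sqrt y"]
    by (intro mult_left_mono) (auto simp: distrib_left)
  also have "\<dots> = 3 * work_bound * \<Lambda> * ((1 + sqrt y) * (1 + 6 * sqrt y))" by simp
  also have "\<dots> \<le> 3 * work_bound * \<Lambda> * (5 + 10 * y)"
  proof (rule mult_left_mono)
    have "(1 + sqrt y) * (1 + 6 * sqrt y) = 1 + 7 * sqrt y + 6 * y"
      using y0 by (simp add: algebra_simps)
    then show "(1 + sqrt y) * (1 + 6 * sqrt y) \<le> 5 + 10 * y" using sy y0 by simp
  qed (use W0 \<Lambda>(2) in simp)
  finally show ?thesis unfolding y_eq .
qed

lemma expected_calls_step:
  assumes acc: "\<And>j. j \<le> k \<Longrightarrow> accurate j" and radius: "0 < radius"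
    and \<Lambda>: "ln (32 * \<mu> * real n * radius * ((L + alpha_of P) / \<mu>) ^ 3 / gam \<epsilon> k) \<le> \<Lambda>" "1 \<le> \<Lambda>"
    and v: "\<And>j. j \<le> k \<Longrightarrow> potential_bound j \<le> v * rho P j"
    and B: "\<And>i. i < n \<Longrightarrow> lam_opt i \<le> B" "0 \<le> B"
    and \<Gamma>: "\<And>i. i < n \<Longrightarrow> lam0 i \<le> \<Gamma>" "B + 1 / 2 + v \<le> \<Gamma>" "0 \<le> \<Gamma>"
  shows "(\<integral>\<^sup>+(x, lam, q). ennreal (2 * max c 0 * real (iters k (lam_hat k x lam))) \<partial>law k)
    \<le> ennreal (6 * max c 0 * work_bound * \<Lambda> * (15 + 10 * \<Gamma>))"
proof -
  define Q where "Q = 6 * max c 0 * work_bound * \<Lambda>"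
  define Q' where "Q' = 10 * Q / (L + alpha_of P)"
  let ?a = "alpha_of P" and ?t = "tau k" and ?r = "rho P k"
  have t: "0 < ?t" "?t < 1" by (rule tau_bounds)+
  have a: "0 \<le> ?a" by (rule alpha_of_nonneg)
  have r: "0 < ?r" by (rule rho_pos)
  have La: "0 < L + ?a" using L_pos a by simp
  have W0: "0 \<le> work_bound" using L_pos a mu_pos by (simp add: work_bound_def)
  have Q0: "0 \<le> Q" and Q'0: "0 \<le> Q'" using W0 \<Lambda>(2) La by (auto simp: Q_def Q'_def)
  have "(\<integral>\<^sup>+s. ennreal (2 * max c 0 * real (iters k (lam_hat k (fst s) (fst (snd s))))) \<partial>law k)
    \<le> ennreal ((Q' * ?t) * (?a * \<Gamma>) + (Q' * (1 - ?t) * ?a / ?r) * potential_bound k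
        + (5 * Q + Q' * (L + (1 - ?t) * (?a * (B + 1 / 2)))))"
  proof (rule nn_integral_affine_le[OF prob_space_law,
        where f = "\<lambda>s. L_xx P (fst (snd s))" and h = "\<lambda>s. potential ?r (fst s) (fst (snd s))"])
    show "(\<integral>\<^sup>+s. ennreal (L_xx P (fst (snd s))) \<partial>law k) \<le> ennreal (?a * \<Gamma>)"
      using expected_L_xx[of k, OF _ v B \<Gamma>] acc by (simp add: case_prod_beta')
    show "(\<integral>\<^sup>+s. ennreal (potential ?r (fst s) (fst (snd s))) \<partial>law k) \<le> ennreal (potential_bound k)"
      using expected_potential[of k] acc by (simp add: case_prod_beta')
    fix s assume "s \<in> space (law k)"
    then have s: "fst s \<in> X" "fst (snd s) \<in> orthant n" by (auto simp: space_law)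
    let ?lam = "fst (snd s)" and ?V = "potential ?r (fst s) (fst (snd s))"
    let ?lh = "lam_hat k (fst s) ?lam"
    have "L_xx P ?lh = ?t * L_xx P ?lam + (1 - ?t) * L_xx P (lam_tilde P ?r (fst s))"
      unfolding lam_hat_def by (rule L_xx_lam_mix)
    also have "\<dots> \<le> ?t * L_xx P ?lam + (1 - ?t) * (?a * (B + 1 / 2 + ?V / ?r))"
      using t s by (intro add_left_mono mult_left_mono L_xx_lam_tilde_le[OF r _ _ B(1)]) auto
    finally have lh: "L_xx P ?lh \<le> \<dots>" .
    have "2 * max c 0 * real (iters k ?lh)
      \<le> 2 * max c 0 * (3 * work_bound * \<Lambda> * (5 + 10 * ((L + L_xx P ?lh) / (L + ?a))))"
      using s acc radius \<Lambda> by (intro mult_left_mono iters_le lam_hat_orthant) auto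
    also have "\<dots> = 5 * Q + Q' * (L + L_xx P ?lh)" by (simp add: Q_def Q'_def algebra_simps)
    also have "\<dots> \<le> 5 * Q + Q' * (L + (?t * L_xx P ?lam + (1 - ?t) * (?a * (B + 1 / 2 + ?V / ?r))))"
      using lh Q'0 by (intro add_left_mono mult_left_mono) auto
    finally show "2 * max c 0 * real (iters k ?lh)
      \<le> (Q' * ?t) * L_xx P ?lam + (Q' * (1 - ?t) * ?a / ?r) * ?V
        + (5 * Q + Q' * (L + (1 - ?t) * (?a * (B + 1 / 2))))"
      by (simp add: algebra_simps)
  qed (use t a r B(2) L_pos Q0 Q'0 \<Gamma> potential_bound_nonneg measurable_law[OF L_xx_state_measurable]
      measurable_law[OF potential_measurable] in
      \<open>auto simp: case_prod_beta' space_law intro!: L_xx_nonneg potential_nonneg add_nonneg_nonneg mult_nonneg_nonneg divide_nonneg_nonneg\<close>)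
  also have "\<dots> \<le> ennreal (Q * (15 + 10 * \<Gamma>))"
  proof (rule ennreal_leI)
    have "(Q' * (1 - ?t) * ?a / ?r) * potential_bound k \<le> (Q' * (1 - ?t) * ?a / ?r) * (v * ?r)"
      using t a r Q'0 v by (intro mult_left_mono) auto
    also have "\<dots> = Q' * ((1 - ?t) * (?a * v))" using r by simp
    finally have "(Q' * ?t) * (?a * \<Gamma>) + (Q' * (1 - ?t) * ?a / ?r) * potential_bound k
        + (5 * Q + Q' * (L + (1 - ?t) * (?a * (B + 1 / 2))))
      \<le> 5 * Q + Q' * (L + (?t * (?a * \<Gamma>) + (1 - ?t) * (?a * (B + 1 / 2 + v))))"
      by (simp add: algebra_simps)
    also have "\<dots> \<le> 5 * Q + Q' * (L + (?t * (?a * \<Gamma>) + (1 - ?t) * (?a * \<Gamma>)))"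
      using t a Q'0 \<Gamma>(2) by (intro add_left_mono mult_left_mono) auto
    also have "\<dots> = 5 * Q + Q' * (L + ?a * \<Gamma>)" by (simp add: algebra_simps)
    also have "\<dots> \<le> 5 * Q + Q' * ((1 + \<Gamma>) * (L + ?a))"
      using Q'0 L_pos a \<Gamma>(3) by (intro add_left_mono mult_left_mono) (auto simp: algebra_simps)
    also have "\<dots> = Q * (15 + 10 * \<Gamma>)" using La by (simp add: Q'_def field_simps)
    finally show "(Q' * ?t) * (?a * \<Gamma>) + (Q' * (1 - ?t) * ?a / ?r) * potential_bound k
        + (5 * Q + Q' * (L + (1 - ?t) * (?a * (B + 1 / 2)))) \<le> Q * (15 + 10 * \<Gamma>)" .
  qed
  finally show ?thesis by (simp add: case_prod_beta' Q_def)
qed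

lemma expected_calls:
  assumes acc: "\<And>j. j < k \<Longrightarrow> accurate j" and radius: "0 < radius"
    and \<Lambda>: "\<And>j. j < k \<Longrightarrow> ln (32 * \<mu> * real n * radius * ((L + alpha_of P) / \<mu>) ^ 3 / gam \<epsilon> j) \<le> \<Lambda>"
      "1 \<le> \<Lambda>"
    and v: "\<And>j. j < k \<Longrightarrow> potential_bound j \<le> v * rho P j"
    and B: "\<And>i. i < n \<Longrightarrow> lam_opt i \<le> B" "0 \<le> B"
    and \<Gamma>: "\<And>i. i < n \<Longrightarrow> lam0 i \<le> \<Gamma>" "B + 1 / 2 + v \<le> \<Gamma>" "0 \<le> \<Gamma>"
  shows "(\<integral>\<^sup>+(x, lam, q). of_nat q \<partial>law k)
    \<le> ennreal (real k * (6 * max c 0 * work_bound * \<Lambda> * (15 + 10 * \<Gamma>)))"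
  using acc \<Lambda>(1) v
proof (induction k)
  case 0
  have "(\<lambda>(x, lam, q). of_nat q :: ennreal) \<in> borel_measurable states"
    using measurable_compose[OF state_projections(3), of "of_nat :: nat \<Rightarrow> ennreal" borel]
    by (simp add: case_prod_beta')
  from nn_integral_return[OF initial_state this] show ?case by simp
next
  case (Suc k)
  let ?Z = "6 * max c 0 * work_bound * \<Lambda> * (15 + 10 * \<Gamma>)"
  have W0: "0 \<le> work_bound" using L_pos alpha_of_nonneg mu_pos by (simp add: work_bound_def)
  then have Z: "0 \<le> ?Z" using \<Lambda>(2) \<Gamma>(3) by simp
  have "(\<integral>\<^sup>+(x, lam, q). of_nat q \<partial>law (Suc k))
    \<le> (\<integral>\<^sup>+(x, lam, q). of_nat q \<partial>law k)
      + (\<integral>\<^sup>+(x, lam, q). ennreal (2 * max c 0 * real (iters k (lam_hat k x lam))) \<partial>law k)"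
    using Suc.prems(1)[of k] by (intro calls_le) (simp add: accurate_def)
  also have "\<dots> \<le> ennreal (real k * ?Z) + ennreal ?Z"
    using Suc by (intro add_mono Suc.IH expected_calls_step[OF _ radius _ \<Lambda>(2) _ B \<Gamma>]) auto
  also have "\<dots> = ennreal (real (Suc k) * ?Z)"
    using Z by (simp add: ennreal_plus[symmetric] distrib_right del: ennreal_plus)
  finally show ?case .
qed

text \<open>
  The objective lies between \<open>cp_obj P x_opt\<close> minus a combination of the infeasibilities and \<open>cp_obj P x_opt\<close> plus
  the potential. Both ends are integrable, and so is the objective.
\<close>

lemma eps_solution_law:
  assumes acc: "\<And>j. j < k \<Longrightarrow> accurate j"
    and B: "\<And>i. i < n \<Longrightarrow> lam_opt i \<le> B" "0 \<le> B"
    and small: "potential_bound k + rho P k * (B + 1 / 2) \<le> \<epsilon>"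
  shows "eps_solution P x_opt \<epsilon> (law k)"
proof -
  interpret law: prob_space "law k" by (rule prob_space_law)
  let ?V = "\<lambda>s. potential (rho P k) (fst s) (fst (snd s))"
  have V_meas: "?V \<in> borel_measurable (law k)"
    using measurable_law[OF potential_measurable] by (simp add: case_prod_beta')
  have st: "fst s \<in> X" "fst (snd s) \<in> orthant n" if "s \<in> space (law k)" for s
    using that by (auto simp: space_law)
  have V_nonneg: "AE s in law k. 0 \<le> ?V s"
    using st by (intro AE_I2 potential_nonneg rho_pos)
  have EV: "(\<integral>\<^sup>+s. ennreal (?V s) \<partial>law k) \<le> ennreal (potential_bound k)"
    using expected_potential[OF acc] by (simp add: case_prod_beta')
  have V_int: "integrable (law k) ?V"
    using EV by (intro integrableI_nonneg V_meas V_nonneg) (auto intro: le_less_trans)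
  have "ennreal (\<integral>s. ?V s \<partial>law k) \<le> ennreal (potential_bound k)"
    using EV nn_integral_eq_integral[OF V_int V_nonneg] by simp
  then have V_le: "(\<integral>s. ?V s \<partial>law k) \<le> potential_bound k"
    using potential_bound_nonneg by simp
  have g_meas: "(\<lambda>s. max (g i (fst s)) 0) \<in> borel_measurable (law k)" if "i < n" for i
    using measurable_law[OF measurable_compose[OF state_projections(1) g_measurable[OF that]]]
    by (simp add: case_prod_beta')
  have g_le: "max (g i (fst s)) 0 \<le> rho P k * (B + 1 / 2) + ?V s" if "i < n" "s \<in> space (law k)" for i s
    using infeasibility_le_potential[OF rho_pos st[OF that(2)] that(1), of k]
      mult_left_mono[OF add_right_mono[OF B(1)[OF that(1)], of "1 / 2"], of "rho P k"] rho_pos[of k]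
    by linarith
  have g_int: "integrable (law k) (\<lambda>s. max (g i (fst s)) 0)" if "i < n" for i
  proof (rule Bochner_Integration.integrable_bound[of _ "\<lambda>s. rho P k * (B + 1 / 2) + ?V s"])
    show "AE s in law k. norm (max (g i (fst s)) 0) \<le> norm (rho P k * (B + 1 / 2) + ?V s)"
      using g_le[OF that] by (intro AE_I2) force
  qed (use V_int g_meas[OF that] in auto)
  have g_exp: "(\<integral>s. max (g i (fst s)) 0 \<partial>law k) \<le> \<epsilon>" if "i < n" for i
  proof -
    have "(\<integral>s. max (g i (fst s)) 0 \<partial>law k) \<le> (\<integral>s. rho P k * (B + 1 / 2) + ?V s \<partial>law k)"
      using V_int g_int[OF that] g_le[OF that] by (intro integral_mono) auto
    also have "\<dots> = rho P k * (B + 1 / 2) + (\<integral>s. ?V s \<partial>law k)"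
      using V_int by (simp add: law.prob_space)
    finally show ?thesis using V_le small by linarith
  qed
  have obj_meas: "(\<lambda>s. cp_obj P (fst s)) \<in> borel_measurable (law k)"
    using measurable_law[OF measurable_compose[OF state_projections(1) obj_measurable]]
    by (simp add: case_prod_beta')
  have obj_le: "cp_obj P (fst s) \<le> cp_obj P x_opt + ?V s" if "s \<in> space (law k)" for s
    using obj_le_potential[OF rho_pos st(2)[OF that], of "fst s" k] by simp
  let ?low = "\<lambda>s. \<Sum>i<n. lam_opt i * max (g i (fst s)) 0"
  have low_int: "integrable (law k) ?low"
    using g_int by (intro Bochner_Integration.integrable_sum integrable_mult_right) auto
  have obj_int: "integrable (law k) (\<lambda>s. cp_obj P (fst s))"
  proof (rule Bochner_Integration.integrable_bound[of _ "\<lambda>s. \<bar>cp_obj P x_opt\<bar> + (?V s + ?low s)"])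
    show "AE s in law k. norm (cp_obj P (fst s)) \<le> norm (\<bar>cp_obj P x_opt\<bar> + (?V s + ?low s))"
    proof (rule AE_I2)
      fix s assume s: "s \<in> space (law k)"
      have "0 \<le> ?low s"
        using lam_opt_orthant by (intro sum_nonneg mult_nonneg_nonneg) (auto simp: orthant_def)
      moreover have "0 \<le> ?V s" by (intro potential_nonneg rho_pos st s)
      moreover have "cp_obj P x_opt \<le> cp_obj P (fst s) + ?low s" by (intro obj_opt_le st s)
      ultimately show "norm (cp_obj P (fst s)) \<le> norm (\<bar>cp_obj P x_opt\<bar> + (?V s + ?low s))"
        using obj_le[OF s] by simp
    qed
  qed (use V_int low_int obj_meas in auto)
  have "(\<integral>s. cp_obj P (fst s) \<partial>law k) \<le> (\<integral>s. cp_obj P x_opt + ?V s \<partial>law k)"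
    using obj_int V_int obj_le by (intro integral_mono) auto
  also have "\<dots> = cp_obj P x_opt + (\<integral>s. ?V s \<partial>law k)"
    using V_int by (simp add: law.prob_space)
  finally have "(\<integral>s. cp_obj P (fst s) \<partial>law k) - cp_obj P x_opt \<le> \<epsilon>"
    using V_le small mult_nonneg_nonneg[OF less_imp_le[OF rho_pos[of k]], of "B + 1 / 2"] B(2) by linarith
  then show ?thesis
    using obj_int g_int g_exp by (simp add: eps_solution_def case_prod_beta')
qed

end


section \<open>The complexity bound\<close>

text \<open>
  A distance generating function is strongly convex, hence lies above its tangent at \<open>u0\<close> by at least
  \<open>1/2 N(y - u0)\<^sup>2\<close>. Thus the logarithm in the guarantee of the solver tends to infinity as the accuracy
  tends to 0, unless the set is a single point.
\<close>

lemma dgf_on_bregman_pos: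
  assumes "finite_dim_subspace E" "norm_on E N" and dgf: "dgf_on E N U h \<omega>"
    and U: "compact U" "U \<subseteq> E" and u0: "u0 \<in> U \<inter> int_dom E \<omega>" and y: "y \<in> U" "y \<noteq> u0"
  shows "0 < bregman_radius E U \<omega> u0"
proof -
  interpret normed_subspace E N by unfold_locales fact+
  let ?w = "fin \<omega>" and ?D = "grad E (fin \<omega>) u0"
  have E: "u0 \<in> E" "y \<in> E" using u0 y U by auto
  have grad: "has_gradient E ?w u0 ?D"
    using dgf u0 E grad_eq by (fastforce simp: dgf_on_def essentially_smooth_def)
  have "strongly_convex_on N U ?w 1" using dgf by (simp add: dgf_on_def)
  from strongly_convex_first_order[OF this grad _ y(1) U(2)] u0
  have "1 / 2 * (N (u0 - y))\<^sup>2 \<le> ?w y - ?w u0 - ?D \<bullet> (y - u0)" by simp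
  moreover have "0 < N (u0 - y)" using E y by (intro N_pos subspace_diff[OF subspace]) auto
  ultimately have pos: "0 < ?w y - ?w u0 - ?D \<bullet> (y - u0)"
    using zero_less_power[of "N (u0 - y)" 2] by linarith
  have "continuous_on U ?w" using dgf by (simp add: dgf_on_def)
  then have "continuous_on U (\<lambda>u. ?w u - ?w u0 - ?D \<bullet> (u - u0))" by (intro continuous_intros)
  then have "bdd_above ((\<lambda>u. ?w u - ?w u0 - ?D \<bullet> (u - u0)) ` U)"
    by (intro bounded_imp_bdd_above compact_imp_bounded compact_continuous_image U)
  from cSUP_upper[OF y(1) this] pos show ?thesis by (simp add: bregman_radius_def)
qed

text \<open>Summing over the support makes this a function of the sequence alone, independent of the number of
  constraints.\<close>

definition total :: "(nat \<Rightarrow> real) \<Rightarrow> real" where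
  "total lam = (\<Sum>i | lam i \<noteq> 0. lam i)"

lemma total_eq:
  assumes "lam \<in> orthant n"
  shows "total lam = (\<Sum>i<n. lam i)"
  unfolding total_def using assms by (intro sum.mono_neutral_left) (auto simp: orthant_def simp flip: not_le)

lemma total_bounds:
  assumes "lam \<in> orthant n"
  shows total_nonneg: "0 \<le> total lam" and le_total: "i < n \<Longrightarrow> lam i \<le> total lam"
    and sum_squares_le_total: "(\<Sum>i<n. (lam i)\<^sup>2) \<le> (total lam)\<^sup>2"
proof -
  have nn: "0 \<le> lam i" if "i \<in> {..<n}" for i using assms that by (auto simp: orthant_def)
  show "0 \<le> total lam" unfolding total_eq[OF assms] by (intro sum_nonneg nn)
  have le: "lam i \<le> total lam" if "i < n" for i
    unfolding total_eq[OF assms] using that nn by (intro member_le_sum) auto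
  then show "i < n \<Longrightarrow> lam i \<le> total lam" .
  have "(\<Sum>i<n. (lam i)\<^sup>2) \<le> (\<Sum>i<n. total lam * lam i)"
    unfolding power2_eq_square using le nn by (intro sum_mono mult_right_mono) auto
  then show "(\<Sum>i<n. (lam i)\<^sup>2) \<le> (total lam)\<^sup>2"
    by (simp add: power2_eq_square sum_distrib_left[symmetric] total_eq[OF assms, symmetric])
qed

text \<open>
  The constants of the bound in terms of \<open>lam0\<close>, \<open>lam_opt\<close> and the normalised initial gap \<open>\<delta>\<close>:
  \<open>gap_const\<close> bounds, in units of \<open>L_D\<close>, the sum of \<open>V\<^sub>0\<close> and of \<open>\<rho>\<^sub>0 (B + 1/2)\<close>, the affine part of the
  infeasibility with \<open>B\<close> the total of \<open>lam_opt\<close>; \<open>length_const\<close> multiplies \<open>M/\<surd>(\<mu>\<epsilon>)\<close> in the number of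
  iterations; \<open>ratio_const\<close> bounds the expected potential divided by \<open>\<rho>\<^sub>k\<close>; \<open>dual_const\<close> times \<open>\<alpha>\<close> bounds the
  expectation of \<open>L_xx\<close>.
\<close>

definition gap_const :: "(nat \<Rightarrow> real) \<Rightarrow> real \<Rightarrow> real" where
  "gap_const lam_opt \<delta> = 8 * total lam_opt + 4 + \<delta> + 4 * (total lam_opt)\<^sup>2"

definition length_const :: "(nat \<Rightarrow> real) \<Rightarrow> real \<Rightarrow> real" where
  "length_const lam_opt \<delta> = 2 * sqrt (gap_const lam_opt \<delta>) + 1"

definition ratio_const :: "(nat \<Rightarrow> real) \<Rightarrow> real \<Rightarrow> real" where
  "ratio_const lam_opt \<delta> = (\<delta> + 4 * (total lam_opt)\<^sup>2) / 8 + (length_const lam_opt \<delta>)\<^sup>2 / 16"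

definition dual_const :: "(nat \<Rightarrow> real) \<Rightarrow> (nat \<Rightarrow> real) \<Rightarrow> real \<Rightarrow> real" where
  "dual_const lam0 lam_opt \<delta> = total lam0 + (total lam_opt + 1 / 2 + ratio_const lam_opt \<delta>)"

definition complexity_const :: "real \<Rightarrow> (nat \<Rightarrow> real) \<Rightarrow> (nat \<Rightarrow> real) \<Rightarrow> real \<Rightarrow> real" where
  "complexity_const c lam0 lam_opt \<delta> =
     54 * max c 0 * length_const lam_opt \<delta> * (15 + 10 * dual_const lam0 lam_opt \<delta>)"

context ipds_run
begin

text \<open>
  The conditions on \<open>\<epsilon>\<close> serve, in this order, to compare powers of \<open>\<epsilon>\<close>, to absorb the rounding of the
  number of iterations, to make the logarithm of the claim at least 1, to bound the logarithms of all runs by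
  three times that one, and to make the guarantee of the solver applicable. A factor above 1 is
  unavoidable there because \<open>1/\<gamma>\<^sub>k\<close>, which enters the logarithm of a run, reaches the order \<open>\<epsilon>\<^sup>-\<^sup>3\<^sup>/\<^sup>2\<close>.
\<close>

lemma complexity_le:
  defines "\<delta> \<equiv> max (smoothed_gap P (rho P 0) x0 lam0) 0 / L_D P"
    and "Y \<equiv> real n * M_of P * (L + alpha_of P) / \<mu>"
  defines "Z \<equiv> 384 * \<mu> * real n * radius * ((L + alpha_of P) / \<mu>) ^ 3
      * length_const lam_opt \<delta> * (M_of P / sqrt \<mu>)"
  assumes radius: "0 < radius"
    and small: "\<epsilon> \<le> 1" "\<epsilon> \<le> L_D P" "exp 1 * \<epsilon> \<le> Y" "Z * \<epsilon> \<le> Y ^ 3"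
      "exp 1 * \<epsilon> \<le> 2 * \<mu> * radius"
  shows "stoc_complexity P rpd u0 x0 lam0 x_opt \<epsilon>
    \<le> ennreal (complexity_const c lam0 lam_opt \<delta>
        * (sqrt (real n) * M_of P / sqrt (\<mu> * \<epsilon>) * (sqrt (real n) + sqrt ((L + alpha_of P) / \<mu>))
           * ln (real n * M_of P * (L + alpha_of P) / (\<mu> * \<epsilon>))))"
proof -
  define T where "T = total lam_opt"
  define R where "R = gap_const lam_opt \<delta>"
  define \<kappa> where "\<kappa> = length_const lam_opt \<delta>"
  define v where "v = ratio_const lam_opt \<delta>"
  define \<Gamma> where "\<Gamma> = dual_const lam0 lam_opt \<delta>"
  define s where "s = M_of P / sqrt (\<mu> * \<epsilon>)"
  define b where "b = (L + alpha_of P) / \<mu>"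
  define K where "K = nat \<lceil>2 * sqrt R * s\<rceil>"
  define \<Lambda> where "\<Lambda> = 3 * ln (Y / \<epsilon>)"
  have n1: "1 \<le> real n" using n_pos by simp
  have T0: "0 \<le> T" unfolding T_def by (rule total_nonneg[OF lam_opt_orthant])
  have A0: "0 \<le> total lam0" by (rule total_nonneg[OF lam0])
  have \<delta>0: "0 \<le> \<delta>" using L_D_pos by (simp add: \<delta>_def)
  have R4: "4 \<le> R" using T0 \<delta>0 by (simp add: R_def gap_const_def T_def)
  have \<kappa>: "\<kappa> = 2 * sqrt R + 1" by (simp add: \<kappa>_def R_def length_const_def)
  have \<kappa>1: "1 \<le> \<kappa>" using R4 by (simp add: \<kappa>)
  have v0: "0 \<le> v" using \<delta>0 by (simp add: v_def ratio_const_def)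
  have \<Gamma>: "T + 1 / 2 + v \<le> \<Gamma>" "0 \<le> \<Gamma>" "\<And>i. i < n \<Longrightarrow> lam0 i \<le> \<Gamma>"
    using A0 T0 v0 le_total[OF lam0] by (auto simp: \<Gamma>_def dual_const_def T_def v_def add_increasing2)
  have B: "lam_opt i \<le> T" if "i < n" for i
    unfolding T_def by (rule le_total[OF lam_opt_orthant that])
  have b1: "1 \<le> b" using mu_pos mu_le_L alpha_of_nonneg by (simp add: b_def)
  have s2: "s\<^sup>2 = L_D P / \<epsilon>"
    using mu_pos eps by (simp add: s_def L_D_def power_divide)
  have s0: "0 < s" using M_pos mu_pos eps by (simp add: s_def)
  have s1: "1 \<le> s"
  proof -
    have "1\<^sup>2 \<le> s\<^sup>2" unfolding s2 using small(2) eps by simp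
    then show ?thesis using s0 by (intro power2_le_imp_le[of 1 s]) auto
  qed
  \<comment> \<open>\<open>K\<close> is the least integer with \<open>K\<^sup>2 \<ge> 4 R L_D / \<epsilon>\<close>, so that \<open>2 R L_D / K\<^sup>2\<close>, which bounds the terms in
    \<open>V\<^sub>0\<close> and \<open>\<rho>\<^sub>K\<close>, is at most \<open>\<epsilon>/2\<close>\<close>
  have Ks: "2 * sqrt R * s \<le> real K" "real K \<le> \<kappa> * s"
  proof -
    have nn: "0 \<le> 2 * sqrt R * s" using R4 s0 by simp
    show "2 * sqrt R * s \<le> real K" unfolding K_def by (rule real_nat_ceiling_ge)
    have "real K \<le> 2 * sqrt R * s + 1" unfolding K_def using nn by (simp add: of_nat_nat)
    also have "\<dots> \<le> \<kappa> * s" using s1 by (simp add: \<kappa> distrib_right)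
    finally show "real K \<le> \<kappa> * s" .
  qed
  have K_lower: "4 * R * L_D P / \<epsilon> \<le> (real K)\<^sup>2"
  proof -
    have "(2 * sqrt R * s)\<^sup>2 \<le> (real K)\<^sup>2" using Ks(1) R4 s0 by (intro power_mono) auto
    moreover have "(2 * sqrt R * s)\<^sup>2 = 4 * R * L_D P / \<epsilon>" using R4 s2 by (simp add: power_mult_distrib)
    ultimately show ?thesis by simp
  qed
  have K_upper: "(real K)\<^sup>2 \<le> \<kappa>\<^sup>2 * (L_D P / \<epsilon>)"
    using power_mono[OF Ks(2), of 2] by (simp add: power_mult_distrib s2)
  have K1: "1 \<le> real K"
  proof -
    have "0 < 2 * sqrt R * s" using R4 s0 by simp
    with Ks(1) have "0 < real K" by linarith
    then show ?thesis by simp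
  qed
  define V0 where "V0 = potential (rho P 0) x0 lam0"
  have V0_nonneg: "0 \<le> V0" unfolding V0_def by (rule potential0_nonneg)
  have V0: "V0 \<le> L_D P * (\<delta> + 4 * T\<^sup>2)"
  proof -
    have "smoothed_primal (rho P 0) x0 - \<psi> lam0 \<le> max (smoothed_gap P (rho P 0) x0 lam0) 0"
      by (rule order_trans[OF smoothed_primal_le_gap[OF rho_pos] max.cobounded1])
    also have "\<dots> = L_D P * \<delta>" using L_D_pos by (simp add: \<delta>_def)
    finally have 1: "smoothed_primal (rho P 0) x0 - \<psi> lam0 \<le> L_D P * \<delta>" .
    have 2: "rho P 0 / 2 * (\<Sum>i<n. (lam_opt i)\<^sup>2) \<le> 4 * L_D P * T\<^sup>2"
      using mult_left_mono[OF sum_squares_le_total[OF lam_opt_orthant], of "4 * L_D P"] L_D_pos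
      by (simp add: T_def)
    show ?thesis using 1 2 unfolding V0_def potential_def by (simp add: distrib_left)
  qed
  have bound: "potential_bound k \<le> 2 * V0 / ((real k + 1) * (real k + 2)) + \<epsilon> / 4" for k
  proof -
    have "real k * (real k + 3) \<le> (real k + 1) * (real k + 2)" by (simp add: algebra_simps)
    then have "\<epsilon> * (real k * (real k + 3)) \<le> \<epsilon> * ((real k + 1) * (real k + 2))"
      using eps by (intro mult_left_mono) auto
    then have "\<epsilon> * (real k * (real k + 3)) / (4 * ((real k + 1) * (real k + 2))) \<le> \<epsilon> / 4"
      by (simp add: divide_simps)
    then show ?thesis by (simp add: potential_bound_def V0_def)
  qed
  have final: "potential_bound K + rho P K * (T + 1 / 2) \<le> \<epsilon>"
  proof -
    let ?q = "(real K + 1) * (real K + 2)"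
    have q0: "0 < ?q" by simp
    have q: "4 * R * L_D P / \<epsilon> \<le> ?q"
      using K_lower by (rule order_trans) (simp add: power2_eq_square algebra_simps)
    have "2 * V0 / ?q + rho P K * (T + 1 / 2) = (2 * V0 + 16 * L_D P * (T + 1 / 2)) / ?q"
      by (simp add: rho_eq add_divide_distrib)
    also have "\<dots> \<le> 2 * (R * L_D P) / ?q"
      using V0 q0 by (intro divide_right_mono) (auto simp: R_def gap_const_def T_def algebra_simps)
    also have "\<dots> \<le> \<epsilon> / 2"
      using q eps q0 by (simp add: divide_simps) (simp add: mult.commute mult.left_commute)
    finally show ?thesis using bound[of K] eps by linarith
  qed
  have ratio: "potential_bound j \<le> v * rho P j" if j: "j \<le> K" for j
  proof -
    let ?q = "(real j + 1) * (real j + 2)"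
    have q0: "0 < ?q" by simp
    have "\<epsilon> * (real j * (real j + 3)) \<le> \<epsilon> * (real K * (4 * real K))"
      using j K1 eps by (intro mult_left_mono mult_mono) auto
    also have "\<dots> = 4 * \<epsilon> * (real K)\<^sup>2" by (simp add: power2_eq_square)
    also have "\<dots> \<le> 4 * \<epsilon> * (\<kappa>\<^sup>2 * (L_D P / \<epsilon>))" using K_upper eps by (intro mult_left_mono) auto
    also have "\<dots> = 4 * \<kappa>\<^sup>2 * L_D P" using eps by simp
    finally have e: "\<epsilon> * (real j * (real j + 3)) \<le> 4 * \<kappa>\<^sup>2 * L_D P" .
    have "potential_bound j = (2 * V0 + \<epsilon> * (real j * (real j + 3)) / 4) / ?q"
      by (simp add: potential_bound_def V0_def add_divide_distrib)
    also have "\<dots> \<le> (2 * (L_D P * (\<delta> + 4 * T\<^sup>2)) + \<kappa>\<^sup>2 * L_D P) / ?q"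
      using e V0 q0 by (intro divide_right_mono) auto
    also have "2 * (L_D P * (\<delta> + 4 * T\<^sup>2)) + \<kappa>\<^sup>2 * L_D P = v * (16 * L_D P)"
      by (simp add: v_def ratio_const_def \<kappa>_def T_def algebra_simps)
    also have "v * (16 * L_D P) / ?q = v * rho P j" by (simp add: rho_eq)
    finally show ?thesis .
  qed
  have gam0: "0 < gam \<epsilon> j" for j using eps by (simp add: gam_def)
  have acc: "accurate j" for j
    unfolding accurate_def
  proof
    fix lam assume lam: "lam \<in> orthant n"
    let ?L = "L + L_xx P lam" and ?w = "rpd_work (subproblem P lam)"
    have L': "0 \<le> ?L" using L_pos L_xx_nonneg[OF lam] by simp
    have w1: "1 \<le> ?w"
      using n1 mu_pos L' by (simp add: rpd_work_def subproblem_def add_increasing2)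
    have "\<mu> = (sqrt \<mu>)\<^sup>2" using mu_pos by simp
    also have "\<dots> \<le> (?L / sqrt \<mu> + sqrt \<mu>)\<^sup>2" using L' mu_pos by (intro power_mono) auto
    finally have mu_le: "\<mu> \<le> (?L / sqrt \<mu> + sqrt \<mu>)\<^sup>2" .
    have "exp 1 \<le> 2 * \<mu> * radius / \<epsilon>" using small(5) eps by (simp add: pos_le_divide_eq)
    also have "\<dots> \<le> 2 * \<mu> * radius / gam \<epsilon> j"
      using mu_pos radius eps gam0 by (intro divide_left_mono) (auto simp: gam_def divide_le_eq)
    also have "\<dots> \<le> 2 * (?L / sqrt \<mu> + sqrt \<mu>)\<^sup>2 * ?w * radius / gam \<epsilon> j"
    proof (intro divide_right_mono mult_right_mono)
      have "2 * \<mu> * 1 \<le> 2 * (?L / sqrt \<mu> + sqrt \<mu>)\<^sup>2 * ?w"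
        using mu_le w1 mu_pos by (intro mult_mono) auto
      then show "2 * \<mu> \<le> 2 * (?L / sqrt \<mu> + sqrt \<mu>)\<^sup>2 * ?w" by simp
    qed (use radius gam0[of j] in auto)
    also have "\<dots> = rpd_log_arg (subproblem P lam) u0 (gam \<epsilon> j)"
      by (simp add: rpd_log_arg_def radius_def) (simp add: subproblem_def)
    finally have "exp 1 \<le> rpd_log_arg (subproblem P lam) u0 (gam \<epsilon> j)" .
    moreover from this have "0 < rpd_log_arg (subproblem P lam) u0 (gam \<epsilon> j)"
      by (rule less_le_trans[OF exp_gt_zero])
    ultimately show "1 \<le> ln (rpd_log_arg (subproblem P lam) u0 (gam \<epsilon> j))"
      by (simp add: ln_ge_iff)
  qed
  have Y0: "0 < Y" using small(3) eps exp_gt_zero[of "1::real"] by (meson less_le_trans mult_pos_pos)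
  have ln1: "1 \<le> ln (Y / \<epsilon>)"
    using small(3) eps Y0 by (simp add: ln_ge_iff pos_le_divide_eq)
  have log: "ln (32 * \<mu> * real n * radius * ((L + alpha_of P) / \<mu>) ^ 3 / gam \<epsilon> j) \<le> \<Lambda>"
    if j: "j < K" for j
  proof -
    let ?c = "32 * \<mu> * real n * radius * ((L + alpha_of P) / \<mu>) ^ 3"
    have c0: "0 < ?c"
      using mu_pos n_pos radius b1 by (auto simp flip: b_def intro!: mult_pos_pos zero_less_power)
    have "s \<le> M_of P / sqrt \<mu> / \<epsilon>"
    proof -
      have "\<epsilon> * \<epsilon> \<le> 1 * \<epsilon>" using small(1) eps by (intro mult_right_mono) auto
      then have "\<epsilon> \<le> sqrt \<epsilon>" using eps by (intro real_le_rsqrt) (simp add: power2_eq_square)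
      then have "M_of P / sqrt \<mu> / sqrt \<epsilon> \<le> M_of P / sqrt \<mu> / \<epsilon>"
        using eps M_pos mu_pos by (intro divide_left_mono) auto
      then show ?thesis by (simp add: s_def real_sqrt_mult)
    qed
    then have "\<kappa> * s \<le> \<kappa> * (M_of P / sqrt \<mu> / \<epsilon>)" using \<kappa>1 by (intro mult_left_mono) auto
    with Ks(2) have "real K \<le> \<kappa> * (M_of P / sqrt \<mu> / \<epsilon>)" by (rule order_trans)
    then have "12 * real K \<le> 12 * (\<kappa> * (M_of P / sqrt \<mu> / \<epsilon>))" by (rule mult_left_mono) simp
    moreover have "4 * (real j + 3) \<le> 12 * real K" using j by simp
    ultimately have "4 * (real j + 3) \<le> 12 * (\<kappa> * (M_of P / sqrt \<mu> / \<epsilon>))" by (rule order_trans[rotated])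
    then have "?c * (4 * (real j + 3)) / \<epsilon> \<le> ?c * (12 * (\<kappa> * (M_of P / sqrt \<mu> / \<epsilon>))) / \<epsilon>"
      using c0 eps by (intro divide_right_mono mult_left_mono) auto
    moreover have "?c / gam \<epsilon> j = ?c * (4 * (real j + 3)) / \<epsilon>" by (simp add: gam_def)
    moreover have "?c * (12 * (\<kappa> * (M_of P / sqrt \<mu> / \<epsilon>))) / \<epsilon> = Z / \<epsilon>\<^sup>2"
      by (simp add: Z_def \<kappa>_def power2_eq_square)
    moreover have "Z / \<epsilon>\<^sup>2 \<le> (Y / \<epsilon>) ^ 3"
    proof -
      have "Z / \<epsilon>\<^sup>2 = Z * \<epsilon> / \<epsilon> ^ 3" using eps by (simp add: power2_eq_square power3_eq_cube)
      also have "\<dots> \<le> Y ^ 3 / \<epsilon> ^ 3" using small(4) eps by (intro divide_right_mono) auto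
      finally show ?thesis by (simp add: power_divide)
    qed
    ultimately have "?c / gam \<epsilon> j \<le> (Y / \<epsilon>) ^ 3" by linarith
    moreover have "0 < ?c / gam \<epsilon> j" using c0 gam0 by (rule divide_pos_pos)
    ultimately have "ln (?c / gam \<epsilon> j) \<le> ln ((Y / \<epsilon>) ^ 3)" by (intro ln_mono)
    also have "\<dots> = \<Lambda>" using Y0 eps by (simp add: \<Lambda>_def ln_realpow)
    finally show ?thesis .
  qed
  have \<Lambda>1: "1 \<le> \<Lambda>" using ln1 by (simp add: \<Lambda>_def)
  have work: "work_bound \<le> 3 * sqrt (real n) * (sqrt (real n) + sqrt b)"
  proof -
    have "sqrt 8 \<le> (3::real)" by (rule real_le_lsqrt) auto
    then have "sqrt 8 * (sqrt (real n) * sqrt b) \<le> 3 * (sqrt (real n) * sqrt b)"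
      using b1 by (intro mult_right_mono) auto
    moreover have "work_bound = real n + sqrt 8 * (sqrt (real n) * sqrt b)"
      by (simp add: work_bound_def b_def[symmetric] real_sqrt_mult)
    moreover have "3 * sqrt (real n) * (sqrt (real n) + sqrt b) = 3 * real n + 3 * (sqrt (real n) * sqrt b)"
      by (simp add: distrib_left mult.assoc)
    ultimately show ?thesis using n1 by linarith
  qed
  have W0: "0 \<le> work_bound" using L_pos alpha_of_nonneg mu_pos by (simp add: work_bound_def)
  have "eps_solution P x_opt \<epsilon> (law K)"
    by (rule eps_solution_law[OF acc B T0 final])
  then have "stoc_complexity P rpd u0 x0 lam0 x_opt \<epsilon> \<le> (\<integral>\<^sup>+ (x, lam, q). of_nat q \<partial>law K)"
    unfolding stoc_complexity_def by (intro INF_lower) simp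
  also have "\<dots> \<le> ennreal (real K * (6 * max c 0 * work_bound * \<Lambda> * (15 + 10 * \<Gamma>)))"
    by (rule expected_calls[OF acc radius log \<Lambda>1 ratio B T0 \<Gamma>(3,1,2)]) auto
  also have "\<dots> \<le> ennreal ((\<kappa> * s) * (6 * max c 0 * (3 * sqrt (real n) * (sqrt (real n) + sqrt b)) * \<Lambda>
      * (15 + 10 * \<Gamma>)))"
    using Ks(2) work W0 \<Lambda>1 \<Gamma>(2) \<kappa>1 s0 b1 by (intro ennreal_leI mult_mono mult_nonneg_nonneg) auto
  also have "(\<kappa> * s) * (6 * max c 0 * (3 * sqrt (real n) * (sqrt (real n) + sqrt b)) * \<Lambda> * (15 + 10 * \<Gamma>))
    = complexity_const c lam0 lam_opt \<delta>
        * (sqrt (real n) * s * (sqrt (real n) + sqrt b) * ln (Y / \<epsilon>))"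
    by (simp add: complexity_const_def \<kappa>_def \<Gamma>_def \<Lambda>_def)
  finally show ?thesis
    by (simp add: s_def b_def Y_def)
qed

text \<open>
  If \<open>X\<close> is a single point, the Bregman radius vanishes and the guarantee of the solver is void, but
  then the starting point is already optimal.
\<close>

lemma complexity_singleton:
  assumes "X \<subseteq> {u0}"
  shows "stoc_complexity P rpd u0 x0 lam0 x_opt \<epsilon> = 0"
proof -
  have x: "x0 = x_opt" using assms x0 x_opt_in by auto
  have obj: "(\<lambda>(x, lam, q). cp_obj P x) \<in> borel_measurable states"
    using measurable_compose[OF state_projections(1) obj_measurable] by (simp add: case_prod_beta')
  have g: "(\<lambda>(x, lam, q). max (g i x) 0) \<in> borel_measurable states" if "i < n" for i
    using measurable_compose[OF state_projections(1) g_measurable[OF that]] by (simp add: case_prod_beta')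
  have int: "integrable (law 0) h \<and> (\<integral>s. h s \<partial>law 0) = h (x0, lam0, 0)"
    if h: "h \<in> borel_measurable states" for h :: "_ \<Rightarrow> real"
  proof
    have "(\<integral>\<^sup>+s. ennreal (norm (h s)) \<partial>law 0) = ennreal (norm (h (x0, lam0, 0)))"
      using h by (simp add: nn_integral_return[OF initial_state])
    then show "integrable (law 0) h"
      using h by (intro integrableI_bounded) (auto simp: measurable_law)
    show "(\<integral>s. h s \<partial>law 0) = h (x0, lam0, 0)"
      using integral_return[OF initial_state h] by simp
  qed
  have "max (g i x_opt) 0 = 0" if "i < n" for i
    using optimal that by (auto simp: optimal_solution_def)
  then have "eps_solution P x_opt \<epsilon> (law 0)"
    using int[OF obj] int[OF g] eps by (simp add: eps_solution_def x)
  then have "stoc_complexity P rpd u0 x0 lam0 x_opt \<epsilon> \<le> (\<integral>\<^sup>+ (x, lam, q). of_nat q \<partial>law 0)"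
    unfolding stoc_complexity_def by (intro INF_lower) simp
  also have "\<dots> = 0"
  proof -
    have "(\<lambda>(x, lam, q). of_nat q :: ennreal) \<in> borel_measurable states"
      using measurable_compose[OF state_projections(3), of "of_nat :: nat \<Rightarrow> ennreal" borel]
      by (simp add: case_prod_beta')
    from nn_integral_return[OF initial_state this] show ?thesis by simp
  qed
  finally show ?thesis by simp
qed

end

theorem theorem5p7:
  fixes c :: real
  shows "\<exists>C :: (nat \<Rightarrow> real) \<Rightarrow> (nat \<Rightarrow> real) \<Rightarrow> real \<Rightarrow> real.
    \<forall>(rpd :: 'a::{real_inner, second_countable_topology} solver) P u0 x_opt lam_opt x0 lam0.
      rpd_guarantee c rpd \<and> valid_problem P \<and>
      u0 \<in> cp_interior P \<and> solver_measurable P rpd u0 \<and>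
      optimal_solution P x_opt \<and> saddle_point P x_opt lam_opt \<and>
      x0 \<in> cp_set P \<and> lam0 \<in> orthant (cp_n P) \<longrightarrow>
      (\<exists>\<epsilon>0>0. \<forall>\<epsilon>. 0 < \<epsilon> \<and> \<epsilon> < \<epsilon>0 \<longrightarrow>
         stoc_complexity P rpd u0 x0 lam0 x_opt \<epsilon>
           \<le> ennreal (C lam0 lam_opt (max (smoothed_gap P (rho P 0) x0 lam0) 0 / L_D P)
               * (sqrt (real (cp_n P)) * M_of P / sqrt (cp_mu P * \<epsilon>)
                  * (sqrt (real (cp_n P)) + sqrt ((cp_L P + alpha_of P) / cp_mu P))
                  * ln (real (cp_n P) * M_of P * (cp_L P + alpha_of P) / (cp_mu P * \<epsilon>)))))"
proof (intro exI[of _ "complexity_const c"] allI impI)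
  fix rpd :: "'a solver" and P u0 x_opt lam_opt x0 lam0
  assume asm: "rpd_guarantee c rpd \<and> valid_problem P \<and>
      u0 \<in> cp_interior P \<and> solver_measurable P rpd u0 \<and>
      optimal_solution P x_opt \<and> saddle_point P x_opt lam_opt \<and>
      x0 \<in> cp_set P \<and> lam0 \<in> orthant (cp_n P)"
  interpret saddle_problem P x_opt lam_opt using asm by unfold_locales auto
  have run: "ipds_run P x_opt lam_opt c rpd u0 x0 lam0 \<epsilon>" if "0 < \<epsilon>" for \<epsilon>
    using asm that by unfold_locales auto
  define \<delta> where "\<delta> = max (smoothed_gap P (rho P 0) x0 lam0) 0 / L_D P"
  let ?goal = "\<lambda>\<epsilon>. stoc_complexity P rpd u0 x0 lam0 x_opt \<epsilon>
    \<le> ennreal (complexity_const c lam0 lam_opt \<delta>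
        * (sqrt (real n) * M_of P / sqrt (\<mu> * \<epsilon>) * (sqrt (real n) + sqrt ((L + alpha_of P) / \<mu>))
           * ln (real n * M_of P * (L + alpha_of P) / (\<mu> * \<epsilon>))))"
  have "\<exists>\<epsilon>0>0. \<forall>\<epsilon>. 0 < \<epsilon> \<and> \<epsilon> < \<epsilon>0 \<longrightarrow> ?goal \<epsilon>"
  proof (cases "X \<subseteq> {u0}")
    case True
    then show ?thesis
      using ipds_run.complexity_singleton[OF run] by (intro exI[of _ 1]) auto
  next
    case False
    then obtain y where y: "y \<in> X" "y \<noteq> u0" by blast
    define rad where "rad = bregman_radius E X (cp_dgf P) u0"
    have rad: "0 < rad"
      unfolding rad_def using asm y
      by (intro dgf_on_bregman_pos[OF finite_dim norm_on dgf X_compact X_sub _ y]) (simp add: cp_interior_def)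
    define Y where "Y = real n * M_of P * (L + alpha_of P) / \<mu>"
    define Z where "Z = 384 * \<mu> * real n * rad * ((L + alpha_of P) / \<mu>) ^ 3
      * length_const lam_opt \<delta> * (M_of P / sqrt \<mu>)"
    have La: "0 < L + alpha_of P" using L_pos alpha_of_nonneg by simp
    have Y: "0 < Y" using n_pos M_pos La mu_pos by (simp add: Y_def)
    have "0 \<le> \<delta>" using L_D_pos by (simp add: \<delta>_def)
    then have "0 < length_const lam_opt \<delta>"
      using total_nonneg[OF lam_opt_orthant] by (simp add: length_const_def gap_const_def add_nonneg_pos)
    then have Z: "0 < Z" using n_pos M_pos La mu_pos rad by (simp add: Z_def)
    define \<epsilon>0 where "\<epsilon>0 = Min {1, L_D P, Y / exp 1, Y ^ 3 / Z, 2 * \<mu> * rad / exp 1}"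
    have "0 < \<epsilon>0" using L_D_pos Y Z rad mu_pos by (simp add: \<epsilon>0_def)
    moreover have "?goal \<epsilon>" if e: "0 < \<epsilon>" "\<epsilon> < \<epsilon>0" for \<epsilon>
    proof -
      have "\<epsilon> \<le> 1" "\<epsilon> \<le> L_D P" "\<epsilon> \<le> Y / exp 1" "\<epsilon> \<le> Y ^ 3 / Z" "\<epsilon> \<le> 2 * \<mu> * rad / exp 1"
        using e by (auto simp: \<epsilon>0_def)
      then have "\<epsilon> \<le> 1" "\<epsilon> \<le> L_D P" "exp 1 * \<epsilon> \<le> Y" "Z * \<epsilon> \<le> Y ^ 3" "exp 1 * \<epsilon> \<le> 2 * \<mu> * rad"
        using Z by (simp_all add: pos_le_divide_eq mult.commute)
      then show ?thesis
        using ipds_run.complexity_le[OF run[OF e(1)]] rad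
        by (simp add: ipds_run.radius_def[OF run[OF e(1)]] rad_def[symmetric] \<delta>_def Y_def Z_def)
    qed
    ultimately show ?thesis by blast
  qed
  then show "\<exists>\<epsilon>0>0. \<forall>\<epsilon>. 0 < \<epsilon> \<and> \<epsilon> < \<epsilon>0 \<longrightarrow>
         stoc_complexity P rpd u0 x0 lam0 x_opt \<epsilon>
           \<le> ennreal (complexity_const c lam0 lam_opt (max (smoothed_gap P (rho P 0) x0 lam0) 0 / L_D P)
               * (sqrt (real (cp_n P)) * M_of P / sqrt (cp_mu P * \<epsilon>)
                  * (sqrt (real (cp_n P)) + sqrt ((cp_L P + alpha_of P) / cp_mu P))
                  * ln (real (cp_n P) * M_of P * (cp_L P + alpha_of P) / (cp_mu P * \<epsilon>))))"
    by (simp only: \<delta>_def)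
qed

end
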